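(* Let $b,c\in\mathbb{C}$ with $b\neq0$ and let $f=f_{c,b}:\mathbb{C}^2\to\mathbb{C}^2$ be the complex Hénon map $f_{c,b}(x,y)=(x^2+c-by,\,x)$, with Julia set $J_f$. Then: (i) If $|c|>2(1+|b|)^2$, then $f:J_f\to J_f$ is topologically conjugate to a horseshoe, i.e. to the full two-sided shift on two symbols. (ii) If $c=0$ and $|b|<(\sqrt2-1)/2$, then $f:J_f\to J_f$ is topologically conjugate to the solenoid, i.e. to the natural shift on $\varprojlim(S^1,z\mapsto z^2)$, where $S^1$ is the unit circle. (iii) If $c=-1$ and $|b|<0.02$, then $f:J_f\to J_f$ is topologically conjugate to the inverse limit of the basilica, i.e. to the natural shift on $\varprojlim(J_p,p)$, where $p(z)=z^2-1$ and $J_p\subset\mathbb{C}$ is its Julia set. Moreover, there are explicit maps on orbits which realize these conjugacies.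
   Context: For the Hénon diffeomorphism $f$ of $\mathbb{C}^2$, $K^{\pm}$ is the set of points of $\mathbb{C}^2$ whose forward (respectively backward) orbit under $f$ is bounded, $J^{\pm}=\partial K^{\pm}$, and $J_f=J^+\cap J^-$. *)

theory Defs
  imports "HOL-Analysis.Analysis"
begin

definition bounded_orbit_set :: "('a::metric_space \<Rightarrow> 'a) \<Rightarrow> 'a set"
  where "bounded_orbit_set f = {z. bounded (range (\<lambda>n::nat. (f ^^ n) z))}"

definition henon :: "complex \<Rightarrow> complex \<Rightarrow> complex \<times> complex \<Rightarrow> complex \<times> complex"
  where "henon c b = (\<lambda>(x, y). (x\<^sup>2 + c - b * y, x))"

(* The backward notions use inv f, which is the two-sided inverse only when f is a bijection;
   this is the case for henon c b with b \<noteq> 0. *)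

definition K_plus :: "('a::metric_space \<Rightarrow> 'a) \<Rightarrow> 'a set"
  where "K_plus f = bounded_orbit_set f"

definition K_minus :: "('a::metric_space \<Rightarrow> 'a) \<Rightarrow> 'a set"
  where "K_minus f = bounded_orbit_set (inv f)"

definition J_plus :: "('a::metric_space \<Rightarrow> 'a) \<Rightarrow> 'a set"
  where "J_plus f = frontier (K_plus f)"

definition J_minus :: "('a::metric_space \<Rightarrow> 'a) \<Rightarrow> 'a set"
  where "J_minus f = frontier (K_minus f)"

definition julia2 :: "('a::metric_space \<Rightarrow> 'a) \<Rightarrow> 'a set"
  where "julia2 f = J_plus f \<inter> J_minus f"

(* The Julia set of a polynomial in one variable: the boundary of its filled Julia set. *)
definition julia1 :: "(complex \<Rightarrow> complex) \<Rightarrow> complex set"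
  where "julia1 p = frontier (bounded_orbit_set p)"

definition is_conjugacy ::
  "'a::topological_space set \<Rightarrow> ('a \<Rightarrow> 'a) \<Rightarrow> 'b::topological_space set \<Rightarrow> ('b \<Rightarrow> 'b) \<Rightarrow> ('a \<Rightarrow> 'b) \<Rightarrow> bool"
  where "is_conjugacy X f Y g h \<longleftrightarrow>
    f ` X \<subseteq> X \<and> g ` Y \<subseteq> Y \<and> (\<exists>k. homeomorphism X Y h k) \<and> (\<forall>x\<in>X. h (f x) = g (h x))"

definition topologically_conjugate ::
  "'a::topological_space set \<Rightarrow> ('a \<Rightarrow> 'a) \<Rightarrow> 'b::topological_space set \<Rightarrow> ('b \<Rightarrow> 'b) \<Rightarrow> bool"
  where "topologically_conjugate X f Y g \<longleftrightarrow> (\<exists>h. is_conjugacy X f Y g h)"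

(* The full two-sided shift on two symbols is full_shift on the whole type int \<Rightarrow> bool, which
   carries the product topology of the discrete topology on bool. *)
definition full_shift :: "(int \<Rightarrow> 'a) \<Rightarrow> (int \<Rightarrow> 'a)"
  where "full_shift s = (\<lambda>n. s (n + 1))"

(* Points of the inverse limit are backward orbits (z 0, z 1, ...) with g (z (n+1)) = z n;
   the topology is the one induced by the product topology on nat \<Rightarrow> 'a. *)
definition inverse_limit :: "'a set \<Rightarrow> ('a \<Rightarrow> 'a) \<Rightarrow> (nat \<Rightarrow> 'a) set"
  where "inverse_limit X g = {z. \<forall>n. z n \<in> X \<and> g (z (Suc n)) = z n}"

(* (z 0, z 1, ...) is sent to (g (z 0), z 0, z 1, ...). *)
definition natural_shift :: "('a \<Rightarrow> 'a) \<Rightarrow> (nat \<Rightarrow> 'a) \<Rightarrow> (nat \<Rightarrow> 'a)"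
  where "natural_shift g z = (\<lambda>n. case n of 0 \<Rightarrow> g (z 0) | Suc m \<Rightarrow> z m)"

definition full_orbit :: "('a \<Rightarrow> 'a) \<Rightarrow> 'a \<Rightarrow> int \<Rightarrow> 'a"
  where "full_orbit f z n = (if n \<ge> 0 then (f ^^ nat n) z else (inv f ^^ nat (- n)) z)"

(* The sequence x of first coordinates of the orbit: the orbit itself is
   n \<mapsto> (x n, x (n - 1)), and x (n + 1) = x n ^ 2 + c - b * x (n - 1). *)
definition henon_coord :: "complex \<Rightarrow> complex \<Rightarrow> complex \<times> complex \<Rightarrow> int \<Rightarrow> complex"
  where "henon_coord c b z n = fst (full_orbit (henon c b) z n)"

(* The itinerary of the orbit with respect to the two half-planes bounded by the line through 0
   orthogonal to the square roots of -c. If |c| > 2 (1 + |b|)^2, bounded full orbits never meet that line. *)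
definition horseshoe_map :: "complex \<Rightarrow> complex \<Rightarrow> complex \<times> complex \<Rightarrow> int \<Rightarrow> bool"
  where "horseshoe_map c b z = (\<lambda>n. Re (henon_coord c b z n / csqrt (- c)) > 0)"

(* The solution u of u ^ 2 + c = w that is closest to a (for a \<noteq> 0): csqrt has nonnegative
   real part. *)
definition nearest_preimage :: "complex \<Rightarrow> complex \<Rightarrow> complex \<Rightarrow> complex"
  where "nearest_preimage c a w = a * csqrt ((w - c) / a\<^sup>2)"

(* shadow_approx c k x pulls x k back k times under z ^ 2 + c along the pseudo-orbit
   x (k - 1), ..., x 0. As k tends to infinity this gives the initial point of the orbit of
   z ^ 2 + c that shadows x. *)
primrec shadow_approx :: "complex \<Rightarrow> nat \<Rightarrow> (nat \<Rightarrow> complex) \<Rightarrow> complex"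
  where
    "shadow_approx c 0 x = x 0"
  | "shadow_approx c (Suc k) x = nearest_preimage c (x 0) (shadow_approx c k (\<lambda>i. x (Suc i)))"

definition shadow :: "complex \<Rightarrow> (nat \<Rightarrow> complex) \<Rightarrow> complex"
  where "shadow c x = lim (\<lambda>k. shadow_approx c k x)"

(* Sends the Henon orbit with coordinates x to the orbit (u n) of z ^ 2 + c that shadows it,
   recorded as the point (u 0, u (-1), u (-2), ...) of the inverse limit. *)
definition shadowing_map :: "complex \<Rightarrow> complex \<Rightarrow> complex \<times> complex \<Rightarrow> nat \<Rightarrow> complex"
  where "shadowing_map c b z = (\<lambda>n. shadow c (\<lambda>i. henon_coord c b z (int i - int n)))"

end

theory Submission
  imports Defs "HOL-Complex_Analysis.Complex_Analysis" "HOL-Library.Diagonal_Subsequence"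
begin

text \<open>An orbit of the Henon map is a sequence with \<open>x\<^sub>n\<^sup>2 = x\<^sub>n\<^sub>+\<^sub>1 - c + b x\<^sub>n\<^sub>-\<^sub>1\<close>, that is, an orbit of
  \<open>p(z) = z\<^sup>2 + c\<close> with the noise \<open>e\<^sub>n = b x\<^sub>n\<^sub>-\<^sub>1\<close>. The attracting cycle of \<open>p\<close> (if there is one) has a
  neighbourhood that \<open>p\<close> maps into its interior even with noise of size up to some \<open>k\<close> that exceeds
  \<open>|b| R\<close>, where \<open>R\<close> bounds the coordinates. In the complementary region \<open>U\<close> the square root branches
  of the noisy inverse map discs into \<open>U\<close> with a margin. Hence the linearized equation along an orbit in \<open>U\<close>
  has no bounded solutions, and so the Julia set consists of the orbits in \<open>U\<close>, and a noisy
  orbit has a unique continuation along every holomorphic family of noises.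

  The shadow of an orbit is obtained by scaling its noise down to \<open>0\<close>. Conversely, given an orbit \<open>u\<close>
  of \<open>p\<close> in \<open>U\<close>, the noisy orbit \<open>x(e)\<close> with shadow \<open>u\<close> depends holomorphically on the noise
  \<open>e\<close>, and the Henon orbits with shadow \<open>u\<close> are the fixed points of \<open>e \<mapsto> (b x\<^sub>n\<^sub>-\<^sub>1(e))\<^sub>n\<close>. This is a
  holomorphic map of a polydisc into a smaller one, so it has exactly one fixed point. For the horseshoe, the
  same fixed point theorem applies to the square root branches that an itinerary prescribes.

  The pullback that follows the noise is the one by nearest preimages as long as arguments change
  by less than \<open>\<pi>/2\<close>. For \<open>c = 0\<close> this is a direct estimate, for \<open>c = -1\<close> it follows from the Schwarz lemma
  for functions with values in an annulus.\<close>

text \<open>The obstacle is the lack of Euclidean expansion: each region \<open>U\<close> contains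
  points w with 2 |w| < 1 + |b|, so the linearized equation 2 x_n d_n = d_(n+1) + b d_(n-1) admits
  no direct norm estimate. All hyperbolicity is drawn from holomorphy, through the Schwarz lemma and
  Cauchy estimates: mapping into \<open>U\<close> with a margin acts like a strict contraction.
  Perturbations are therefore always embedded in holomorphic families over a disc. Allowing noise up
  to \<open>k\<close> > |b| R lets the factor t that scales the noise run over a disc of radius k /
  (|b| R) > 1, which has both t = 0 (the orbit of the polynomial) and t = 1 (the given orbit) in its
  interior.

  The second obstacle is that the recursion couples both neighbours: a pullback computes x_n from
  the future, whereas b x_(n-1) belongs to the past. Declaring this term to be independent noise
  decouples the two, at the price of a fixed point problem in infinitely many unknowns. To see that
  the orbit with a given shadow depends holomorphically on the noise, the shadow must be known to
  stay constant along every holomorphic family, which is again a consequence of the linearized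
  equation.\<close>

section \<open>A fixed point theorem for polydiscs\<close>

text \<open>After cancelling |z - w| the claim reads (1 + q) |q - u| \<le> 2 q |1 - u| for u =
  \<open>cnj w * z\<close>, q = \<kappa>^2 and |u| \<le> q, with equality at u = -q. The factor is
  below 1 and is the source of the contraction in the fixed point theorem.\<close>

lemma pseudo_hyperbolic_scale:
  assumes \<kappa>: "0 < \<kappa>" "\<kappa> < 1" and z: "cmod z < \<kappa>" and w: "cmod w < \<kappa>"
  shows "cmod (Moebius_function 0 w z)
    \<le> 2 * \<kappa> / (1 + \<kappa>\<^sup>2) * cmod (Moebius_function 0 (w / of_real \<kappa>) (z / of_real \<kappa>))"
proof -
  define u where "u = cnj w * z"
  define q where "q = \<kappa>\<^sup>2"
  have q: "0 < q" "q < 1" using \<kappa> by (auto simp: q_def power_less_one_iff)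
  have "cmod u = cmod w * cmod z" by (simp add: u_def norm_mult)
  also have "\<dots> \<le> \<kappa> * \<kappa>" using z w \<kappa> by (intro mult_mono) auto
  finally have u: "cmod u \<le> q" by (simp add: q_def power2_eq_square)
  define s where "s = cmod u"
  define x where "x = Re u"
  have xs: "x \<ge> - s" "0 \<le> s" "s \<le> q"
    using abs_Re_le_cmod[of u] u by (auto simp: x_def s_def)
  have s2: "s\<^sup>2 = x\<^sup>2 + (Im u)\<^sup>2" by (simp add: s_def x_def cmod_power2)
  have n1: "(cmod (1 - u))\<^sup>2 = 1 - 2 * x + s\<^sup>2"
    unfolding s2 cmod_power2 by (simp add: x_def power2_eq_square algebra_simps)
  have n2: "(cmod (of_real q - u))\<^sup>2 = q\<^sup>2 - 2 * q * x + s\<^sup>2"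
    unfolding s2 cmod_power2 by (simp add: x_def power2_eq_square algebra_simps)
  \<comment> \<open>A certificate for the difference of the squared sides: both summands are
    nonnegative because x \<ge> -s and s \<le> q, and both vanish in the extremal case u =
    -q.\<close>
  have "4 * q\<^sup>2 * (1 - 2 * x + s\<^sup>2) - (1 + q)\<^sup>2 * (q\<^sup>2 - 2 * q * x + s\<^sup>2)
      = (x + s) * (2 * q * (1 - q)\<^sup>2) + (2 * q * (1 + s) + (1 + q) * (q + s)) * ((q - s) * (1 - q))"
    by (simp add: power2_eq_square algebra_simps)
  moreover have "(x + s) * (2 * q * (1 - q)\<^sup>2) \<ge> 0"
    using xs q by (intro mult_nonneg_nonneg) auto
  moreover have "(2 * q * (1 + s) + (1 + q) * (q + s)) * ((q - s) * (1 - q)) \<ge> 0"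
    using xs q by simp
  ultimately have "(1 + q)\<^sup>2 * (q\<^sup>2 - 2 * q * x + s\<^sup>2) \<le> 4 * q\<^sup>2 * (1 - 2 * x + s\<^sup>2)"
    by linarith
  then have "((1 + q) * cmod (of_real q - u))\<^sup>2 \<le> (2 * q * cmod (1 - u))\<^sup>2"
    unfolding power_mult_distrib n1 n2 by simp
  then have le: "(1 + q) * cmod (of_real q - u) \<le> 2 * q * cmod (1 - u)"
    by (rule power2_le_imp_le) (use q in auto)
  have ne1: "1 - u \<noteq> 0" using u q by (auto simp: s_def dest: arg_cong[of _ _ cmod])
  have "cmod u < q"
    using mult_strict_mono[OF w z] \<kappa> by (simp add: u_def norm_mult q_def power2_eq_square)
  then have ne2: "of_real q - u \<noteq> 0" using q by auto
  have e1: "cmod (Moebius_function 0 w z) = cmod (z - w) / cmod (1 - u)"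
    by (simp add: Moebius_function_simple norm_divide u_def)
  have "Moebius_function 0 (w / of_real \<kappa>) (z / of_real \<kappa>)
      = (z - w) * of_real \<kappa> / (of_real q - u)"
    using \<kappa> ne2 by (simp add: Moebius_function_simple u_def q_def field_simps power2_eq_square)
  then have e2: "cmod (Moebius_function 0 (w / of_real \<kappa>) (z / of_real \<kappa>))
      = cmod (z - w) * \<kappa> / cmod (of_real q - u)"
    using \<kappa> by (simp add: norm_divide norm_mult)
  have p: "cmod (1 - u) > 0" "cmod (of_real q - u) > 0" using ne1 ne2 by auto
  have "1 / cmod (1 - u) \<le> 2 * q / ((1 + q) * cmod (of_real q - u))"
    using le p q by (simp add: divide_simps mult.commute)
  then have "cmod (z - w) * (1 / cmod (1 - u)) \<le> cmod (z - w) * (2 * q / ((1 + q) * cmod (of_real q - u)))"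
    by (intro mult_left_mono) auto
  then show ?thesis
    unfolding e1 e2 by (simp add: q_def power2_eq_square mult_ac)
qed

lemma Schwarz_Pick_0:
  assumes "h holomorphic_on ball 0 1" and "\<And>z. cmod z < 1 \<Longrightarrow> cmod (h z) < 1" and "cmod z < 1"
  shows "cmod (Moebius_function 0 (h 0) (h z)) \<le> cmod z"
proof -
  have h0: "cmod (h 0) < 1" using assms(2)[of 0] by simp
  have "(Moebius_function 0 (h 0) \<circ> h) holomorphic_on ball 0 1"
    by (rule holomorphic_on_compose_gen[OF assms(1) Moebius_function_holomorphic[OF h0]])
      (use assms(2) in auto)
  then have "cmod ((Moebius_function 0 (h 0) \<circ> h) z) \<le> cmod z"
    by (rule Schwarz_Lemma(1))
      (use assms h0 Moebius_function_norm_lt_1 in \<open>auto simp: Moebius_function_eq_zero\<close>)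
  then show ?thesis by simp
qed

text \<open>Contraction is measured by Moebius quotients, convergence by Euclidean distance; this
  comparison and the next translate between them. The reverse one needs both points in a fixed
  smaller disc.\<close>

lemma cmod_diff_le_Moebius:
  assumes "cmod z < 1" "cmod w < 1"
  shows "cmod (z - w) \<le> 2 * cmod (Moebius_function 0 w z)"
proof -
  have "cmod (cnj w * z) < 1" using norm_mult_less[OF assms(2,1)] by (simp add: norm_mult)
  then have "cmod (1 - cnj w * z) \<le> 2" "cmod (1 - cnj w * z) > 0"
    using norm_triangle_ineq4[of 1 "cnj w * z"] by auto
  moreover have "cmod (z - w) * cmod (1 - cnj w * z) \<le> cmod (z - w) * 2"
    using calculation by (intro mult_left_mono) auto
  ultimately show ?thesis
    by (simp add: Moebius_function_simple norm_divide pos_le_divide_eq mult.commute)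
qed

lemma Moebius_le_cmod_diff:
  assumes "cmod z \<le> \<kappa>" "cmod w \<le> \<kappa>" "\<kappa> < 1"
  shows "cmod (Moebius_function 0 w z) \<le> cmod (z - w) / (1 - \<kappa>\<^sup>2)"
proof -
  have k0: "0 \<le> \<kappa>" using assms(1) norm_ge_zero order_trans by blast
  have "cmod (cnj w * z) \<le> \<kappa> * \<kappa>" using assms k0 by (simp add: norm_mult mult_mono)
  moreover have "\<kappa> * \<kappa> < 1" using power_strict_mono[of \<kappa> 1 2] k0 assms(3) by (simp add: power2_eq_square)
  moreover have "1 - cmod (cnj w * z) \<le> cmod (1 - cnj w * z)"
    using norm_triangle_ineq2[of 1 "cnj w * z"] by simp
  ultimately have "1 - \<kappa>\<^sup>2 \<le> cmod (1 - cnj w * z)" "1 - \<kappa>\<^sup>2 > 0"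
    by (auto simp: power2_eq_square)
  then show ?thesis
    by (simp add: Moebius_function_simple norm_divide frac_le)
qed

text \<open>An Earle--Hamilton fixed point theorem: the supremum of the pseudo-hyperbolic distances of the
  coordinates is contracted, because any two points of the polydisc lie on an analytic disc whose
  coordinate functions realize that supremum.\<close>

lemma unit_polydisc_fixed_point:
  fixes G :: "('i \<Rightarrow> complex) \<Rightarrow> 'i \<Rightarrow> complex"
  assumes r: "0 \<le> r" "r < 1"
    and into: "\<And>x i. (\<And>j. cmod (x j) < 1) \<Longrightarrow> cmod (G x i) \<le> r"
    and hol: "\<And>E i. (\<And>j. E j holomorphic_on ball 0 1) \<Longrightarrow> (\<And>j z. cmod z < 1 \<Longrightarrow> cmod (E j z) < 1)
      \<Longrightarrow> (\<lambda>z. G (\<lambda>j. E j z) i) holomorphic_on ball 0 1"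
  shows "\<exists>!x. (\<forall>j. cmod (x j) < 1) \<and> G x = x"
proof -
  \<comment> \<open>A radius strictly between \<open>r\<close> and 1: dividing a coordinate of
    \<open>G\<close> by \<kappa> still lands in the unit disc, and undoing the division gains the
    factor \<theta> < 1.\<close>
  define \<kappa> where "\<kappa> = (r + 1) / 2"
  define \<theta> where "\<theta> = 2 * \<kappa> / (1 + \<kappa>\<^sup>2)"
  have \<kappa>: "0 < \<kappa>" "\<kappa> < 1" "r < \<kappa>" using r by (auto simp: \<kappa>_def)
  have "0 < (1 - \<kappa>)\<^sup>2" using \<kappa> by simp
  then have "2 * \<kappa> < 1 + \<kappa>\<^sup>2" by (simp add: power2_eq_square algebra_simps)
  then have \<theta>: "0 < \<theta>" "\<theta> < 1" using \<kappa> by (auto simp: \<theta>_def add_pos_nonneg field_simps)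
  let ?M = "Moebius_function 0"
  have into': "cmod (G x i) < \<kappa>" if "\<And>j. cmod (x j) < 1" for x i
    using into[of x i] that \<kappa> by force
  have contr: "cmod (?M (G y i) (G x i)) \<le> \<theta> * \<tau>"
    if x: "\<And>j. cmod (x j) < 1" and y: "\<And>j. cmod (y j) < 1"
      and \<tau>: "0 < \<tau>" "\<tau> < 1" and le: "\<And>j. cmod (?M (y j) (x j)) \<le> \<tau>" for x y \<tau> i
  proof -
    \<comment> \<open>Coordinate j is a disc with value \<open>y j\<close> at 0 and
      \<open>x j\<close> at \<tau>. The inner linear factor has modulus at most 1 because \<tau>
      dominates all coordinate distances.\<close>
    define E where "E = (\<lambda>j z. ?M (- y j) (z * (?M (y j) (x j) / of_real \<tau>)))"
    have in1: "cmod (z * (?M (y j) (x j) / of_real \<tau>)) < 1" if "cmod z < 1" for z j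
    proof -
      have "cmod (?M (y j) (x j) / of_real \<tau>) \<le> 1" using le[of j] \<tau> by (simp add: norm_divide)
      then have "cmod (z * (?M (y j) (x j) / of_real \<tau>)) \<le> cmod z * 1"
        unfolding norm_mult by (intro mult_left_mono) auto
      then show ?thesis using that by simp
    qed
    have holE: "E j holomorphic_on ball 0 1" for j
    proof -
      have "(?M (- y j) \<circ> (\<lambda>z. z * (?M (y j) (x j) / of_real \<tau>))) holomorphic_on ball 0 1"
        by (rule holomorphic_on_compose_gen[of _ _ _ "ball 0 1"])
          (use in1 y[of j] in \<open>auto intro!: holomorphic_intros Moebius_function_holomorphic\<close>)
      then show ?thesis by (simp add: E_def o_def)
    qed
    have bE: "cmod (E j z) < 1" if "cmod z < 1" for j z
      unfolding E_def using in1[OF that] y[of j] by (intro Moebius_function_norm_lt_1) auto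
    have E0: "E j 0 = y j" for j by (simp add: E_def Moebius_function_of_zero)
    have E\<tau>: "E j (of_real \<tau>) = x j" for j
      using Moebius_function_compose[of "- y j" "y j" "x j"] \<tau> x y by (simp add: E_def)
    define h where "h = (\<lambda>z. G (\<lambda>j. E j z) i / of_real \<kappa>)"
    have "h holomorphic_on ball 0 1"
      unfolding h_def using hol[of E i] holE bE \<kappa> by (intro holomorphic_intros) auto
    moreover have "cmod (h z) < 1" if "cmod z < 1" for z
      using into'[of "\<lambda>j. E j z" i] bE[OF that] \<kappa> by (simp add: h_def norm_divide)
    ultimately have "cmod (?M (h 0) (h (of_real \<tau>))) \<le> cmod (of_real \<tau>)"
      by (intro Schwarz_Pick_0) (use \<tau> in auto)
    then have "cmod (?M (G y i / of_real \<kappa>) (G x i / of_real \<kappa>)) \<le> \<tau>"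
      using \<tau> by (simp add: h_def E0 E\<tau>)
    then have "\<theta> * cmod (?M (G y i / of_real \<kappa>) (G x i / of_real \<kappa>)) \<le> \<theta> * \<tau>"
      using \<theta> by (intro mult_left_mono) auto
    then show ?thesis
      using pseudo_hyperbolic_scale[OF \<kappa>(1,2) into'[of x i, OF x] into'[of y i, OF y]]
      by (simp add: \<theta>_def)
  qed
  define X where "X = (\<lambda>m. (G ^^ m) (\<lambda>_. 0))"
  have X_Suc: "X (Suc m) = G (X m)" for m by (simp add: X_def)
  have X_lt: "cmod (X m i) < \<kappa>" for m i
  proof (induction m arbitrary: i)
    case 0 show ?case using \<kappa> by (simp add: X_def)
  next
    case (Suc m)
    show ?case unfolding X_Suc by (rule into') (use Suc \<kappa> in \<open>auto intro: less_trans\<close>)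
  qed
  have X_lt1: "cmod (X m i) < 1" for m i using X_lt \<kappa> less_trans by blast
  have step: "cmod (?M (X m i) (X (Suc m) i)) \<le> \<kappa> * \<theta> ^ m" for m i
  proof (induction m arbitrary: i)
    case 0 show ?case using X_lt[of 1 i] by (simp add: X_def Moebius_function_simple)
  next
    case (Suc m)
    have "\<theta> ^ m \<le> 1" using \<theta> by (simp add: power_le_one)
    then have "\<kappa> * \<theta> ^ m \<le> \<kappa> * 1" using \<kappa> by (intro mult_left_mono) auto
    then have "\<kappa> * \<theta> ^ m < 1" using \<kappa> by linarith
    then show ?case
      unfolding X_Suc using contr[of "X (Suc m)" "X m" "\<kappa> * \<theta> ^ m" i, OF X_lt1 X_lt1 _ _ Suc.IH] \<kappa> \<theta>
      by (simp add: X_Suc mult_ac)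
  qed
  have stepd: "dist (X m i) (X (Suc m) i) \<le> 2 * \<kappa> * \<theta> ^ m" for m i
    using cmod_diff_le_Moebius[OF X_lt1 X_lt1, of "Suc m" i m i] step[of m i]
    by (simp add: dist_norm norm_minus_commute)
  have geo: "dist (X m i) (X (m + j) i) \<le> 2 * \<kappa> * \<theta> ^ m / (1 - \<theta>)" for m j i
  proof -
    have "dist (X m i) (X (m + j) i) \<le> 2 * \<kappa> * \<theta> ^ m * (1 - \<theta> ^ j) / (1 - \<theta>)"
    proof (induction j)
      case 0 show ?case by simp
    next
      case (Suc j)
      have "dist (X m i) (X (m + Suc j) i) \<le> dist (X m i) (X (m + j) i) + 2 * \<kappa> * \<theta> ^ (m + j)"
        using dist_triangle[of "X m i" "X (m + Suc j) i" "X (m + j) i"] stepd[of "m + j" i] by simp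
      also have "\<dots> \<le> 2 * \<kappa> * \<theta> ^ m * (1 - \<theta> ^ j) / (1 - \<theta>) + 2 * \<kappa> * \<theta> ^ (m + j)"
        using Suc.IH by simp
      also have "\<dots> = 2 * \<kappa> * \<theta> ^ m * (1 - \<theta> ^ Suc j) / (1 - \<theta>)"
        using \<theta> by (simp add: field_simps power_add)
      finally show ?case .
    qed
    also have "\<dots> \<le> 2 * \<kappa> * \<theta> ^ m / (1 - \<theta>)"
      using \<theta> \<kappa> by (intro divide_right_mono) (auto simp: mult_le_cancel_left1)
    finally show ?thesis .
  qed
  have lim0: "(\<lambda>m. C * \<theta> ^ m) \<longlonglongrightarrow> 0" for C
    using \<theta> by (intro tendsto_mult_right_zero LIMSEQ_realpow_zero) auto
  have "Cauchy (\<lambda>m. X m i)" for i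
  proof (rule metric_CauchyI)
    fix e :: real assume "e > 0"
    obtain M where M: "2 * \<kappa> / (1 - \<theta>) * \<theta> ^ M < e / 2"
      using order_tendstoD(2)[OF lim0[of "2 * \<kappa> / (1 - \<theta>)"], of "e / 2"] \<open>e > 0\<close>
      unfolding eventually_sequentially by (metis half_gt_zero le_refl)
    have "dist (X m i) (X n i) < e" if "m \<ge> M" "n \<ge> M" for m n
      using geo[of M i "m - M"] geo[of M i "n - M"] that M dist_triangle3[of "X m i" "X n i" "X M i"]
      by simp
    then show "\<exists>M. \<forall>m\<ge>M. \<forall>n\<ge>M. dist (X m i) (X n i) < e" by blast
  qed
  then have "\<exists>l. (\<lambda>m. X m i) \<longlonglongrightarrow> l" for i by (simp add: Cauchy_convergent_iff convergent_def)
  then obtain x where x: "\<And>i. (\<lambda>m. X m i) \<longlonglongrightarrow> x i" by metis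
  have x_le: "cmod (x i) \<le> \<kappa>" for i
    by (rule LIMSEQ_le_const2[OF tendsto_norm[OF x]]) (use X_lt less_imp_le in blast)
  then have x_lt: "cmod (x i) < 1" for i using \<kappa> le_less_trans by blast
  \<comment> \<open>The rate does not depend on the coordinate \<open>i\<close>. This matters
    because \<open>contr\<close> asks for one bound \<tau> on all coordinates at once.\<close>
  have xd: "dist (X m i) (x i) \<le> 2 * \<kappa> * \<theta> ^ m / (1 - \<theta>)" for m i
  proof (rule LIMSEQ_le_const2[of "\<lambda>n. dist (X m i) (X n i)"])
    show "(\<lambda>n. dist (X m i) (X n i)) \<longlonglongrightarrow> dist (X m i) (x i)" by (intro tendsto_intros x)
    show "\<exists>N. \<forall>n\<ge>N. dist (X m i) (X n i) \<le> 2 * \<kappa> * \<theta> ^ m / (1 - \<theta>)"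
      using geo[of m i] by (metis le_Suc_ex)
  qed
  define C where "C = 2 * \<kappa> / (1 - \<theta>) / (1 - \<kappa>\<^sup>2)"
  have k2: "1 - \<kappa>\<^sup>2 > 0" using \<kappa> by (simp add: power_less_one_iff)
  have C: "C > 0" using \<kappa> \<theta> k2 by (simp add: C_def)
  have xM: "cmod (?M (x i) (X m i)) \<le> C * \<theta> ^ m" for m i
  proof -
    have "cmod (?M (x i) (X m i)) \<le> cmod (X m i - x i) / (1 - \<kappa>\<^sup>2)"
      by (rule Moebius_le_cmod_diff) (use X_lt x_le \<kappa> less_imp_le in blast)+
    also have "\<dots> \<le> (2 * \<kappa> * \<theta> ^ m / (1 - \<theta>)) / (1 - \<kappa>\<^sup>2)"
      using xd[of m i] k2 by (intro divide_right_mono) (auto simp: dist_norm)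
    finally show ?thesis by (simp add: C_def field_simps)
  qed
  have "G x i = x i" for i
  proof -
    \<comment> \<open>Continuity of \<open>G\<close> along this sequence comes from
      \<open>contr\<close> itself, applied to \<open>X m\<close> and the limit
      \<open>x\<close>.\<close>
    have "(\<lambda>m. X (Suc m) i) \<longlonglongrightarrow> G x i"
    proof (rule metric_LIMSEQ_I)
      fix e :: real assume "e > 0"
      have "\<forall>\<^sub>F m in sequentially. C * \<theta> ^ m < min 1 (e / 2)"
        by (rule order_tendstoD(2)[OF lim0]) (use \<open>e > 0\<close> in auto)
      then obtain N where N: "\<And>m. m \<ge> N \<Longrightarrow> C * \<theta> ^ m < min 1 (e / 2)"
        by (auto simp: eventually_sequentially)
      have "dist (X (Suc m) i) (G x i) < e" if "m \<ge> N" for m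
      proof -
        have "cmod (?M (G x i) (G (X m) i)) \<le> \<theta> * (C * \<theta> ^ m)"
          by (rule contr[OF X_lt1 x_lt _ _ xM]) (use C \<theta> N[OF that] in auto)
        also have "\<dots> \<le> C * \<theta> ^ m" using \<theta> C by (simp add: mult_le_cancel_right1)
        finally have "cmod (?M (G x i) (G (X m) i)) < e / 2" using N[OF that] by simp
        then have "cmod (G (X m) i - G x i) < e"
          using cmod_diff_le_Moebius[of "G (X m) i" "G x i"] into'[of "X m" i, OF X_lt1] into'[of x i, OF x_lt] \<kappa>
          by simp
        then show ?thesis by (simp add: X_Suc dist_norm)
      qed
      then show "\<exists>N. \<forall>n\<ge>N. dist (X (Suc n) i) (G x i) < e" by blast
    qed
    then show ?thesis using LIMSEQ_unique LIMSEQ_Suc[OF x[of i]] by blast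
  qed
  then have fx: "G x = x" by blast
  have uniq: "y = z" if y: "\<And>j. cmod (y j) < 1" "G y = y" and z: "\<And>j. cmod (z j) < 1" "G z = z" for y z
  proof
    fix i
    have y': "cmod (y j) < \<kappa>" for j using into'[of y j] y by simp
    have z': "cmod (z j) < \<kappa>" for j using into'[of z j] z by simp
    \<comment> \<open>The induction starts at \<theta> and not at 1, since \<open>contr\<close>
      requires \<tau> < 1 uniformly over the coordinates. Fixed points lie in the polydisc of radius
      \<kappa>, which provides this start.\<close>
    have le: "cmod (?M (z j) (y j)) \<le> \<theta> ^ Suc m" for m j
    proof (induction m arbitrary: j)
      case 0
      have "cmod (?M (z j / of_real \<kappa>) (y j / of_real \<kappa>)) \<le> 1"
        using y'[of j] z'[of j] \<kappa>
        by (intro less_imp_le Moebius_function_norm_lt_1) (auto simp: norm_divide)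
      then have "\<theta> * cmod (?M (z j / of_real \<kappa>) (y j / of_real \<kappa>)) \<le> \<theta> * 1"
        using \<theta> by (intro mult_left_mono) auto
      then show ?case using pseudo_hyperbolic_scale[OF \<kappa>(1,2) y' z', of j j] by (simp add: \<theta>_def)
    next
      case (Suc m)
      have "cmod (?M (G z j) (G y j)) \<le> \<theta> * \<theta> ^ Suc m"
        by (rule contr[OF y(1) z(1) _ _ Suc.IH]) (use \<theta> in \<open>auto simp: power_less_one_iff simp del: power_Suc\<close>)
      then show ?case using y z by simp
    qed
    have "(\<lambda>m. \<theta> ^ Suc m) \<longlonglongrightarrow> 0"
      using lim0[of 1] by (intro LIMSEQ_Suc) simp
    then have "cmod (?M (z i) (y i)) \<le> 0"
      by (rule LIMSEQ_le_const) (use le in auto)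
    then show "y i = z i"
      using cmod_diff_le_Moebius[OF y(1) z(1), of i i] by auto
  qed
  show ?thesis
    using fx x_lt uniq by blast
qed

text \<open>Rescaling to the unit polydisc. Holomorphy in infinitely many variables is expressed
  through the coordinates along analytic discs, which is the form in which continuation of orbits
  delivers it.\<close>

lemma polydisc_fixed_point:
  fixes G :: "('i \<Rightarrow> complex) \<Rightarrow> 'i \<Rightarrow> complex"
  assumes r: "0 \<le> r'" "r' < r"
    and into: "\<And>x i. (\<And>j. cmod (x j) < r) \<Longrightarrow> cmod (G x i) \<le> r'"
    and hol: "\<And>E i. (\<And>j. E j holomorphic_on ball 0 1) \<Longrightarrow> (\<And>j z. cmod z < 1 \<Longrightarrow> cmod (E j z) < r)
      \<Longrightarrow> (\<lambda>z. G (\<lambda>j. E j z) i) holomorphic_on ball 0 1"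
  shows "\<exists>!x. (\<forall>j. cmod (x j) < r) \<and> G x = x"
proof -
  define H where "H = (\<lambda>x i. G (\<lambda>j. of_real r * x j) i / of_real r)"
  have "\<exists>!x. (\<forall>j. cmod (x j) < 1) \<and> H x = x"
  proof (rule unit_polydisc_fixed_point)
    show "0 \<le> r' / r" "r' / r < 1" using r by auto
    show "cmod (H x i) \<le> r' / r" if "\<And>j. cmod (x j) < 1" for x i
      using into[of "\<lambda>j. of_real r * x j" i] that r
      by (simp add: H_def norm_divide norm_mult divide_right_mono)
    show "(\<lambda>z. H (\<lambda>j. E j z) i) holomorphic_on ball 0 1"
      if "\<And>j. E j holomorphic_on ball 0 1" "\<And>j z. cmod z < 1 \<Longrightarrow> cmod (E j z) < 1" for E i
      unfolding H_def using r that
      by (intro holomorphic_intros hol[of "\<lambda>j z. of_real r * E j z"]) (auto simp: norm_mult)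
  qed
  then obtain x where x: "\<And>j. cmod (x j) < 1" "H x = x"
    and uniq: "\<And>y. (\<forall>j. cmod (y j) < 1) \<and> H y = y \<Longrightarrow> y = x" by blast
  show ?thesis
  proof (rule ex1I[of _ "\<lambda>j. of_real r * x j"])
    have "G (\<lambda>j. of_real r * x j) i = of_real r * x i" for i
      using fun_cong[OF x(2), of i] r by (simp add: H_def field_simps)
    then show "(\<forall>j. cmod (of_real r * x j) < r) \<and> G (\<lambda>j. of_real r * x j) = (\<lambda>j. of_real r * x j)"
      using x(1) r by (auto simp: norm_mult)
  next
    fix y assume y: "(\<forall>j. cmod (y j) < r) \<and> G y = y"
    have "(\<lambda>j. y j / of_real r) = x"
      by (rule uniq) (use y r in \<open>auto simp: H_def norm_divide\<close>)
    then show "y = (\<lambda>j. of_real r * x j)" using r by (auto simp: fun_eq_iff field_simps)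
  qed
qed

section \<open>Pullbacks under quadratic polynomials\<close>

text \<open>The supremum S of the values \<ge> R would satisfy S^2 \<le> C + B S, whereas t (t - B)
  exceeds C from t = R on. The arbitrary index type and the alternative in \<open>step\<close> let
  it serve two-sided orbits, half-orbits cut off at an end (both with B = 1 + |b|) and polynomial
  orbits (B = 1).\<close>

lemma bounded_coupled_orbit_less:
  fixes a :: "'i \<Rightarrow> complex"
  assumes bdd: "bounded (range a)" and R: "C + B * R < R\<^sup>2" "0 < R" "0 \<le> C"
    and step: "\<And>i. cmod (a i) < R \<or> (\<exists>j l. (cmod (a i))\<^sup>2 \<le> C + cmod (a j) + (B - 1) * cmod (a l))"
    and B: "1 \<le> B"
  shows "cmod (a i) < R"
proof (rule ccontr)
  assume "\<not> cmod (a i) < R"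
  define I where "I = {i. R \<le> cmod (a i)}"
  define S where "S = Sup ((\<lambda>i. cmod (a i)) ` I)"
  have iI: "i \<in> I" using \<open>\<not> cmod (a i) < R\<close> by (simp add: I_def)
  obtain K where K: "\<And>i. cmod (a i) \<le> K" using bdd by (auto simp: bounded_iff)
  have bddI: "bdd_above ((\<lambda>i. cmod (a i)) ` I)" using K by (auto intro!: bdd_aboveI)
  have SI: "cmod (a j) \<le> S" if "j \<in> I" for j
    unfolding S_def by (rule cSUP_upper[OF that bddI])
  have RS: "R \<le> S" using SI[OF iI] iI by (simp add: I_def)
  have all: "cmod (a j) \<le> S" for j
    using SI[of j] RS by (cases "j \<in> I") (auto simp: I_def)
  have le: "cmod (a j) \<le> sqrt (C + B * S)" if jI: "j \<in> I" for j
  proof -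
    obtain m l where "(cmod (a j))\<^sup>2 \<le> C + cmod (a m) + (B - 1) * cmod (a l)"
      using step[of j] jI by (auto simp: I_def)
    also have "\<dots> \<le> C + S + (B - 1) * S"
      using all B by (intro add_mono mult_left_mono) auto
    finally show ?thesis by (intro real_le_rsqrt) (simp add: algebra_simps)
  qed
  have "S \<le> sqrt (C + B * S)"
    unfolding S_def by (rule cSUP_least) (use iI le in \<open>auto simp: S_def\<close>)
  then have "S\<^sup>2 \<le> (sqrt (C + B * S))\<^sup>2" using RS R by (intro power_mono) auto
  also have "\<dots> = C + B * S" using R RS B by (intro real_sqrt_pow2 add_nonneg_nonneg mult_nonneg_nonneg) auto
  finally have "S * (S - B) \<le> C" by (simp add: power2_eq_square algebra_simps)
  moreover have "R * (R - B) > C" using R by (simp add: power2_eq_square algebra_simps)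
  moreover have "R * (R - B) > 0" using calculation(2) R by linarith
  then have "R - B > 0" using R by (simp add: zero_less_mult_iff)
  then have "R * (R - B) \<le> S * (S - B)"
    using RS R by (intro mult_mono) auto
  ultimately show False by linarith
qed

lemma holomorphic_sqrt_lift:
  assumes "open S" "convex S" "f holomorphic_on S" "\<And>z. z \<in> S \<Longrightarrow> f z \<noteq> 0"
    and "z0 \<in> S" "a\<^sup>2 = f z0"
  obtains h where "h holomorphic_on S" "\<And>z. z \<in> S \<Longrightarrow> (h z)\<^sup>2 = f z" "h z0 = a"
proof -
  obtain g where g: "g holomorphic_on S" "\<And>z. z \<in> S \<Longrightarrow> f z = (g z)\<^sup>2"
    using simply_connected_eq_holomorphic_sqrt[OF assms(1)] convex_imp_simply_connected[OF assms(2)] assms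
    by blast
  have "g z0 = a \<or> g z0 = - a"
    using g(2)[OF assms(5)] assms(6) by (auto simp: power2_eq_iff)
  then show ?thesis
  proof
    assume "g z0 = a" then show ?thesis using that[of g] g by auto
  next
    assume "g z0 = - a" then show ?thesis
      using that[of "\<lambda>z. - g z"] g by (auto intro: holomorphic_intros)
  qed
qed

text \<open>Both square roots are required to land in \<open>U\<close>, so no branch needs to be
  singled out. The condition \<open>v \<noteq> 0\<close> says that noisy images never hit the
  critical value, hence branches exist over every disc of parameters.\<close>

locale pullback_region =
  fixes c :: complex and U :: "complex set" and R k \<epsilon> :: real
  assumes open_U: "open U" and U_sub: "U \<subseteq> ball 0 R" and \<epsilon>: "0 < \<epsilon>"
    and pull: "\<And>w e v. w \<in> U \<Longrightarrow> cmod e < k \<Longrightarrow> v\<^sup>2 = w - c + e \<Longrightarrow> v \<noteq> 0 \<and> ball v \<epsilon> \<subseteq> U"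
begin

lemma U_norm: "w \<in> U \<Longrightarrow> cmod w < R"
  using U_sub by auto

lemma pull_in: "w \<in> U \<Longrightarrow> cmod e < k \<Longrightarrow> v\<^sup>2 = w - c + e \<Longrightarrow> v \<in> U"
  using pull[of w e v] \<epsilon> by force

lemma pullback_lift:
  assumes S: "open S" "convex S" and g: "g holomorphic_on S" "\<And>z. z \<in> S \<Longrightarrow> g z \<in> U"
    and E: "E holomorphic_on S" "\<And>z. z \<in> S \<Longrightarrow> cmod (E z) < k"
    and a: "z0 \<in> S" "a\<^sup>2 = g z0 - c + E z0"
  obtains h where "h holomorphic_on S" "\<And>z. z \<in> S \<Longrightarrow> (h z)\<^sup>2 = g z - c + E z" "h z0 = a"
    "\<And>z. z \<in> S \<Longrightarrow> ball (h z) \<epsilon> \<subseteq> U" "\<And>z. z \<in> S \<Longrightarrow> h z \<in> U"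
proof -
  have ne: "g z - c + E z \<noteq> 0" if "z \<in> S" for z
    using pull[of "g z" "E z" 0] g(2)[OF that] E(2)[OF that] by auto
  have hol: "(\<lambda>z. g z - c + E z) holomorphic_on S" by (intro holomorphic_intros g E)
  obtain h where h: "h holomorphic_on S" "\<And>z. z \<in> S \<Longrightarrow> (h z)\<^sup>2 = g z - c + E z" "h z0 = a"
    by (rule holomorphic_sqrt_lift[OF S hol, of z0 a]) (use ne a in auto)
  show ?thesis
    by (rule that[OF h]) (use pull pull_in h g E in blast)+
qed

text \<open>Pulling a family of discs back along the orbit leaves a margin \<open>\<epsilon>\<close> to the boundary
  of \<open>U\<close>, so the discs can be dilated by a fixed factor after every step. As a bounded solution of
  the linearized equation is reproduced by the pullback, it would grow beyond the Cauchy bound.\<close>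

lemma linearized_orbit_zero:
  fixes a d \<beta> \<eta> :: "'i \<Rightarrow> complex" and s t :: "'i \<Rightarrow> 'i"
  assumes aU: "\<And>i. a i \<in> U" and noise: "\<And>i z. z \<in> U \<Longrightarrow> cmod (\<beta> i * z + \<eta> i) < k"
    and step: "\<And>i. d i = 0 \<or> (a i)\<^sup>2 = a (s i) - c + (\<beta> i * a (t i) + \<eta> i)
      \<and> 2 * a i * d i = d (s i) + \<beta> i * d (t i)"
    and bdd: "bounded (range d)"
  shows "d i = 0"
proof -
  obtain B where B: "0 < B" "\<And>i. cmod (d i) < B"
  proof -
    obtain B where "0 < B" "\<And>x. x \<in> range d \<Longrightarrow> norm x \<le> B" using bdd unfolding bounded_pos by blast
    then show ?thesis by (intro that[of "B + 1"]) (auto intro!: le_less_trans[of "cmod (d _)" B])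
  qed
  have R: "R > 0" using U_norm[OF aU[of i]] norm_ge_zero le_less_trans by blast
  define \<delta> where "\<delta> = \<epsilon> / (2 * R)"
  have \<delta>: "\<delta> > 0" using \<epsilon> R by (simp add: \<delta>_def)
  \<comment> \<open>Normalized to |D i| < \<epsilon>, so that the affine discs that start the
    induction fit into the margin around \<open>a i\<close>.\<close>
  define D where "D = (\<lambda>i. of_real (\<epsilon> / B) * d i)"
  have Dstep: "D i = 0 \<or> (a i)\<^sup>2 = a (s i) - c + (\<beta> i * a (t i) + \<eta> i)
      \<and> 2 * a i * D i = D (s i) + \<beta> i * D (t i)" for i
  proof (cases "d i = 0")
    case False
    then have "2 * a i * d i = d (s i) + \<beta> i * d (t i)" using step by blast
    then have "of_real (\<epsilon> / B) * (2 * a i * d i) = of_real (\<epsilon> / B) * (d (s i) + \<beta> i * d (t i))" by simp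
    then show ?thesis using step[of i] False by (simp add: D_def algebra_simps)
  qed (simp add: D_def)
  have discs: "\<exists>g. \<forall>i. g i holomorphic_on ball 0 1 \<and> (\<forall>z\<in>ball 0 1. g i z \<in> U) \<and> g i 0 = a i
      \<and> (g i has_field_derivative of_real ((1 + \<delta>) ^ m) * D i) (at 0)" for m
  proof (induction m)
    case 0
    have "a i + z * D i \<in> U" if "cmod z < 1" for i z
    proof (cases "D i = 0")
      case True then show ?thesis using aU by simp
    next
      case False
      have "cmod (D i) = \<epsilon> / B * cmod (d i)" using \<epsilon> B(1) by (simp add: D_def norm_mult norm_divide)
      also have "\<dots> \<le> \<epsilon> / B * B" using B(2)[of i] \<epsilon> B(1) by (intro mult_left_mono) auto
      also have "\<dots> = \<epsilon>" using B(1) by simp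
      finally have "cmod z * cmod (D i) \<le> cmod z * \<epsilon>" by (intro mult_left_mono) auto
      also have "\<dots> < \<epsilon>" using that \<epsilon> by simp
      finally have "a i + z * D i \<in> ball (a i) \<epsilon>" by (simp add: dist_norm norm_mult)
      moreover have "ball (a i) \<epsilon> \<subseteq> U"
        using pull[of "a (s i)" "\<beta> i * a (t i) + \<eta> i" "a i"] Dstep[of i] False aU noise by blast
      ultimately show ?thesis by blast
    qed
    then show ?case
      by (intro exI[of _ "\<lambda>i z. a i + z * D i"])
        (auto intro!: holomorphic_intros derivative_eq_intros)
  next
    case (Suc m)
    let ?q = "of_real ((1 + \<delta>) ^ m) :: complex"
    from Suc obtain g where g: "\<And>i. g i holomorphic_on ball 0 1" "\<And>i z. z \<in> ball 0 1 \<Longrightarrow> g i z \<in> U"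
      "\<And>i. g i 0 = a i" "\<And>i. (g i has_field_derivative ?q * D i) (at 0)" by blast
    have "\<exists>f. f holomorphic_on ball 0 1 \<and> (\<forall>z\<in>ball 0 1. f z \<in> U) \<and> f 0 = a i
      \<and> (f has_field_derivative of_real ((1 + \<delta>) ^ Suc m) * D i) (at 0)" for i
    proof (cases "D i = 0")
      \<comment> \<open>Where the solution vanishes a constant disc suffices and no equation is
        used. This permits cutting the recursion off at the end of a half-orbit.\<close>
      case True
      then show ?thesis using aU by (intro exI[of _ "\<lambda>_. a i"]) auto
    next
      case False
      then have eqs: "(a i)\<^sup>2 = a (s i) - c + (\<beta> i * a (t i) + \<eta> i)"
        "2 * a i * D i = D (s i) + \<beta> i * D (t i)" using Dstep by auto
      obtain h where h: "h holomorphic_on ball 0 1"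
        "\<And>z. z \<in> ball 0 1 \<Longrightarrow> (h z)\<^sup>2 = g (s i) z - c + (\<beta> i * g (t i) z + \<eta> i)" "h 0 = a i"
        "\<And>z. z \<in> ball 0 1 \<Longrightarrow> ball (h z) \<epsilon> \<subseteq> U" "\<And>z. z \<in> ball 0 1 \<Longrightarrow> h z \<in> U"
        by (rule pullback_lift[of "ball 0 1" "g (s i)" "\<lambda>z. \<beta> i * g (t i) z + \<eta> i" 0 "a i"])
          (use g noise eqs in \<open>auto intro!: holomorphic_intros\<close>)
      have a0: "a i \<noteq> 0"
        using pull[of "a (s i)" "\<beta> i * a (t i) + \<eta> i" "a i"] eqs(1) aU noise by blast
      obtain h' where h': "(h has_field_derivative h') (at 0)"
        using holomorphic_derivI[OF h(1) open_ball, of 0] by auto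
      have "((\<lambda>z. (h z)\<^sup>2) has_field_derivative 2 * a i * h') (at 0)"
        using DERIV_power[OF h', of 2] by (simp add: h(3) mult_ac)
      moreover have "((\<lambda>z. g (s i) z - c + (\<beta> i * g (t i) z + \<eta> i)) has_field_derivative
          ?q * D (s i) + \<beta> i * (?q * D (t i))) (at 0)"
        using DERIV_add[OF DERIV_diff[OF g(4)[of "s i"] DERIV_const[of c]]
          DERIV_add[OF DERIV_cmult[OF g(4)[of "t i"], of "\<beta> i"] DERIV_const[of "\<eta> i"]]] by simp
      then have "((\<lambda>z. (h z)\<^sup>2) has_field_derivative ?q * D (s i) + \<beta> i * (?q * D (t i))) (at 0)"
        by (rule has_field_derivative_transform_within_open[of _ _ _ "ball 0 1"]) (use h(2) in auto)
      ultimately have "2 * a i * h' = ?q * D (s i) + \<beta> i * (?q * D (t i))"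
        by (rule DERIV_unique)
      also have "\<dots> = ?q * (D (s i) + \<beta> i * D (t i))" by (simp add: algebra_simps)
      also have "\<dots> = 2 * a i * (?q * D i)" unfolding eqs(2)[symmetric] by simp
      finally have h'_eq: "h' = ?q * D i" using a0 by simp
      \<comment> \<open>The pulled back disc dilated about its centre by 1 + \<delta>. Points of
        \<open>U\<close> are less than 2 R apart, so each value moves by less than \<delta> * 2 R =
        \<epsilon> and stays in the margin, while the derivative gains the factor 1 +
        \<delta>.\<close>
      define f where "f = (\<lambda>z. h z + of_real \<delta> * (h z - a i))"
      have "f z \<in> U" if z: "z \<in> ball 0 1" for z
      proof -
        have "cmod (h z - a i) < R + R"
          using norm_triangle_ineq4[of "h z" "a i"] U_norm[OF h(5)[OF z]] U_norm[OF aU[of i]] by linarith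
        then have "\<delta> * cmod (h z - a i) < \<delta> * (2 * R)" using \<delta> by (intro mult_strict_left_mono) auto
        then have "\<delta> * cmod (h z - a i) < \<epsilon>" using R by (simp add: \<delta>_def)
        then have "f z \<in> ball (h z) \<epsilon>" using \<delta> by (simp add: f_def dist_norm norm_mult)
        then show ?thesis using h(4)[OF z] by blast
      qed
      moreover have "f holomorphic_on ball 0 1" unfolding f_def by (intro holomorphic_intros h(1))
      moreover have "f 0 = a i" by (simp add: f_def h(3))
      moreover have "(f has_field_derivative h' + of_real \<delta> * h') (at 0)"
        using DERIV_add[OF h' DERIV_cmult[OF DERIV_diff[OF h' DERIV_const[of "a i"]], of "of_real \<delta>"]]
        by (simp add: f_def)
      then have "(f has_field_derivative of_real ((1 + \<delta>) ^ Suc m) * D i) (at 0)"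
        by (simp add: h'_eq algebra_simps)
      ultimately show ?thesis by blast
    qed
    then show ?case by (intro choice allI)
  qed
  have bnd: "(1 + \<delta>) ^ m * cmod (D i) \<le> 2 * R" for m
  proof -
    obtain g where g: "g holomorphic_on ball 0 1" "\<And>z. z \<in> ball 0 1 \<Longrightarrow> g z \<in> U"
      "(g has_field_derivative of_real ((1 + \<delta>) ^ m) * D i) (at 0)"
      using discs[of m] by blast
    have "cmod ((deriv ^^ 1) g 0) \<le> fact 1 * R / (1/2) ^ 1"
    proof (rule Cauchy_higher_deriv_bound)
      show "g holomorphic_on ball 0 (1/2)" "continuous_on (cball 0 (1/2)) g"
        using g(1) by (auto intro: holomorphic_on_subset holomorphic_on_imp_continuous_on continuous_on_subset)
      show "g w \<in> ball 0 R" if "w \<in> ball 0 (1/2)" for w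
        using U_norm[OF g(2)[of w]] that by auto
    qed auto
    moreover have "deriv g 0 = of_real ((1 + \<delta>) ^ m) * D i" using g(3) by (rule DERIV_imp_deriv)
    ultimately show ?thesis using \<delta> by (simp add: norm_mult norm_power del: of_real_power of_real_add)
  qed
  show ?thesis
  proof (rule ccontr)
    assume "d i \<noteq> 0"
    then have D0: "cmod (D i) > 0" using \<epsilon> B(1) by (simp add: D_def)
    obtain m where "2 * R / cmod (D i) < (1 + \<delta>) ^ m"
      using real_arch_pow[of "1 + \<delta>" "2 * R / cmod (D i)"] \<delta> by auto
    then show False using bnd[of m] D0 by (simp add: field_simps)
  qed
qed

end

section \<open>Orbits of the Henon map\<close>

lemma int_bounded_image_atLeast:
  fixes x :: "int \<Rightarrow> 'a::metric_space"
  assumes "bounded (x ` {m..})"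
  shows "bounded (x ` {l..})"
proof -
  have "x ` {l..} \<subseteq> x ` {l..m} \<union> x ` {m..}"
    unfolding image_Un[symmetric] by (intro image_mono) auto
  then show ?thesis
    using assms by (meson bounded_Un bounded_subset finite_imp_bounded finite_imageI finite_atLeastAtMost_int)
qed

lemma full_orbit_of_nat: "full_orbit f z (int n) = (f ^^ n) z"
  by (simp add: full_orbit_def)

lemma full_orbit_minus_of_nat: "full_orbit f z (- int n) = (inv f ^^ n) z"
  by (cases "n = 0") (simp_all add: full_orbit_def)

lemma full_orbit_add_1:
  assumes "bij f"
  shows "full_orbit f z (n + 1) = f (full_orbit f z n)"
proof (cases "n \<ge> 0")
  case True
  then show ?thesis by (simp add: full_orbit_def nat_add_distrib)
next
  case False
  define m where "m = nat (- n - 1)"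
  have n: "n = - int (Suc m)" using False by (simp add: m_def)
  have "f (full_orbit f z n) = (inv f ^^ m) z"
    unfolding n full_orbit_minus_of_nat using assms by (simp add: bij_is_surj surj_f_inv_f)
  also have "\<dots> = full_orbit f z (n + 1)"
    using full_orbit_minus_of_nat[of f z m] by (simp add: n)
  finally show ?thesis by simp
qed

lemma full_orbit_0 [simp]: "full_orbit f z 0 = z"
  by (simp add: full_orbit_def)

lemma bij_henon:
  assumes "b \<noteq> 0"
  shows "bij (henon c b)"
  by (rule o_bij[of "\<lambda>(x, y). (y, (y\<^sup>2 + c - x) / b)"]) (use assms in \<open>auto simp: henon_def fun_eq_iff\<close>)

lemma snd_full_orbit_henon:
  assumes "b \<noteq> 0"
  shows "snd (full_orbit (henon c b) z n) = henon_coord c b z (n - 1)"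
  using full_orbit_add_1[OF bij_henon[OF assms], of c z "n - 1"]
  by (simp add: henon_coord_def henon_def split_beta)

lemma full_orbit_henon:
  assumes "b \<noteq> 0"
  shows "full_orbit (henon c b) z n = (henon_coord c b z n, henon_coord c b z (n - 1))"
  using snd_full_orbit_henon[OF assms] by (simp add: henon_coord_def prod_eq_iff)

lemma henon_coord_0 [simp]: "henon_coord c b z 0 = fst z"
  by (simp add: henon_coord_def)

lemma henon_coord_minus_1: "b \<noteq> 0 \<Longrightarrow> henon_coord c b z (- 1) = snd z"
  using snd_full_orbit_henon[of b c z 0] by simp

lemma henon_coord_add_1:
  assumes "b \<noteq> 0"
  shows "henon_coord c b z (n + 1) = (henon_coord c b z n)\<^sup>2 + c - b * henon_coord c b z (n - 1)"
  using full_orbit_add_1[OF bij_henon[OF assms], of c z n]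
  unfolding full_orbit_henon[OF assms] by (simp add: henon_def)

lemma henon_coord_square:
  assumes "b \<noteq> 0"
  shows "(henon_coord c b z n)\<^sup>2 = henon_coord c b z (n + 1) - c + b * henon_coord c b z (n - 1)"
  using henon_coord_add_1[OF assms, of c z n] by simp

text \<open>Turns a two-sided solution of the scalar recursion, as fixed point arguments produce it,
  into a point of the plane. Two consecutive terms propagate in both directions; the backward step
  divides by \<open>b\<close>.\<close>

lemma henon_coord_unique:
  assumes b: "b \<noteq> 0" and x: "\<And>n. (x n)\<^sup>2 = x (n + 1) - c + b * x (n - 1)"
  shows "henon_coord c b (x 0, x (- 1)) n = x n"
proof -
  let ?y = "henon_coord c b (x 0, x (- 1))"
  have "?y n = x n \<and> ?y (n - 1) = x (n - 1)"
  proof (induction n rule: int_induct[where k = 0])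
    case base
    show ?case using henon_coord_minus_1[OF b, of c "(x 0, x (- 1))"] by simp
  next
    case (step1 i)
    then show ?case using henon_coord_add_1[OF b, of c "(x 0, x (- 1))" i] x[of i] by simp
  next
    case (step2 i)
    then have "b * ?y (i - 1 - 1) = b * x (i - 1 - 1)"
      using henon_coord_add_1[OF b, of c "(x 0, x (- 1))" "i - 1"] x[of "i - 1"] by auto
    then show ?case using step2 b by simp
  qed
  then show ?thesis by simp
qed

lemma henon_coord_henon:
  assumes b: "b \<noteq> 0"
  shows "henon_coord c b (henon c b z) n = henon_coord c b z (n + 1)"
proof -
  let ?x = "\<lambda>n. henon_coord c b z (n + 1)"
  have "henon_coord c b (?x 0, ?x (- 1)) n = ?x n"
    by (rule henon_coord_unique[OF b]) (use henon_coord_square[OF b, of c z] in \<open>simp add: algebra_simps\<close>)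
  moreover have "(?x 0, ?x (- 1)) = henon c b z"
    using full_orbit_henon[OF b, of c z 1] full_orbit_of_nat[of "henon c b" z 1] by simp
  ultimately show ?thesis by simp
qed

section \<open>Dependence of the coordinates on the initial point\<close>

lemma continuous_on_henon_coord:
  assumes b: "b \<noteq> 0"
  shows "continuous_on UNIV (\<lambda>z. henon_coord c b z n)"
proof -
  have "continuous_on UNIV (\<lambda>z. henon_coord c b z n) \<and> continuous_on UNIV (\<lambda>z. henon_coord c b z (n - 1))"
  proof (induction n rule: int_induct[where k = 0])
    case base
    then show ?case by (auto simp: henon_coord_minus_1[OF b] intro!: continuous_intros)
  next
    case (step1 i)
    then show ?case by (auto simp: henon_coord_add_1[OF b] intro!: continuous_intros)
  next
    case (step2 i)
    have "henon_coord c b z (i - 1 - 1)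
      = ((henon_coord c b z (i - 1))\<^sup>2 + c - henon_coord c b z i) / b" for z
      using henon_coord_add_1[OF b, of c z "i - 1"] b by (simp add: field_simps)
    then show ?case using step2 b by (auto intro!: continuous_intros)
  qed
  then show ?thesis by simp
qed

text \<open>Restricts the coordinates to the complex line through (x, y) with direction (p, q);
  their t-derivatives are the solutions of the linearized equation used to show that Julia points
  are not interior.\<close>

lemma holomorphic_on_henon_coord:
  assumes b: "b \<noteq> 0"
  shows "(\<lambda>t. henon_coord c b (x + p * t, y + q * t) n) holomorphic_on S"
proof -
  let ?h = "\<lambda>n t. henon_coord c b (x + p * t, y + q * t) n"
  have "?h n holomorphic_on S \<and> ?h (n - 1) holomorphic_on S"
  proof (induction n rule: int_induct[where k = 0])
    case base
    then show ?case by (auto simp: henon_coord_minus_1[OF b] intro!: holomorphic_intros)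
  next
    case (step1 i)
    then show ?case by (auto simp: henon_coord_add_1[OF b] intro!: holomorphic_intros)
  next
    case (step2 i)
    have "henon_coord c b z (i - 1 - 1)
      = ((henon_coord c b z (i - 1))\<^sup>2 + c - henon_coord c b z i) / b" for z
      using henon_coord_add_1[OF b, of c z "i - 1"] b by (simp add: field_simps)
    then show ?case using step2 b by (auto intro!: holomorphic_intros)
  qed
  then show ?thesis by simp
qed

text \<open>The index set starts at -1 because the point itself records the coordinates 0 and
  -1.\<close>

lemma mem_K_plus_henon:
  assumes b: "b \<noteq> 0"
  shows "z \<in> K_plus (henon c b) \<longleftrightarrow> bounded (henon_coord c b z ` {- 1..})"
proof -
  let ?x = "henon_coord c b z"
  have eq: "(henon c b ^^ n) z = (?x (int n), ?x (int n - 1))" for n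
    using full_orbit_henon[OF b, of c z "int n"] by (simp add: full_orbit_of_nat)
  have 1: "int n \<in> {- 1..}" "int n - 1 \<in> {- 1..}" for n by auto
  have 2: "\<exists>n. m = int n \<or> m = int n - 1" if "m \<in> {- 1..}" for m :: int
    using that by (intro exI[of _ "nat (m + 1)"]) auto
  show ?thesis
  proof
    assume "z \<in> K_plus (henon c b)"
    then obtain B where B: "\<And>n. norm (?x (int n), ?x (int n - 1)) \<le> B"
      by (auto simp: K_plus_def bounded_orbit_set_def eq bounded_iff)
    have "norm (?x m) \<le> B" if m: "m \<in> {- 1..}" for m
    proof -
      obtain n where "m = int n \<or> m = int n - 1" using 2[OF m] by blast
      then show ?thesis
        using B[of n] by (auto intro: order_trans[OF norm_fst_le] order_trans[OF norm_snd_le])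
    qed
    then show "bounded (?x ` {- 1..})" by (auto simp: bounded_iff)
  next
    assume "bounded (?x ` {- 1..})"
    then obtain B where B: "\<And>n. n \<in> {- 1..} \<Longrightarrow> norm (?x n) \<le> B" unfolding bounded_iff by blast
    have "norm (?x (int n), ?x (int n - 1)) \<le> B + B" for n
      using norm_Pair_le[of "?x (int n)" "?x (int n - 1)"] B[OF 1(1), of n] B[OF 1(2), of n] by linarith
    then show "z \<in> K_plus (henon c b)"
      by (auto simp: K_plus_def bounded_orbit_set_def eq bounded_iff)
  qed
qed

lemma mem_K_minus_henon:
  assumes b: "b \<noteq> 0"
  shows "z \<in> K_minus (henon c b) \<longleftrightarrow> bounded (henon_coord c b z ` {..0})"
proof -
  let ?x = "henon_coord c b z"
  have eq: "(inv (henon c b) ^^ n) z = (?x (- int n), ?x (- int n - 1))" for n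
    using full_orbit_henon[OF b, of c z "- int n"] by (simp add: full_orbit_minus_of_nat)
  have 1: "- int n \<in> {..0}" "- int n - 1 \<in> {..0}" for n by auto
  have 2: "\<exists>n. m = - int n" if "m \<in> {..0}" for m :: int
    using that by (intro exI[of _ "nat (- m)"]) auto
  show ?thesis
  proof
    assume "z \<in> K_minus (henon c b)"
    then obtain B where B: "\<And>n. norm (?x (- int n), ?x (- int n - 1)) \<le> B"
      by (auto simp: K_minus_def bounded_orbit_set_def eq bounded_iff)
    have "norm (?x m) \<le> B" if m: "m \<in> {..0}" for m
    proof -
      obtain n where "m = - int n" using 2[OF m] by blast
      then show ?thesis using B[of n] by (auto intro: order_trans[OF norm_fst_le])
    qed
    then show "bounded (?x ` {..0})" by (auto simp: bounded_iff)
  next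
    assume "bounded (?x ` {..0})"
    then obtain B where B: "\<And>n. n \<in> {..0} \<Longrightarrow> norm (?x n) \<le> B" unfolding bounded_iff by blast
    have "norm (?x (- int n), ?x (- int n - 1)) \<le> B + B" for n
      using norm_Pair_le[of "?x (- int n)" "?x (- int n - 1)"] B[OF 1(1), of n] B[OF 1(2), of n] by linarith
    then show "z \<in> K_minus (henon c b)"
      by (auto simp: K_minus_def bounded_orbit_set_def eq bounded_iff)
  qed
qed

text \<open>Both \<open>K_plus\<close> and \<open>K_minus\<close> are sets of initial values whose orbit is bounded on a half-line
  \<open>I\<close> of times; there the bound at the endpoint of \<open>I\<close> propagates to all of \<open>I\<close>.\<close>

lemma henon_coord_less_on:
  assumes b: "b \<noteq> 0" and R: "cmod c + (1 + cmod b) * R < R\<^sup>2" "0 < R" "R \<le> R'"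
    and bdd: "bounded (henon_coord c b z ` I)"
    and I: "\<And>n. n \<in> I \<Longrightarrow> cmod (henon_coord c b z n) < R' \<or> n + 1 \<in> I \<and> n - 1 \<in> I"
    and n: "n \<in> I"
  shows "cmod (henon_coord c b z n) < R'"
proof -
  let ?x = "henon_coord c b z"
  \<comment> \<open>The value 0 outside \<open>I\<close> lies below R', so the alternative in the
    coupled estimate covers it.\<close>
  define a where "a = (\<lambda>n. if n \<in> I then ?x n else 0)"
  \<comment> \<open>The escape inequality t (t - (1 + |b|)) > |c| passes from \<open>R\<close> to
    every larger radius by monotonicity.\<close>
  have RB: "R * (R - (1 + cmod b)) > cmod c" using R by (simp add: power2_eq_square algebra_simps)
  then have "R * (R - (1 + cmod b)) > 0" using norm_ge_zero[of c] by linarith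
  then have "R - (1 + cmod b) > 0" using R by (simp add: zero_less_mult_iff)
  then have "R * (R - (1 + cmod b)) \<le> R' * (R' - (1 + cmod b))" using R by (intro mult_mono) auto
  then have R': "cmod c + (1 + cmod b) * R' < R'\<^sup>2" using RB by (simp add: power2_eq_square algebra_simps)
  have "cmod (a n) < R'"
  proof (rule bounded_coupled_orbit_less[where a = a and i = n, OF _ R'])
    have "range a \<subseteq> insert 0 (?x ` I)" by (auto simp: a_def)
    then show "bounded (range a)" using bdd bounded_insert bounded_subset by blast
  next
    fix i
    show "cmod (a i) < R' \<or> (\<exists>j l. (cmod (a i))\<^sup>2 \<le> cmod c + cmod (a j) + (1 + cmod b - 1) * cmod (a l))"
    proof (cases "i \<in> I \<and> \<not> cmod (?x i) < R'")
      case True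
      then have i: "i \<in> I" "i + 1 \<in> I" "i - 1 \<in> I" using I by auto
      have "(cmod (?x i))\<^sup>2 = cmod (?x (i + 1) - c + b * ?x (i - 1))"
        using henon_coord_square[OF b, of c z i] by (simp flip: norm_power)
      also have "\<dots> \<le> cmod c + cmod (?x (i + 1)) + cmod b * cmod (?x (i - 1))"
        using norm_triangle_ineq[of "?x (i + 1) - c" "b * ?x (i - 1)"] norm_triangle_ineq4[of "?x (i + 1)" c]
        by (simp add: norm_mult)
      finally show ?thesis using i by (intro disjI2 exI[of _ "i + 1"] exI[of _ "i - 1"]) (simp add: a_def)
    qed (use R in \<open>auto simp: a_def\<close>)
  qed (use R in auto)
  then show ?thesis using n by (simp add: a_def)
qed

lemma henon_coord_less_forward:
  assumes "b \<noteq> 0" "cmod c + (1 + cmod b) * R < R\<^sup>2" "0 < R" "R \<le> R'"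
    and "z \<in> K_plus (henon c b)" "cmod (snd z) < R'" "n \<ge> - 1"
  shows "cmod (henon_coord c b z n) < R'"
proof (rule henon_coord_less_on[OF assms(1-4), of z "{- 1..}"])
  show "cmod (henon_coord c b z m) < R' \<or> m + 1 \<in> {- 1..} \<and> m - 1 \<in> {- 1..}" if "m \<in> {- 1..}" for m
    using that assms(1,6) by (cases "m = - 1") (auto simp: henon_coord_minus_1)
qed (use assms mem_K_plus_henon in auto)

lemma henon_coord_less_backward:
  assumes "b \<noteq> 0" "cmod c + (1 + cmod b) * R < R\<^sup>2" "0 < R" "R \<le> R'"
    and "z \<in> K_minus (henon c b)" "cmod (fst z) < R'" "n \<le> 0"
  shows "cmod (henon_coord c b z n) < R'"
proof (rule henon_coord_less_on[OF assms(1-4), of z "{..0}"])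
  show "cmod (henon_coord c b z m) < R' \<or> m + 1 \<in> {..0} \<and> m - 1 \<in> {..0}" if "m \<in> {..0}" for m
    using that assms(1,6) by (cases "m = 0") auto
qed (use assms mem_K_minus_henon in auto)

text \<open>The endpoint coordinate \<open>p\<close> alone controls the bound on the half-orbit, so
  the members of a convergent sequence in \<open>K\<close> eventually share one bound R', and this
  bound survives pointwise limits.\<close>

lemma closed_henon_half_orbits:
  assumes b: "b \<noteq> 0" and R: "0 < R"
    and less: "\<And>z R' n. R \<le> R' \<Longrightarrow> z \<in> K \<Longrightarrow> cmod (p z) < R' \<Longrightarrow> n \<in> I \<Longrightarrow> cmod (henon_coord c b z n) < R'"
    and K: "\<And>z. z \<in> K \<longleftrightarrow> bounded (henon_coord c b z ` I)"
    and p: "continuous_on UNIV p"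
  shows "closed K"
proof (unfold closed_sequential_limits, intro allI impI)
  fix Z z assume Z: "(\<forall>j. Z j \<in> K) \<and> Z \<longlonglongrightarrow> z"
  define R' where "R' = max R (cmod (p z) + 1)"
  have "(\<lambda>j. cmod (p (Z j))) \<longlonglongrightarrow> cmod (p z)"
    using Z continuous_on_tendsto_compose[OF p, of Z z] by (intro tendsto_norm) auto
  then have ev: "\<forall>\<^sub>F j in sequentially. cmod (p (Z j)) < R'"
    by (rule order_tendstoD) (simp add: R'_def)
  have "cmod (henon_coord c b z n) \<le> R'" if n: "n \<in> I" for n
  proof (rule tendsto_upperbound)
    show "(\<lambda>j. cmod (henon_coord c b (Z j) n)) \<longlonglongrightarrow> cmod (henon_coord c b z n)"
      using Z continuous_on_tendsto_compose[OF continuous_on_henon_coord[OF b, of c n], of Z z]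
      by (intro tendsto_norm) auto
    show "\<forall>\<^sub>F j in sequentially. cmod (henon_coord c b (Z j) n) \<le> R'"
      using ev by eventually_elim (rule less_imp_le, rule less[OF _ _ _ n], use Z in \<open>auto simp: R'_def\<close>)
  qed simp
  then show "z \<in> K" unfolding K bounded_iff by blast
qed

lemma closed_K_plus_henon:
  assumes "b \<noteq> 0" "cmod c + (1 + cmod b) * R < R\<^sup>2" "0 < R"
  shows "closed (K_plus (henon c b))"
  by (rule closed_henon_half_orbits[of b R _ snd "{- 1..}" c])
    (use assms henon_coord_less_forward mem_K_plus_henon in \<open>auto intro!: continuous_intros\<close>)

lemma closed_K_minus_henon:
  assumes "b \<noteq> 0" "cmod c + (1 + cmod b) * R < R\<^sup>2" "0 < R"
  shows "closed (K_minus (henon c b))"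
  by (rule closed_henon_half_orbits[of b R _ fst "{..0}" c])
    (use assms henon_coord_less_backward mem_K_minus_henon in \<open>auto intro!: continuous_intros\<close>)

section \<open>Julia sets as sets of orbits in a region\<close>

lemma deriv_0_bound:
  assumes "f holomorphic_on ball 0 e" "0 < e" "\<And>t. t \<in> ball 0 e \<Longrightarrow> cmod (f t) < R"
  shows "cmod (deriv f 0) \<le> R / (e / 2)"
proof -
  have "cmod ((deriv ^^ 1) f 0) \<le> fact 1 * R / (e/2) ^ 1"
  proof (rule Cauchy_higher_deriv_bound)
    show "f holomorphic_on ball 0 (e/2)" "continuous_on (cball 0 (e/2)) f"
      using assms(1,2)
      by (auto intro!: holomorphic_on_subset[OF assms(1)] continuous_on_subset[OF holomorphic_on_imp_continuous_on[OF assms(1)]])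
    show "f w \<in> ball 0 R" if "w \<in> ball 0 (e/2)" for w
      using assms(3)[of w] that assms(2) by auto
  qed (use assms in auto)
  then show ?thesis by simp
qed

text \<open>The condition \<open>escape\<close> makes \<open>R\<close> an a priori bound for bounded
  orbits. In \<open>trap\<close> the interior makes capture an open condition, so that captured
  points are interior to \<open>K_plus\<close>; if \<open>U\<close> is the whole ball,
  \<open>trap\<close> is vacuous.\<close>

locale henon_region = pullback_region +
  fixes b :: complex
  assumes b: "b \<noteq> 0" and R: "0 < R" and b_R: "cmod b * R < k"
    and escape: "cmod c + (1 + cmod b) * R < R\<^sup>2"
    and trap: "\<And>x y. x \<in> ball 0 R - U \<Longrightarrow> cmod y < R \<Longrightarrow> x\<^sup>2 + c - b * y \<in> interior (ball 0 R - U)"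
begin

lemma noise_less: "z \<in> U \<Longrightarrow> cmod (b * z) < cmod b * R"
  using U_norm[of z] b by (simp add: norm_mult)

lemma julia2_subset_K:
  "julia2 (henon c b) \<subseteq> K_plus (henon c b) \<inter> K_minus (henon c b)"
  using frontier_subset_closed[OF closed_K_plus_henon[OF b escape R]]
    frontier_subset_closed[OF closed_K_minus_henon[OF b escape R]]
  by (auto simp: julia2_def J_plus_def J_minus_def)

lemma bounded_orbit_less:
  assumes "z \<in> K_plus (henon c b)" "z \<in> K_minus (henon c b)"
  shows "cmod (henon_coord c b z n) < R"
proof (rule henon_coord_less_on[OF b escape R order_refl, of z UNIV])
  have "henon_coord c b z ` UNIV = henon_coord c b z ` {- 1..} \<union> henon_coord c b z ` {..0}"
    unfolding image_Un[symmetric] by (rule arg_cong[of _ _ "image _"]) auto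
  then show "bounded (range (henon_coord c b z))"
    using assms by (simp add: mem_K_plus_henon[OF b] mem_K_minus_henon[OF b])
qed auto

text \<open>One step after leaving \<open>U\<close> the coordinate lies in an open set, a property
  shared by nearby initial points. That set is forward invariant because the previous coordinate,
  which acts as noise, also stays in the ball.\<close>

lemma trapped_interior_K_plus:
  assumes "henon_coord c b z n \<in> ball 0 R - U" "cmod (henon_coord c b z (n - 1)) < R"
  shows "z \<in> interior (K_plus (henon c b))"
proof -
  define W where "W = interior (ball 0 R - U)"
  \<comment> \<open>The first condition is the capture at time n + 1, the second bounds the noise in
    the step from n + 1 to n + 2.\<close>
  define V where "V = {z'. henon_coord c b z' (n + 1) \<in> W} \<inter> {z'. henon_coord c b z' n \<in> ball 0 R}"
  have WR: "w \<in> W \<Longrightarrow> w \<in> ball 0 R - U" for w unfolding W_def using interior_subset by blast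
  have op: "open {z'. henon_coord c b z' m \<in> A}" if "open A" for A m
    using open_vimage[OF that continuous_on_henon_coord[OF b, of c m]] by (simp add: vimage_def)
  have "open V" unfolding V_def W_def by (intro open_Int op) auto
  moreover have "z \<in> V"
    using trap[OF assms] assms by (simp add: V_def W_def henon_coord_add_1[OF b])
  moreover have "V \<subseteq> K_plus (henon c b)"
  proof
    fix z' assume z': "z' \<in> V"
    let ?x = "henon_coord c b z'"
    have in_W: "?x (n + 1 + int m) \<in> W \<and> ?x (n + int m) \<in> ball 0 R" for m
    proof (induction m)
      case 0 then show ?case using z' by (simp add: V_def)
    next
      case (Suc m)
      have "?x (n + 1 + int m + 1) \<in> W"
        unfolding henon_coord_add_1[OF b, of _ _ "n + 1 + int m"] W_def
        by (rule trap) (use Suc WR in \<open>auto simp: W_def\<close>)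
      then show ?case using Suc WR by (auto simp: algebra_simps)
    qed
    have "?x m \<in> ball 0 R" if "m \<in> {n..}" for m
      using in_W[of "nat (m - n)"] that by auto
    then have "bounded (?x ` {n..})" by (intro bounded_subset[OF bounded_ball[of 0 R]]) auto
    then show "z' \<in> K_plus (henon c b)"
      unfolding mem_K_plus_henon[OF b] by (rule int_bounded_image_atLeast)
  qed
  ultimately show ?thesis by (meson interiorI)
qed

lemma julia2_in_U:
  assumes "z \<in> julia2 (henon c b)"
  shows "henon_coord c b z n \<in> U"
proof (rule ccontr)
  assume "henon_coord c b z n \<notin> U"
  moreover have "cmod (henon_coord c b z m) < R" for m
    using bounded_orbit_less julia2_subset_K assms by blast
  ultimately have "z \<in> interior (K_plus (henon c b))"
    by (intro trapped_interior_K_plus[of z n]) auto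
  then show False using assms by (auto simp: julia2_def J_plus_def frontier_def)
qed

text \<open>A uniform bound on the perturbed half-orbits bounds their t-derivatives by Cauchy's
  estimate, which gives a bounded solution of the linearized equation along an orbit in
  \<open>U\<close>. The condition on \<open>I\<close> permits extending it by 0 beyond the
  half-line.\<close>

lemma bounded_perturbation_deriv_zero:
  assumes xU: "\<And>n. henon_coord c b (x, y) n \<in> U" and e: "0 < e"
    and bnd: "\<And>n t. n \<in> I \<Longrightarrow> t \<in> ball 0 e \<Longrightarrow> cmod (henon_coord c b (x + p * t, y + q * t) n) < R"
    and I: "\<And>n. n \<in> I \<Longrightarrow> deriv (\<lambda>t. henon_coord c b (x + p * t, y + q * t) n) 0 = 0
      \<or> n + 1 \<in> I \<and> n - 1 \<in> I"
    and n: "n \<in> I"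
  shows "deriv (\<lambda>t. henon_coord c b (x + p * t, y + q * t) n) 0 = 0"
proof -
  define h where "h = (\<lambda>n t. henon_coord c b (x + p * t, y + q * t) n)"
  define d where "d = (\<lambda>n. if n \<in> I then deriv (h n) 0 else 0)"
  have hol: "h m holomorphic_on S" for m S
    unfolding h_def by (rule holomorphic_on_henon_coord[OF b])
  have der: "(h m has_field_derivative deriv (h m) 0) (at 0)" for m
    using holomorphic_derivI[OF hol open_UNIV, of 0 m] by simp
  have h0: "h m 0 = henon_coord c b (x, y) m" for m by (simp add: h_def)
  have lin: "2 * h m 0 * deriv (h m) 0 = deriv (h (m + 1)) 0 + b * deriv (h (m - 1)) 0" for m
  proof (rule DERIV_unique)
    show "((\<lambda>t. (h m t)\<^sup>2) has_field_derivative 2 * h m 0 * deriv (h m) 0) (at 0)"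
      using DERIV_power[OF der[of m], of 2] by (simp add: mult_ac)
    have "((\<lambda>t. h (m + 1) t - c + b * h (m - 1) t) has_field_derivative
        deriv (h (m + 1)) 0 + b * deriv (h (m - 1)) 0) (at 0)"
      using DERIV_add[OF DERIV_diff[OF der[of "m + 1"] DERIV_const[of c]] DERIV_cmult[OF der[of "m - 1"], of b]]
      by simp
    then show "((\<lambda>t. (h m t)\<^sup>2) has_field_derivative
        deriv (h (m + 1)) 0 + b * deriv (h (m - 1)) 0) (at 0)"
      by (simp add: h_def henon_coord_square[OF b])
  qed
  have I': "deriv (h m) 0 = 0 \<or> m + 1 \<in> I \<and> m - 1 \<in> I" if "m \<in> I" for m
    using I[OF that] by (simp add: h_def)
  have "d n = 0"
  proof (rule linearized_orbit_zero[of "\<lambda>m. h m 0" "\<lambda>_. b" "\<lambda>_. 0" d "\<lambda>m. m + 1" "\<lambda>m. m - 1"])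
    show "h m 0 \<in> U" for m unfolding h0 by (rule xU)
    show "cmod (b * z + 0) < k" if "z \<in> U" for z using noise_less[OF that] b_R by simp
    show "d m = 0 \<or> (h m 0)\<^sup>2 = h (m + 1) 0 - c + (b * h (m - 1) 0 + 0)
        \<and> 2 * h m 0 * d m = d (m + 1) + b * d (m - 1)" for m
      using I'[of m] lin[of m] henon_coord_square[OF b, of c "(x, y)" m]
      by (auto simp: d_def h0)
    have "cmod (d m) \<le> R / (e / 2)" for m
      using deriv_0_bound[OF hol[of m] e, of R] bnd[of m] R e by (auto simp: d_def h_def)
    then show "bounded (range d)" by (auto simp: bounded_iff)
  qed
  then show ?thesis using n by (simp add: d_def h_def)
qed

lemma in_U_not_interior:
  assumes xU: "\<And>n. henon_coord c b z n \<in> U"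
  shows "z \<notin> interior (K_plus (henon c b))" "z \<notin> interior (K_minus (henon c b))"
proof -
  obtain x y where z: "z = (x, y)" by (cases z)
  have xR: "cmod x < R" and yR: "cmod y < R"
    using U_norm[OF xU[of 0]] U_norm[OF xU[of "- 1"]] by (auto simp: z henon_coord_minus_1[OF b])
  show "z \<notin> interior (K_plus (henon c b))"
  proof
    assume "z \<in> interior (K_plus (henon c b))"
    then obtain e where e: "0 < e" "ball z e \<subseteq> K_plus (henon c b)" by (auto simp: mem_interior)
    \<comment> \<open>Moving x alone fixes coordinate -1, so the recursion may be cut off there; but
      coordinate 0 is x + t, with derivative 1.\<close>
    have "deriv (\<lambda>t. henon_coord c b (x + 1 * t, y + 0 * t) 0) 0 = 0"
    proof (rule bounded_perturbation_deriv_zero[of x y e "{- 1..}"])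
      show "cmod (henon_coord c b (x + 1 * t, y + 0 * t) n) < R" if "n \<in> {- 1..}" "t \<in> ball 0 e" for n t
        by (rule henon_coord_less_forward[OF b escape R order_refl])
          (use e that yR in \<open>auto simp: z dist_Pair_Pair dist_norm\<close>)
      show "deriv (\<lambda>t. henon_coord c b (x + 1 * t, y + 0 * t) n) 0 = 0 \<or> n + 1 \<in> {- 1..} \<and> n - 1 \<in> {- 1..}"
        if "n \<in> {- 1..}" for n using that by (cases "n = - 1") (auto simp: henon_coord_minus_1[OF b])
    qed (use xU e in \<open>auto simp: z\<close>)
    then show False by simp
  qed
  show "z \<notin> interior (K_minus (henon c b))"
  proof
    assume "z \<in> interior (K_minus (henon c b))"
    then obtain e where e: "0 < e" "ball z e \<subseteq> K_minus (henon c b)" by (auto simp: mem_interior)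
    \<comment> \<open>The mirror image: moving y alone fixes coordinate 0, where the backward
      half-line ends, but coordinate -1 is y + t.\<close>
    have "deriv (\<lambda>t. henon_coord c b (x + 0 * t, y + 1 * t) (- 1)) 0 = 0"
    proof (rule bounded_perturbation_deriv_zero[of x y e "{..0}"])
      show "cmod (henon_coord c b (x + 0 * t, y + 1 * t) n) < R" if "n \<in> {..0}" "t \<in> ball 0 e" for n t
        by (rule henon_coord_less_backward[OF b escape R order_refl])
          (use e that xR in \<open>auto simp: z dist_Pair_Pair dist_norm\<close>)
      show "deriv (\<lambda>t. henon_coord c b (x + 0 * t, y + 1 * t) n) 0 = 0 \<or> n + 1 \<in> {..0} \<and> n - 1 \<in> {..0}"
        if "n \<in> {..0}" for n using that by (cases "n = 0") auto
    qed (use xU e in \<open>auto simp: z\<close>)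
    then show False by (simp add: henon_coord_minus_1[OF b])
  qed
qed

lemma julia2_henon: "julia2 (henon c b) = {z. \<forall>n. henon_coord c b z n \<in> U}"
proof (intro equalityI subsetI)
  fix z assume "z \<in> {z. \<forall>n. henon_coord c b z n \<in> U}"
  then have xU: "\<And>n. henon_coord c b z n \<in> U" by blast
  have bdd: "bounded (henon_coord c b z ` I)" for I
    using xU U_norm by (auto simp: bounded_iff intro!: exI[of _ R] less_imp_le)
  then have "z \<in> K_plus (henon c b)" "z \<in> K_minus (henon c b)"
    by (simp_all add: mem_K_plus_henon[OF b] mem_K_minus_henon[OF b])
  then show "z \<in> julia2 (henon c b)"
    using in_U_not_interior[OF xU] closure_subset
    by (auto simp: julia2_def J_plus_def J_minus_def frontier_def)
qed (use julia2_in_U in blast)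

lemma compact_julia2: "compact (julia2 (henon c b))"
proof -
  have "closed (julia2 (henon c b))"
    by (auto simp: julia2_def J_plus_def J_minus_def)
  moreover have "norm z \<le> R + R" if "z \<in> julia2 (henon c b)" for z
  proof -
    have "cmod (fst z) < R" "cmod (snd z) < R"
      using U_norm[OF julia2_in_U[OF that, of 0]] U_norm[OF julia2_in_U[OF that, of "- 1"]]
      by (auto simp: henon_coord_minus_1[OF b])
    then show ?thesis using norm_Pair_le[of "fst z" "snd z"] by simp
  qed
  then have "bounded (julia2 (henon c b))" unfolding bounded_iff by blast
  ultimately show ?thesis by (simp add: compact_eq_bounded_closed)
qed

text \<open>The argument for the Henon map repeated with zero noise: capture uses
  \<open>trap\<close> with y = 0, and the derivatives of the iterates solve the linearized equation
  without the term from the past.\<close>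

lemma julia1_quadratic:
  "julia1 (\<lambda>z. z\<^sup>2 + c) = {z. \<forall>n. ((\<lambda>z. z\<^sup>2 + c) ^^ n) z \<in> U}"
proof -
  define p where "p = (\<lambda>z. z\<^sup>2 + c)"
  define K where "K = bounded_orbit_set p"
  have "(1 + cmod b) * R = R + cmod b * R" "0 \<le> cmod b * R" using R by (simp_all add: algebra_simps)
  then have escape': "cmod c + 1 * R < R\<^sup>2" using escape by linarith
  have psuc: "((p ^^ n) z)\<^sup>2 = (p ^^ Suc n) z - c" for n z by (simp add: p_def)
  have less: "cmod ((p ^^ n) z) < R" if "z \<in> K" for z n
  proof (rule bounded_coupled_orbit_less[where a = "\<lambda>n. (p ^^ n) z" and i = n, OF _ escape'])
    show "bounded (range (\<lambda>n. (p ^^ n) z))" using that by (simp add: K_def bounded_orbit_set_def)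
    fix i
    have "(cmod ((p ^^ i) z))\<^sup>2 = cmod ((p ^^ Suc i) z - c)" by (simp only: psuc flip: norm_power)
    also have "\<dots> \<le> cmod c + cmod ((p ^^ Suc i) z)"
      using norm_triangle_ineq4[of "(p ^^ Suc i) z" c] by simp
    finally show "cmod ((p ^^ i) z) < R \<or> (\<exists>j l. (cmod ((p ^^ i) z))\<^sup>2
        \<le> cmod c + cmod ((p ^^ j) z) + (1 - 1) * cmod ((p ^^ l) z))"
      by (intro disjI2 exI[of _ "Suc i"] exI[of _ 0]) simp
  qed (use R in auto)
  have K_iff: "z \<in> K \<longleftrightarrow> (\<forall>n. cmod ((p ^^ n) z) \<le> R)" for z
    using less less_imp_le by (auto simp: K_def bounded_orbit_set_def bounded_iff)
  have cont: "continuous_on UNIV (p ^^ n)" for n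
    by (induction n) (auto simp: p_def intro!: continuous_intros)
  have hol: "(\<lambda>t. (p ^^ n) (z + t)) holomorphic_on S" for n z S
    by (induction n) (auto simp: p_def intro!: holomorphic_intros)
  have "K = (\<Inter>n. (p ^^ n) -` cball 0 R)" using K_iff by auto
  then have "closed K" using cont by (auto intro!: closed_INT continuous_closed_vimage continuous_on_imp_continuous_within simp: continuous_on_eq_continuous_at)
  have "z \<notin> julia1 p" if z: "(p ^^ n) z \<notin> U" for z n
  proof
    assume "z \<in> julia1 p"
    then have zK: "z \<in> K" and zi: "z \<notin> interior K"
      using frontier_subset_closed[OF \<open>closed K\<close>] by (auto simp: julia1_def K_def frontier_def)
    define W where "W = interior (ball 0 R - U)"
    have trap': "p x \<in> W" if "x \<in> ball 0 R - U" for x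
      using trap[OF that, of 0] R by (simp add: p_def W_def)
    have WR: "w \<in> W \<Longrightarrow> w \<in> ball 0 R - U" for w unfolding W_def using interior_subset by blast
    have "open ((p ^^ Suc n) -` W)"
      by (rule open_vimage[OF _ cont[of "Suc n"]]) (simp add: W_def)
    moreover have "z \<in> (p ^^ Suc n) -` W" using trap'[of "(p ^^ n) z"] less[OF zK, of n] z by simp
    moreover have "(p ^^ Suc n) -` W \<subseteq> K"
    proof
      fix z' assume "z' \<in> (p ^^ Suc n) -` W"
      then have "(p ^^ (Suc n + m)) z' \<in> W" for m
      proof (induction m)
        case (Suc m)
        then have "p ((p ^^ (Suc n + m)) z') \<in> W" by (intro trap' WR)
        then show ?case by simp
      qed simp
      then have "(p ^^ m) z' \<in> ball 0 R" if "m \<ge> Suc n" for m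
        using that WR by (metis DiffD1 le_Suc_ex)
      then have "bounded ((\<lambda>m. (p ^^ m) z') ` {Suc n..})"
        by (intro bounded_subset[OF bounded_ball[of 0 R]]) auto
      moreover have "bounded ((\<lambda>m. (p ^^ m) z') ` {..n})" by (simp add: finite_imp_bounded)
      moreover have "UNIV = {..n} \<union> {Suc n..}" by auto
      ultimately show "z' \<in> K" unfolding K_def bounded_orbit_set_def by (metis bounded_Un image_Un mem_Collect_eq)
    qed
    ultimately show False using zi by (meson interiorI)
  qed
  moreover have "z \<in> julia1 p" if zU: "\<And>n. (p ^^ n) z \<in> U" for z
  proof -
    have "z \<in> K" using zU U_norm less_imp_le by (auto simp: K_iff)
    moreover have "z \<notin> interior K"
    proof
      assume "z \<in> interior K"
      then obtain e where e: "0 < e" "ball z e \<subseteq> K" by (auto simp: mem_interior)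
      define h where "h = (\<lambda>n t. (p ^^ n) (z + t))"
      have der: "(h m has_field_derivative deriv (h m) 0) (at 0)" for m
        unfolding h_def using holomorphic_derivI[OF hol open_UNIV, of 0 m] by simp
      have "deriv (h 0) 0 = 0"
      proof (rule linearized_orbit_zero[of "\<lambda>m. (p ^^ m) z" "\<lambda>_. 0" "\<lambda>_. 0" "\<lambda>m. deriv (h m) 0" Suc id])
        show "cmod (0 * w + 0) < k" for w
          using le_less_trans[OF mult_nonneg_nonneg[of "cmod b" R] b_R] R by simp
        show "deriv (h m) 0 = 0 \<or> ((p ^^ m) z)\<^sup>2 = (p ^^ Suc m) z - c + (0 * (p ^^ id m) z + 0)
            \<and> 2 * (p ^^ m) z * deriv (h m) 0 = deriv (h (Suc m)) 0 + 0 * deriv (h (id m)) 0" for m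
        proof -
          have "2 * h m 0 * deriv (h m) 0 = deriv (h (Suc m)) 0"
          proof (rule DERIV_unique)
            show "((\<lambda>t. (h m t)\<^sup>2) has_field_derivative 2 * h m 0 * deriv (h m) 0) (at 0)"
              using DERIV_power[OF der[of m], of 2] by (simp add: mult_ac)
            have "((\<lambda>t. h (Suc m) t - c) has_field_derivative deriv (h (Suc m)) 0) (at 0)"
              using DERIV_diff[OF der[of "Suc m"] DERIV_const[of c]] by simp
            then show "((\<lambda>t. (h m t)\<^sup>2) has_field_derivative deriv (h (Suc m)) 0) (at 0)"
              by (simp only: h_def psuc)
          qed
          then show ?thesis using psuc[of m z] by (simp add: h_def)
        qed
        have "cmod (deriv (h m) 0) \<le> R / (e / 2)" for m
        proof (rule deriv_0_bound[OF _ e(1)])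
          show "h m holomorphic_on ball 0 e" unfolding h_def by (rule hol)
          show "cmod (h m t) < R" if "t \<in> ball 0 e" for t
            unfolding h_def by (rule less) (use e that in \<open>auto simp: dist_norm\<close>)
        qed
        then show "bounded (range (\<lambda>m. deriv (h m) 0))" by (auto simp: bounded_iff)
      qed (rule zU)
      then show False by (simp add: h_def)
    qed
    ultimately show ?thesis using closure_subset by (auto simp: julia1_def K_def frontier_def)
  qed
  ultimately show ?thesis by (auto simp: p_def)
qed

end

section \<open>Continuation of noisy orbits\<close>

context pullback_region
begin

text \<open>One-sided sequences suffice since a pullback uses only the future; all dependence on the
  past is hidden in the noise \<open>E\<close>.\<close>

definition solution_family :: "complex set \<Rightarrow> (nat \<Rightarrow> complex \<Rightarrow> complex) \<Rightarrow> (nat \<Rightarrow> complex \<Rightarrow> complex) \<Rightarrow> bool"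
  where "solution_family S E v \<longleftrightarrow> (\<forall>i. v i holomorphic_on S \<and>
    (\<forall>t\<in>S. v i t \<in> U \<and> (v i t)\<^sup>2 = v (Suc i) t - c + E i t))"

lemma solution_family_shift:
  "solution_family S E v \<Longrightarrow> solution_family S (\<lambda>i. E (n + i)) (\<lambda>i. v (n + i))"
  by (simp add: solution_family_def)

text \<open>The lowest nonvanishing derivatives of the difference of two families solve the linearized
  equation.\<close>

lemma solution_family_unique:
  assumes S: "open S" "connected S" "p \<in> S"
    and E: "\<And>i. cmod (E i p) < k"
    and v: "solution_family S E v" and w: "solution_family S E w"
    and eq: "\<And>i. v i p = w i p" and t: "t \<in> S"
  shows "v i t = w i t"
proof -
  have hol: "v i holomorphic_on S" "w i holomorphic_on S" for i
    using v w by (auto simp: solution_family_def)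
  have vU: "v i z \<in> U" "w i z \<in> U" if "z \<in> S" for i z
    using v w that by (auto simp: solution_family_def)
  have rec: "(v i z)\<^sup>2 = v (Suc i) z - c + E i z" "(w i z)\<^sup>2 = w (Suc i) z - c + E i z" if "z \<in> S" for i z
    using v w that by (auto simp: solution_family_def)
  define D where "D = (\<lambda>i z. v i z - w i z)"
  define s where "s = (\<lambda>i z. v i z + w i z)"
  have holD: "D i holomorphic_on S" and hols: "s i holomorphic_on S" for i
    unfolding D_def s_def by (intro holomorphic_intros hol)+
  have Dstep: "D i z * s i z = D (Suc i) z" if "z \<in> S" for i z
  proof -
    have "D i z * s i z = (v i z)\<^sup>2 - (w i z)\<^sup>2"
      by (simp add: D_def s_def algebra_simps power2_eq_square)
    then show ?thesis unfolding rec[OF that, of i] by (simp add: D_def)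
  qed
  obtain r where r: "0 < r" "cball p r \<subseteq> S" using S open_contains_cball by blast
  have "(deriv ^^ m) (D i) p = 0" for m i
  proof (induction m arbitrary: i rule: less_induct)
    case (less m)
    let ?d = "\<lambda>i. (deriv ^^ m) (D i) p"
    have lin: "2 * v i p * ?d i = ?d (Suc i)" for i
    proof -
      have "?d (Suc i) = (deriv ^^ m) (\<lambda>z. D i z * s i z) p"
        by (rule higher_deriv_transform_within_open[OF holD _ S(1,3)])
          (use Dstep hols holD in \<open>auto intro!: holomorphic_intros\<close>)
      also have "\<dots> = (\<Sum>j=0..m. of_nat (m choose j) * (deriv ^^ j) (D i) p * (deriv ^^ (m - j)) (s i) p)"
        by (rule higher_deriv_mult[OF holD hols S(1,3)])
      \<comment> \<open>In Leibniz' rule only j = m survives because the lower derivatives of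
        \<open>D i\<close> vanish at p. The remaining factor is the sum \<open>s i p\<close> = 2
        \<open>v i p\<close>.\<close>
      also have "\<dots> = (\<Sum>j\<in>{m}. of_nat (m choose j) * (deriv ^^ j) (D i) p * (deriv ^^ (m - j)) (s i) p)"
        by (rule sum.mono_neutral_right) (use less in auto)
      finally show ?thesis by (simp add: s_def eq[symmetric])
    qed
    show ?case
    proof (cases "m = 0")
      case True then show ?thesis by (simp add: D_def eq)
    next
      case False
      show ?thesis
      proof (rule linearized_orbit_zero[of "\<lambda>i. v i p" "\<lambda>_. 0" "\<lambda>i. E i p" ?d Suc id])
        show "v i p \<in> U" for i by (rule vU[OF S(3)])
        show "cmod (0 * z + E i p) < k" for i z using E by simp
        show "?d i = 0 \<or> (v i p)\<^sup>2 = v (Suc i) p - c + (0 * v (id i) p + E i p) \<and>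
            2 * v i p * ?d i = ?d (Suc i) + 0 * ?d (id i)" for i
          using rec[OF S(3)] lin by simp
        have "cmod (?d i) \<le> fact m * (2 * R) / r ^ m" for i
        proof (rule Cauchy_higher_deriv_bound)
          show "D i holomorphic_on ball p r"
            by (rule holomorphic_on_subset[OF holD]) (use r ball_subset_cball in blast)
          show "continuous_on (cball p r) (D i)"
            by (rule continuous_on_subset[OF holomorphic_on_imp_continuous_on[OF holD] r(2)])
          show "D i z \<in> ball 0 (2 * R)" if "z \<in> ball p r" for z
          proof -
            have "z \<in> S" using that r by auto
            then show ?thesis
              using norm_triangle_ineq4[of "v i z" "w i z"] U_norm[OF vU(1)[of z i]] U_norm[OF vU(2)[of z i]]
              by (simp add: D_def)
          qed
        qed (use r False in auto)
        then show "bounded (range ?d)" by (auto simp: bounded_iff)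
      qed
    qed
  qed
  then have "D i t = 0"
    by (intro holomorphic_fun_eq_0_on_connected[OF holD S(1,2) _ S(3) t]) auto
  then show ?thesis by (simp add: D_def)
qed

text \<open>Limits may leave the open set \<open>U\<close>, but having a margin of \<epsilon> is a
  closed condition. This keeps limits of families inside \<open>U\<close>.\<close>

lemma margin_limit:
  assumes "z \<longlonglongrightarrow> w" "\<And>j. ball (z j) \<epsilon> \<subseteq> U"
  shows "ball w \<epsilon> \<subseteq> U"
proof
  fix y assume "y \<in> ball w \<epsilon>"
  moreover have "(\<lambda>j. dist (z j) y) \<longlonglongrightarrow> dist w y" by (intro tendsto_intros assms)
  ultimately have "\<forall>\<^sub>F j in sequentially. dist (z j) y < \<epsilon>" by (intro order_tendstoD(2)) auto
  then obtain j where "dist (z j) y < \<epsilon>" by (auto simp: eventually_sequentially)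
  then have "y \<in> ball (z j) \<epsilon>" by simp
  then show "y \<in> U" using assms(2) by blast
qed

lemma margin_norm:
  assumes "ball v \<epsilon> \<subseteq> U"
  shows "v \<in> U" "cmod v \<le> R - \<epsilon>"
proof -
  show "v \<in> U" using assms \<epsilon> by auto
  have "ball v \<epsilon> \<subseteq> ball 0 R" using assms U_sub by blast
  then show "cmod v \<le> R - \<epsilon>" using \<epsilon> by (simp add: ball_subset_ball_iff dist_norm)
qed

text \<open>Montel's theorem for each index combined with a diagonal sequence. The recursion is
  demanded only eventually, since finite windows satisfy it only below their length, and the noise
  may vary with j, which is needed for the continuity of the shadow.\<close>

lemma solution_family_subseq:
  fixes V :: "nat \<Rightarrow> nat \<Rightarrow> complex \<Rightarrow> complex"
  assumes S: "open S" "p \<in> S"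
    and hol: "\<And>j i. V j i holomorphic_on S"
    and margin: "\<And>j i t. t \<in> S \<Longrightarrow> ball (V j i t) \<epsilon> \<subseteq> U"
    and rec: "\<And>i. \<forall>\<^sub>F j in sequentially. \<forall>t\<in>S. (V j i t)\<^sup>2 = V j (Suc i) t - c + E j i t"
    and E: "\<And>i t. t \<in> S \<Longrightarrow> (\<lambda>j. E j i t) \<longlonglongrightarrow> F i t"
    and base: "\<And>i. (\<lambda>j. V j i p) \<longlonglongrightarrow> a i"
    and r: "strict_mono (r :: nat \<Rightarrow> nat)"
  obtains s v where "strict_mono (s :: nat \<Rightarrow> nat)" "solution_family S F v" "\<And>i. v i p = a i"
    "\<And>i t. t \<in> S \<Longrightarrow> (\<lambda>j. V (r (s j)) i t) \<longlonglongrightarrow> v i t"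
proof -
  define P where "P = (\<lambda>i s. \<exists>g. g holomorphic_on S \<and> (\<forall>t\<in>S. (\<lambda>j. V (r (s j)) i t) \<longlonglongrightarrow> g t))"
  have sub: "subseqs P"
  proof
    fix n and s :: "nat \<Rightarrow> nat" assume "strict_mono s"
    obtain g q where "g holomorphic_on S" "strict_mono (q :: nat \<Rightarrow> nat)"
      "\<And>t. t \<in> S \<Longrightarrow> (\<lambda>j. V (r (s (q j))) n t) \<longlonglongrightarrow> g t"
    proof (rule Montel[of S "{h. h holomorphic_on S \<and> (\<forall>t\<in>S. cmod (h t) \<le> R)}" "\<lambda>j. V (r (s j)) n"])
      show "\<exists>B. \<forall>h\<in>{h. h holomorphic_on S \<and> (\<forall>t\<in>S. cmod (h t) \<le> R)}. \<forall>z\<in>K. cmod (h z) \<le> B"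
        if "K \<subseteq> S" for K using that by (intro exI[of _ R]) blast
      show "range (\<lambda>j. V (r (s j)) n) \<subseteq> {h. h holomorphic_on S \<and> (\<forall>t\<in>S. cmod (h t) \<le> R)}"
        using hol U_norm[OF margin_norm(1)[OF margin]] less_imp_le by blast
    qed (use S in auto)
    then show "\<exists>r'. strict_mono r' \<and> P n (s \<circ> r')" unfolding P_def by auto
  qed
  define s where "s = subseqs.diagseq P"
  have s: "strict_mono s" unfolding s_def by (rule subseqs.subseq_diagseq[OF sub])
  have closed: "P n (s \<circ> q)" if q: "strict_mono q" and Pn: "P n s" for n and s q :: "nat \<Rightarrow> nat"
  proof -
    obtain g where g: "g holomorphic_on S" "\<And>t. t \<in> S \<Longrightarrow> (\<lambda>j. V (r (s j)) n t) \<longlonglongrightarrow> g t"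
      using Pn unfolding P_def by blast
    have "(\<lambda>j. V (r ((s \<circ> q) j)) n t) \<longlonglongrightarrow> g t" if "t \<in> S" for t
      using LIMSEQ_subseq_LIMSEQ[OF g(2)[OF that] q] by (simp add: o_def)
    then show ?thesis using g(1) unfolding P_def by blast
  qed
  have "\<exists>g. g holomorphic_on S \<and> (\<forall>t\<in>S. (\<lambda>j. V (r (s j)) i t) \<longlonglongrightarrow> g t)" for i
  proof -
    have "P i (s \<circ> ((+) (Suc i)))"
      unfolding s_def by (rule subseqs.diagseq_holds[OF sub closed])
    then obtain g where g: "g holomorphic_on S" "\<And>t. t \<in> S \<Longrightarrow> (\<lambda>j. V (r (s (Suc i + j))) i t) \<longlonglongrightarrow> g t"
      by (auto simp: P_def)
    \<comment> \<open>The diagonal sequence is known to converge at index i from its term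
      \<open>Suc i\<close> on; shifting the sequence does not change the limit.\<close>
    have "(\<lambda>j. V (r (s j)) i t) \<longlonglongrightarrow> g t" if "t \<in> S" for t
      by (rule LIMSEQ_offset[of _ "Suc i"]) (use g(2)[OF that] in \<open>simp add: add.commute\<close>)
    then show ?thesis using g(1) by blast
  qed
  then obtain v where v: "\<And>i. v i holomorphic_on S"
    "\<And>i t. t \<in> S \<Longrightarrow> (\<lambda>j. V (r (s j)) i t) \<longlonglongrightarrow> v i t" by metis
  have rs: "strict_mono (r \<circ> s)" using r s by (rule strict_mono_o)
  have sub_lim: "(\<lambda>j. X (r (s j))) \<longlonglongrightarrow> l" if "X \<longlonglongrightarrow> l" for X :: "nat \<Rightarrow> complex" and l
    using LIMSEQ_subseq_LIMSEQ[OF that rs] by (simp add: o_def)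
  have "v i p = a i" for i
    using LIMSEQ_unique[OF v(2)[OF S(2)] sub_lim[OF base]] .
  moreover have "solution_family S F v"
    unfolding solution_family_def
  proof (intro allI conjI ballI)
    fix i t assume t: "t \<in> S"
    show "v i t \<in> U"
      by (rule margin_norm(1), rule margin_limit[OF v(2)[OF t]]) (rule margin[OF t])
    show "(v i t)\<^sup>2 = v (Suc i) t - c + F i t"
    proof (rule LIMSEQ_unique)
      show "(\<lambda>j. (V (r (s j)) i t)\<^sup>2) \<longlonglongrightarrow> (v i t)\<^sup>2" by (intro tendsto_intros v(2) t)
      have "\<forall>\<^sub>F j in sequentially. (V (r (s j)) i t)\<^sup>2
          = V (r (s j)) (Suc i) t - c + E (r (s j)) i t"
        using eventually_subseq[OF rs rec[of i]] by eventually_elim (use t in auto)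
      moreover have "(\<lambda>j. V (r (s j)) (Suc i) t - c + E (r (s j)) i t) \<longlonglongrightarrow> v (Suc i) t - c + F i t"
        by (intro tendsto_intros v(2) t sub_lim[OF E[OF t]])
      ultimately show "(\<lambda>j. (V (r (s j)) i t)\<^sup>2) \<longlonglongrightarrow> v (Suc i) t - c + F i t"
        by (simp add: tendsto_cong)
    qed
  qed (rule v)
  ultimately show ?thesis using that s v by blast
qed

text \<open>Every subsequence has a further subsequence whose limit is a family with the same values
  at p. By uniqueness all these limits agree, so the whole sequence converges.\<close>

lemma solution_family_limit:
  fixes V :: "nat \<Rightarrow> nat \<Rightarrow> complex \<Rightarrow> complex"
  assumes S: "open S" "connected S" "p \<in> S"
    and hol: "\<And>j i. V j i holomorphic_on S"
    and margin: "\<And>j i t. t \<in> S \<Longrightarrow> ball (V j i t) \<epsilon> \<subseteq> U"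
    and rec: "\<And>i. \<forall>\<^sub>F j in sequentially. \<forall>t\<in>S. (V j i t)\<^sup>2 = V j (Suc i) t - c + E j i t"
    and E: "\<And>i t. t \<in> S \<Longrightarrow> (\<lambda>j. E j i t) \<longlonglongrightarrow> F i t"
    and F: "\<And>i. cmod (F i p) < k"
    and base: "\<And>i. (\<lambda>j. V j i p) \<longlonglongrightarrow> a i"
  obtains v where "solution_family S F v" "\<And>i. v i p = a i"
    "\<And>i t. t \<in> S \<Longrightarrow> (\<lambda>j. V j i t) \<longlonglongrightarrow> v i t"
proof -
  obtain s v where "strict_mono (s :: nat \<Rightarrow> nat)" and v: "solution_family S F v" "\<And>i. v i p = a i"
    and "\<And>i t. t \<in> S \<Longrightarrow> (\<lambda>j. V (s j) i t) \<longlonglongrightarrow> v i t"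
    by (rule solution_family_subseq[where S = S and p = p and V = V and E = E and F = F and a = a, OF S(1,3) hol margin rec E base, of "\<lambda>j. j"]) (simp_all add: strict_mono_def)
  have "(\<lambda>j. V j i t) \<longlonglongrightarrow> v i t" if t: "t \<in> S" for i t
  proof (rule ccontr)
    assume "\<not> (\<lambda>j. V j i t) \<longlonglongrightarrow> v i t"
    then obtain e where e: "e > 0" "\<not> (\<forall>\<^sub>F j in sequentially. dist (V j i t) (v i t) < e)"
      by (auto simp: tendsto_iff)
    then have "infinite {j. \<not> dist (V j i t) (v i t) < e}"
      unfolding cofinite_eq_sequentially[symmetric] eventually_cofinite by simp
    then obtain r where r: "strict_mono (r :: nat \<Rightarrow> nat)" "\<And>j. \<not> dist (V (r j) i t) (v i t) < e"
      using infinite_enumerate by blast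
    obtain s w where s: "strict_mono (s :: nat \<Rightarrow> nat)" and w: "solution_family S F w" "\<And>i. w i p = a i"
      "\<And>i t. t \<in> S \<Longrightarrow> (\<lambda>j. V (r (s j)) i t) \<longlonglongrightarrow> w i t"
      by (rule solution_family_subseq[where S = S and p = p and V = V and E = E and F = F and a = a, OF S(1,3) hol margin rec E base r(1)]) simp_all
    have "w i t = v i t"
      by (rule solution_family_unique[OF S F w(1) v(1) _ t]) (simp add: w v)
    then have "\<forall>\<^sub>F j in sequentially. dist (V (r (s j)) i t) (v i t) < e"
      using w(3)[OF t, of i] e(1) by (simp add: tendsto_iff)
    then show False using r(2) by (auto simp: eventually_sequentially)
  qed
  then show ?thesis using that v by blast
qed

text \<open>Terms from index m on are frozen at the given orbit, and the first m terms are obtained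
  by successive lifts of square roots. The induction treats the shifted orbit and prepends one
  lift.\<close>

lemma window_exists:
  assumes S: "open S" "convex S" "p \<in> S"
    and E: "\<And>i. E i holomorphic_on S" "\<And>i t. t \<in> S \<Longrightarrow> cmod (E i t) < k"
    and a: "\<And>i. a i \<in> U" "\<And>i. (a i)\<^sup>2 = a (Suc i) - c + E i p"
  shows "\<exists>v. (\<forall>i. v i holomorphic_on S \<and> (\<forall>t\<in>S. ball (v i t) \<epsilon> \<subseteq> U) \<and> v i p = a i)
    \<and> (\<forall>i<m. \<forall>t\<in>S. (v i t)\<^sup>2 = v (Suc i) t - c + E i t) \<and> (\<forall>i\<ge>m. \<forall>t. v i t = a i)"
  using E a
proof (induction m arbitrary: a E)
  case 0
  have "ball (a i) \<epsilon> \<subseteq> U" for i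
    using pull[of "a (Suc i)" "E i p" "a i"] 0 S(3) by blast
  then show ?case by (intro exI[of _ "\<lambda>i _. a i"]) auto
next
  case (Suc m)
  have "\<exists>v. (\<forall>i. v i holomorphic_on S \<and> (\<forall>t\<in>S. ball (v i t) \<epsilon> \<subseteq> U) \<and> v i p = a (Suc i))
    \<and> (\<forall>i<m. \<forall>t\<in>S. (v i t)\<^sup>2 = v (Suc i) t - c + E (Suc i) t) \<and> (\<forall>i\<ge>m. \<forall>t. v i t = a (Suc i))"
    by (rule Suc.IH[of "\<lambda>i. E (Suc i)" "\<lambda>i. a (Suc i)"]) (simp_all only: Suc.prems)
  then obtain v where "\<forall>i. v i holomorphic_on S \<and> (\<forall>t\<in>S. ball (v i t) \<epsilon> \<subseteq> U) \<and> v i p = a (Suc i)"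
    and "\<forall>i<m. \<forall>t\<in>S. (v i t)\<^sup>2 = v (Suc i) t - c + E (Suc i) t"
    and "\<forall>i\<ge>m. \<forall>t. v i t = a (Suc i)" by (elim exE conjE)
  then have v: "\<And>i. v i holomorphic_on S" "\<And>i t. t \<in> S \<Longrightarrow> ball (v i t) \<epsilon> \<subseteq> U"
    "\<And>i. v i p = a (Suc i)"
    "\<And>i t. i < m \<Longrightarrow> t \<in> S \<Longrightarrow> (v i t)\<^sup>2 = v (Suc i) t - c + E (Suc i) t"
    "\<And>i t. i \<ge> m \<Longrightarrow> v i t = a (Suc i)" by simp_all
  obtain h where h: "h holomorphic_on S" "\<And>z. z \<in> S \<Longrightarrow> (h z)\<^sup>2 = v 0 z - c + E 0 z" "h p = a 0"
    "\<And>z. z \<in> S \<Longrightarrow> ball (h z) \<epsilon> \<subseteq> U"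
  proof (rule pullback_lift[OF S(1,2) v(1)[of 0] _ Suc.prems(1)[of 0] Suc.prems(2)[of _ 0] S(3), of "a 0"])
    show "v 0 z \<in> U" if "z \<in> S" for z using margin_norm(1)[OF v(2)[OF that]] .
    show "(a 0)\<^sup>2 = v 0 p - c + E 0 p" unfolding v(3) by (rule Suc.prems(4))
  qed blast+
  define w where "w = case_nat h v"
  have w: "w 0 = h" "\<And>i. w (Suc i) = v i" by (simp_all add: w_def)
  have "\<forall>i. w i holomorphic_on S \<and> (\<forall>t\<in>S. ball (w i t) \<epsilon> \<subseteq> U) \<and> w i p = a i"
  proof
    show "w i holomorphic_on S \<and> (\<forall>t\<in>S. ball (w i t) \<epsilon> \<subseteq> U) \<and> w i p = a i" for i
    proof (cases i)
      case 0 then show ?thesis unfolding 0 w using h(1,3,4) by blast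
    next
      case (Suc n) then show ?thesis unfolding Suc w using v(1-3) by blast
    qed
  qed
  moreover have "\<forall>i<Suc m. \<forall>t\<in>S. (w i t)\<^sup>2 = w (Suc i) t - c + E i t"
  proof (intro allI impI ballI)
    show "(w i t)\<^sup>2 = w (Suc i) t - c + E i t" if "i < Suc m" "t \<in> S" for i t
      using v(4)[of "i - 1" t] h(2)[of t] that by (cases i) (simp_all add: w)
  qed
  moreover have "\<forall>i\<ge>Suc m. \<forall>t. w i t = a i"
  proof (intro allI impI)
    show "w i t = a i" if "i \<ge> Suc m" for i t
      using v(5)[of "i - 1" t] that by (cases i) (simp_all add: w)
  qed
  ultimately show ?case by (intro exI[of _ w] conjI)
qed

text \<open>The windows \<open>V\<close> are returned together with their limit because at parameter
  0 they turn out to be the values of \<open>shadow_approx\<close>.\<close>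

lemma continuation:
  assumes S: "open S" "convex S" "p \<in> S"
    and E: "\<And>i. E i holomorphic_on S" "\<And>i t. t \<in> S \<Longrightarrow> cmod (E i t) < k"
    and a: "\<And>i. a i \<in> U" "\<And>i. (a i)\<^sup>2 = a (Suc i) - c + E i p"
  obtains v V where "solution_family S E v" "\<And>i. v i p = a i"
    "\<And>m i. V m i holomorphic_on S" "\<And>m i t. t \<in> S \<Longrightarrow> V m i t \<in> U" "\<And>m i. V m i p = a i"
    "\<And>m i t. i < m \<Longrightarrow> t \<in> S \<Longrightarrow> (V m i t)\<^sup>2 = V m (Suc i) t - c + E i t"
    "\<And>m i t. m \<le> i \<Longrightarrow> V m i t = a i"
    "\<And>i t. t \<in> S \<Longrightarrow> (\<lambda>m. V m i t) \<longlonglongrightarrow> v i t"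
proof -
  have "\<exists>V. \<forall>m. (\<forall>i. V m i holomorphic_on S \<and> (\<forall>t\<in>S. ball (V m i t) \<epsilon> \<subseteq> U) \<and> V m i p = a i)
    \<and> (\<forall>i<m. \<forall>t\<in>S. (V m i t)\<^sup>2 = V m (Suc i) t - c + E i t) \<and> (\<forall>i\<ge>m. \<forall>t. V m i t = a i)"
    by (intro choice allI window_exists[where S = S and p = p and E = E and a = a, OF S E a])
  then obtain V where "\<forall>m. (\<forall>i. V m i holomorphic_on S \<and> (\<forall>t\<in>S. ball (V m i t) \<epsilon> \<subseteq> U) \<and> V m i p = a i)
    \<and> (\<forall>i<m. \<forall>t\<in>S. (V m i t)\<^sup>2 = V m (Suc i) t - c + E i t) \<and> (\<forall>i\<ge>m. \<forall>t. V m i t = a i)"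
    by (elim exE)
  then have V: "\<And>m i. V m i holomorphic_on S" "\<And>m i t. t \<in> S \<Longrightarrow> ball (V m i t) \<epsilon> \<subseteq> U"
    "\<And>m i. V m i p = a i"
    "\<And>m i t. i < m \<Longrightarrow> t \<in> S \<Longrightarrow> (V m i t)\<^sup>2 = V m (Suc i) t - c + E i t"
    "\<And>m i t. m \<le> i \<Longrightarrow> V m i t = a i" by simp_all
  obtain v where v: "solution_family S E v" "\<And>i. v i p = a i"
    "\<And>i t. t \<in> S \<Longrightarrow> (\<lambda>j. V j i t) \<longlonglongrightarrow> v i t"
  proof (rule solution_family_limit[OF S(1) convex_connected[OF S(2)] S(3), of V "\<lambda>_. E" E a])
    show "\<forall>\<^sub>F j in sequentially. \<forall>t\<in>S. (V j i t)\<^sup>2 = V j (Suc i) t - c + E i t" for i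
      using eventually_gt_at_top[of i] by eventually_elim (use V(4) in blast)
  qed (use V E S in auto)
  show ?thesis by (rule that[OF v(1,2) V(1) margin_norm(1)[OF V(2)] V(3-5) v(3)])
qed

end

section \<open>Shadowing\<close>

text \<open>A positive real part of w_i / a_i identifies this quotient as the principal square root
  of its square, hence w_i as the preimage that \<open>nearest_preimage\<close> selects.\<close>

lemma shadow_approx_eqI:
  assumes "\<And>i. i < m \<Longrightarrow> (w i)\<^sup>2 = w (Suc i) - c \<and> 0 < Re (w i / a i)" "w m = a m" "\<And>i. a i \<noteq> 0"
  shows "shadow_approx c m a = w 0"
  using assms
proof (induction m arbitrary: w a)
  case 0 then show ?case by simp
next
  case (Suc m)
  have "shadow_approx c m (\<lambda>i. a (Suc i)) = w (Suc 0)"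
    using Suc.prems by (intro Suc.IH[of "\<lambda>i. w (Suc i)"]) auto
  moreover have "(w (Suc 0) - c) / (a 0)\<^sup>2 = (w 0 / a 0)\<^sup>2"
    using Suc.prems(1)[of 0] by (simp add: power_divide)
  moreover have "csqrt ((w 0 / a 0)\<^sup>2) = w 0 / a 0"
    using Suc.prems(1)[of 0] by (intro csqrt_square) auto
  ultimately show ?case using Suc.prems(3)[of 0] by (simp add: nearest_preimage_def)
qed

text \<open>In the assumption \<open>near\<close>, the functions \<open>v\<^sub>i\<close> pull the last term of a finite orbit
  segment back while the noise is scaled by \<open>t\<close>. Its conclusion says that at \<open>t = 0\<close> this pullback
  chooses the preimage nearest to the orbit, as \<open>shadow_approx\<close> does.\<close>

locale shadow_region = pullback_region +
  fixes q :: real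
  assumes q: "0 < q" "q < k"
    and near: "\<And>m v e. \<lbrakk>\<And>i. v i holomorphic_on ball 0 (k / q);
      \<And>i t. t \<in> ball 0 (k / q) \<Longrightarrow> v i t \<in> U; \<And>i. cmod (e i) < q;
      \<And>i t. i < m \<Longrightarrow> t \<in> ball 0 (k / q) \<Longrightarrow> (v i t)\<^sup>2 = v (Suc i) t - c + t * e i;
      \<And>i t. m \<le> i \<Longrightarrow> v i t = v i 1\<rbrakk> \<Longrightarrow> 0 < Re (v 0 0 / v (0::nat) (1::complex))"
begin

lemma k_q: "1 < k / q" "0 < k / q"
  using q by auto

lemma noise_line: "t \<in> ball 0 (k / q) \<Longrightarrow> cmod e < q \<Longrightarrow> cmod (t * e) < k"
  using mult_strict_mono'[of "cmod t" "k / q" "cmod e" q] q by (simp add: norm_mult)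

text \<open>Windows over the noise t * e_i, evaluated at t = 0, are the approximants of the shadow.
  Their convergence therefore shows that the limit defining the shadow exists.\<close>

lemma shadow_window:
  assumes a: "\<And>i. a i \<in> U" "\<And>i. (a i)\<^sup>2 = a (Suc i) - c + e i" and e: "\<And>i. cmod (e i) < q"
  obtains v where "solution_family (ball 0 (k / q)) (\<lambda>i t. t * e i) v" "\<And>i. v i 1 = a i"
    "(\<lambda>m. shadow_approx c m a) \<longlonglongrightarrow> v 0 0"
    "\<And>m. shadow_approx c m a \<in> U"
    "\<And>m. 0 < Re (shadow_approx c m a / a 0)"
    "\<And>m. (shadow_approx c (Suc m) a)\<^sup>2 = shadow_approx c m (\<lambda>i. a (Suc i)) - c"
proof -
  let ?S = "ball 0 (k / q) :: complex set"
  have S: "open ?S" "convex ?S" "1 \<in> ?S" "0 \<in> ?S" using k_q by auto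
  have a1: "(a i)\<^sup>2 = a (Suc i) - c + 1 * e i" for i using a(2) by simp
  obtain v V where v: "solution_family ?S (\<lambda>i t. t * e i) v" "\<And>i. v i 1 = a i"
    and V: "\<And>m i. V m i holomorphic_on ?S" "\<And>m i t. t \<in> ?S \<Longrightarrow> V m i t \<in> U" "\<And>m i. V m i 1 = a i"
    "\<And>m i t. i < m \<Longrightarrow> t \<in> ?S \<Longrightarrow> (V m i t)\<^sup>2 = V m (Suc i) t - c + t * e i"
    "\<And>m i t. m \<le> i \<Longrightarrow> V m i t = a i"
    and lim: "\<And>i t. t \<in> ?S \<Longrightarrow> (\<lambda>m. V m i t) \<longlonglongrightarrow> v i t"
    by (rule continuation[where S = ?S and p = 1 and E = "\<lambda>i t. t * e i" and a = a, OF S(1-3) _ _ a(1) a1])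
      (auto intro!: holomorphic_intros noise_line e simp del: mem_ball)
  have a0: "a i \<noteq> 0" for i
    using pull[OF a(1)[of "Suc i"] less_trans[OF e[of i] q(2)] a(2)] by blast
  have Re_V: "0 < Re (V m i 0 / a i)" for m i
  proof -
    have "0 < Re (V m (i + 0) 0 / V m (i + 0) 1)"
      by (rule near[of "\<lambda>j. V m (i + j)" "\<lambda>j. e (i + j)" "m - i"]) (use V e in auto)
    then show ?thesis by (simp add: V(3))
  qed
  have sa: "shadow_approx c m a = V m 0 0" for m
    by (rule shadow_approx_eqI) (use V(4)[OF _ S(4)] V(5) Re_V a0 in auto)
  have sa': "shadow_approx c m (\<lambda>i. a (Suc i)) = V (Suc m) (Suc 0) 0" for m
    by (rule shadow_approx_eqI[where w = "\<lambda>i. V (Suc m) (Suc i) 0"])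
      (use V(4)[OF _ S(4)] V(5) Re_V a0 in auto)
  show ?thesis
  proof (rule that[OF v])
    show "(\<lambda>m. shadow_approx c m a) \<longlonglongrightarrow> v 0 0" unfolding sa by (rule lim[OF S(4)])
    show "shadow_approx c m a \<in> U" for m unfolding sa by (rule V(2)[OF S(4)])
    show "0 < Re (shadow_approx c m a / a 0)" for m unfolding sa by (rule Re_V)
    show "(shadow_approx c (Suc m) a)\<^sup>2 = shadow_approx c m (\<lambda>i. a (Suc i)) - c" for m
      unfolding sa sa' using V(4)[OF _ S(4), of 0 "Suc m"] by simp
  qed
qed

text \<open>By uniqueness of continuation every family through the orbit at t = 1, however it was
  obtained, has the shadow as its value at t = 0.\<close>

lemma shadow_family:
  assumes e: "\<And>i. cmod (e i) < q"
    and v: "solution_family (ball 0 (k / q)) (\<lambda>i t. t * e i) v"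
  shows "(\<lambda>m. shadow_approx c m (\<lambda>j. v (i + j) 1)) \<longlonglongrightarrow> v i 0"
    and "shadow c (\<lambda>j. v (i + j) 1) = v i 0"
proof -
  let ?S = "ball 0 (k / q) :: complex set"
  have S: "open ?S" "connected ?S" "1 \<in> ?S" "0 \<in> ?S" using k_q by auto
  have a: "v (i + j) 1 \<in> U" "(v (i + j) 1)\<^sup>2 = v (i + Suc j) 1 - c + e (i + j)" for j
    using v S(3) by (auto simp: solution_family_def)
  obtain w where w: "solution_family ?S (\<lambda>j t. t * e (i + j)) w" "\<And>j. w j 1 = v (i + j) 1"
    "(\<lambda>m. shadow_approx c m (\<lambda>j. v (i + j) 1)) \<longlonglongrightarrow> w 0 0"
    by (rule shadow_window[of "\<lambda>j. v (i + j) 1" "\<lambda>j. e (i + j)", OF a]) (use e in auto)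
  have "w 0 0 = v (i + 0) 0"
  proof (rule solution_family_unique[OF S(1-3) _ w(1) _ _ S(4)])
    show "solution_family ?S (\<lambda>j t. t * e (i + j)) (\<lambda>j. v (i + j))"
      using solution_family_shift[OF v, of i] .
    show "cmod (1 * e (i + j)) < k" for j using less_trans[OF e q(2)] by simp
  qed (rule w(2))
  then show "(\<lambda>m. shadow_approx c m (\<lambda>j. v (i + j) 1)) \<longlonglongrightarrow> v i 0" using w(3) by simp
  then show "shadow c (\<lambda>j. v (i + j) 1) = v i 0" unfolding shadow_def by (rule limI)
qed

lemma shadow_orbit:
  assumes a: "\<And>i. a i \<in> U" "\<And>i. (a i)\<^sup>2 = a (Suc i) - c + e i" and e: "\<And>i. cmod (e i) < q"
  obtains v where "solution_family (ball 0 (k / q)) (\<lambda>i t. t * e i) v" "\<And>i. v i 1 = a i"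
    "\<And>i. (\<lambda>m. shadow_approx c m (\<lambda>j. a (i + j))) \<longlonglongrightarrow> v i 0"
    "\<And>i. shadow c (\<lambda>j. a (i + j)) = v i 0"
proof -
  obtain v where v: "solution_family (ball 0 (k / q)) (\<lambda>i t. t * e i) v" "\<And>i. v i 1 = a i"
    by (rule shadow_window[where a = a and e = e, OF a e]) blast
  show ?thesis by (rule that[OF v]) (use shadow_family[OF e v(1)] in \<open>simp_all add: v(2)\<close>)
qed

text \<open>The only danger is the branch cut of \<open>csqrt\<close>. The chosen preimage divided
  by v_0 lies in the open right half-plane, so its square avoids the nonpositive reals.\<close>

lemma holomorphic_shadow_approx:
  assumes v: "solution_family S E v" and E: "\<And>i t. t \<in> S \<Longrightarrow> cmod (E i t) < q"
  shows "(\<lambda>t. shadow_approx c m (\<lambda>i. v i t)) holomorphic_on S"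
  using assms
proof (induction m arbitrary: v E)
  case 0 then show ?case by (simp add: solution_family_def)
next
  case (Suc m)
  let ?g = "\<lambda>t. shadow_approx c m (\<lambda>i. v (Suc i) t)"
  have g: "?g holomorphic_on S"
    using solution_family_shift[OF Suc.prems(1), of 1] Suc.prems(2)
    by (intro Suc.IH[of "\<lambda>i. E (Suc i)"]) auto
  have pos: "v 0 t \<noteq> 0 \<and> (?g t - c) / (v 0 t)\<^sup>2 \<notin> \<real>\<^sub>\<le>\<^sub>0" if t: "t \<in> S" for t
  proof -
    have a: "v i t \<in> U" "(v i t)\<^sup>2 = v (Suc i) t - c + E i t" for i
      using Suc.prems(1) t by (auto simp: solution_family_def)
    have "0 < Re (shadow_approx c (Suc m) (\<lambda>i. v i t) / v 0 t)"
      "(shadow_approx c (Suc m) (\<lambda>i. v i t))\<^sup>2 = ?g t - c"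
      by (rule shadow_window[of "\<lambda>i. v i t" "\<lambda>i. E i t", OF a Suc.prems(2)[OF t]]; blast)+
    define \<zeta> where "\<zeta> = shadow_approx c (Suc m) (\<lambda>i. v i t) / v 0 t"
    have \<zeta>: "Re \<zeta> > 0" "(?g t - c) / (v 0 t)\<^sup>2 = \<zeta>\<^sup>2"
      using \<open>0 < Re _\<close> \<open>_ = ?g t - c\<close> by (simp_all add: \<zeta>_def power_divide)
    have "\<zeta>\<^sup>2 \<notin> \<real>\<^sub>\<le>\<^sub>0"
    proof
      assume "\<zeta>\<^sup>2 \<in> \<real>\<^sub>\<le>\<^sub>0"
      then have "2 * Re \<zeta> * Im \<zeta> = 0" "(Re \<zeta>)\<^sup>2 - (Im \<zeta>)\<^sup>2 \<le> 0"
        by (auto simp: complex_nonpos_Reals_iff power2_eq_square)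
      then show False using \<zeta>(1) mult_pos_pos[OF \<zeta>(1) \<zeta>(1)] by (auto simp: power2_eq_square)
    qed
    moreover have "v 0 t \<noteq> 0" using \<zeta>(1) by (auto simp: \<zeta>_def)
    ultimately show ?thesis using \<zeta>(2) by simp
  qed
  have v0: "v 0 holomorphic_on S" using Suc.prems(1) by (simp add: solution_family_def)
  have "(\<lambda>t. v 0 t * csqrt ((?g t - c) / (v 0 t)\<^sup>2)) holomorphic_on S"
    by (intro holomorphic_intros g v0) (use pos in auto)
  then show ?case by (simp add: nearest_preimage_def)
qed

text \<open>For each parameter the shadow is an orbit of z^2 + c in \<open>U\<close>, and it depends
  holomorphically on the parameter. Its derivative is then a bounded solution of the linearized
  equation, hence zero.\<close>

lemma shadow_constant:
  assumes S: "open S" "convex S"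
    and v: "solution_family S E v" and E: "\<And>i t. t \<in> S \<Longrightarrow> cmod (E i t) < q"
    and st: "s \<in> S" "t \<in> S"
  shows "shadow c (\<lambda>i. v i s) = shadow c (\<lambda>i. v i t)"
proof -
  define u where "u = (\<lambda>i t. shadow c (\<lambda>j. v (i + j) t))"
  have u: "(\<lambda>m. shadow_approx c m (\<lambda>j. v (i + j) t)) \<longlonglongrightarrow> u i t" "u i t \<in> U"
    "(u i t)\<^sup>2 = u (Suc i) t - c" if t: "t \<in> S" for i t
  proof -
    have a: "v i t \<in> U" "(v i t)\<^sup>2 = v (Suc i) t - c + E i t" for i
      using v t by (auto simp: solution_family_def)
    obtain w where w: "solution_family (ball 0 (k / q)) (\<lambda>i s. s * E i t) w"
      "\<And>i. (\<lambda>m. shadow_approx c m (\<lambda>j. v (i + j) t)) \<longlonglongrightarrow> w i 0"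
      "\<And>i. shadow c (\<lambda>j. v (i + j) t) = w i 0"
      by (rule shadow_orbit[of "\<lambda>i. v i t" "\<lambda>i. E i t", OF a E[OF t]]) blast
    have uw: "u i t = w i 0" for i unfolding u_def by (rule w(3))
    have "0 \<in> ball (0::complex) (k / q)" using k_q by simp
    then show "(\<lambda>m. shadow_approx c m (\<lambda>j. v (i + j) t)) \<longlonglongrightarrow> u i t" "u i t \<in> U"
      "(u i t)\<^sup>2 = u (Suc i) t - c"
      using w(1,2) uw by (auto simp: solution_family_def)
  qed
  have hol: "u i holomorphic_on S" for i
  proof -
    let ?f = "\<lambda>m t. shadow_approx c m (\<lambda>j. v (i + j) t)"
    have f_hol: "?f m holomorphic_on S" for m
      by (rule holomorphic_shadow_approx[OF solution_family_shift[OF v]]) (use E in auto)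
    have f_R: "cmod (?f m t) \<le> R" if t: "t \<in> S" for m t
    proof -
      have a: "v (i + j) t \<in> U" "(v (i + j) t)\<^sup>2 = v (i + Suc j) t - c + E (i + j) t" for j
        using v t by (auto simp: solution_family_def)
      have "?f m t \<in> U"
        by (rule shadow_window[of "\<lambda>j. v (i + j) t" "\<lambda>j. E (i + j) t", OF a E[OF t]]) blast
      then show ?thesis using U_norm less_imp_le by blast
    qed
    \<comment> \<open>The approximants are uniformly bounded and holomorphic. Montel's theorem gives
      a subsequence with holomorphic limit, which must be the pointwise limit
      \<open>u i\<close>.\<close>
    obtain g r where g: "g holomorphic_on S" "strict_mono (r :: nat \<Rightarrow> nat)"
      "\<And>t. t \<in> S \<Longrightarrow> (\<lambda>m. ?f (r m) t) \<longlonglongrightarrow> g t"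
    proof (rule Montel[of S "{h. h holomorphic_on S \<and> (\<forall>t\<in>S. cmod (h t) \<le> R)}" ?f])
      show "\<exists>B. \<forall>h\<in>{h. h holomorphic_on S \<and> (\<forall>t\<in>S. cmod (h t) \<le> R)}. \<forall>z\<in>K. cmod (h z) \<le> B"
        if "K \<subseteq> S" for K using that by (intro exI[of _ R]) blast
      show "range ?f \<subseteq> {h. h holomorphic_on S \<and> (\<forall>t\<in>S. cmod (h t) \<le> R)}"
        using f_hol f_R by blast
    qed (use S in auto)
    have "g t = u i t" if "t \<in> S" for t
      using LIMSEQ_unique[OF g(3)[OF that]] LIMSEQ_subseq_LIMSEQ[OF u(1)[OF that] g(2)]
      by (simp add: o_def)
    then show ?thesis using g(1) holomorphic_transform by blast
  qed
  have der: "(u i has_field_derivative deriv (u i) x) (at x)" if "x \<in> S" for i x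
    using holomorphic_derivI[OF hol S(1) that] .
  have d0: "deriv (u i) x = 0" if x: "x \<in> S" for i x
  proof (rule linearized_orbit_zero[of "\<lambda>i. u i x" "\<lambda>_. 0" "\<lambda>_. 0" "\<lambda>i. deriv (u i) x" Suc id])
    show "u i x \<in> U" for i by (rule u(2)[OF x])
    show "cmod (0 * z + 0) < k" for z using q by simp
    show "deriv (u i) x = 0 \<or> (u i x)\<^sup>2 = u (Suc i) x - c + (0 * u (id i) x + 0) \<and>
        2 * u i x * deriv (u i) x = deriv (u (Suc i)) x + 0 * deriv (u (id i)) x" for i
    proof -
      have "2 * u i x * deriv (u i) x = deriv (u (Suc i)) x"
      proof (rule DERIV_unique)
        show "((\<lambda>t. (u i t)\<^sup>2) has_field_derivative 2 * u i x * deriv (u i) x) (at x)"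
          using DERIV_power[OF der[OF x, of i], of 2] by (simp add: mult_ac)
        have "((\<lambda>t. u (Suc i) t - c) has_field_derivative deriv (u (Suc i)) x) (at x)"
          using DERIV_diff[OF der[OF x, of "Suc i"] DERIV_const[of c]] by simp
        then show "((\<lambda>t. (u i t)\<^sup>2) has_field_derivative deriv (u (Suc i)) x) (at x)"
          by (rule has_field_derivative_transform_within_open[OF _ S(1) x]) (use u(3) in auto)
      qed
      then show ?thesis using u(3)[OF x] by simp
    qed
    obtain r where r: "0 < r" "cball x r \<subseteq> S" using S x open_contains_cball by blast
    have "cmod ((deriv ^^ 1) (u i) x) \<le> fact 1 * R / r ^ 1" for i
    proof (rule Cauchy_higher_deriv_bound)
      show "u i holomorphic_on ball x r"
        by (rule holomorphic_on_subset[OF hol]) (use r ball_subset_cball in blast)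
      show "continuous_on (cball x r) (u i)"
        by (rule continuous_on_subset[OF holomorphic_on_imp_continuous_on[OF hol] r(2)])
      show "u i z \<in> ball 0 R" if "z \<in> ball x r" for z
      proof -
        have "z \<in> S" using that r(2) ball_subset_cball by blast
        then show ?thesis using U_norm[OF u(2)] by simp
      qed
    qed (use r in auto)
    then show "bounded (range (\<lambda>i. deriv (u i) x))" by (auto simp: bounded_iff)
  qed
  have "\<exists>C. \<forall>x\<in>S. u 0 x = C"
    by (rule has_field_derivative_zero_constant[OF S(2)])
      (use der[of _ 0] d0[of _ 0] in \<open>auto intro: has_field_derivative_at_within\<close>)
  then show ?thesis using st by (auto simp: u_def)
qed

text \<open>Existence continues u from t = 0 to t = 1; for uniqueness a candidate is continued from
  t = 1 back to 0, where it meets u, so both families coincide.\<close>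

lemma shadowed_orbit_ex1:
  assumes u: "\<And>i. u i \<in> U" "\<And>i. (u i)\<^sup>2 = u (Suc i) - c" and e: "\<And>i. cmod (e i) < q"
  shows "\<exists>!a. \<forall>i. a i \<in> U \<and> (a i)\<^sup>2 = a (Suc i) - c + e i \<and> shadow c (\<lambda>j. a (i + j)) = u i"
proof -
  let ?S = "ball 0 (k / q) :: complex set"
  have S: "open ?S" "convex ?S" "1 \<in> ?S" "0 \<in> ?S" using k_q by auto
  have u0: "(u i)\<^sup>2 = u (Suc i) - c + 0 * e i" for i using u(2) by simp
  obtain v where v: "solution_family ?S (\<lambda>i t. t * e i) v" "\<And>i. v i 0 = u i"
    by (rule continuation[where S = ?S and p = 0 and E = "\<lambda>i t. t * e i" and a = u, OF S(1,2,4) _ _ u(1) u0])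
      (auto intro!: holomorphic_intros noise_line e simp del: mem_ball)
  show ?thesis
  proof (rule ex1I)
    show "\<forall>i. v i 1 \<in> U \<and> (v i 1)\<^sup>2 = v (Suc i) 1 - c + e i \<and> shadow c (\<lambda>j. v (i + j) 1) = u i"
      using shadow_family(2)[OF e v(1)] v S(3) by (auto simp: solution_family_def)
  next
    fix a assume a: "\<forall>i. a i \<in> U \<and> (a i)\<^sup>2 = a (Suc i) - c + e i \<and> shadow c (\<lambda>j. a (i + j)) = u i"
    obtain w where w: "solution_family ?S (\<lambda>i t. t * e i) w" "\<And>i. w i 1 = a i"
      "\<And>i. shadow c (\<lambda>j. a (i + j)) = w i 0"
      by (rule shadow_orbit[of a e]) (use a e in blast)+
    have "w i 1 = v i 1" for i
      by (rule solution_family_unique[OF S(1) convex_connected[OF S(2)] S(4) _ w(1) v(1) _ S(3)])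
        (use w(3) a v(2) q in auto)
    then show "a = (\<lambda>i. v i 1)" using w(2) by auto
  qed
qed

text \<open>The tail of the one-sided orbit starting at n is the orbit starting at n + m, by
  uniqueness. So the one-sided orbits glue.\<close>

lemma two_sided_shadowed_orbit_ex1:
  fixes u e :: "int \<Rightarrow> complex"
  assumes u: "\<And>n. u n \<in> U" "\<And>n. (u n)\<^sup>2 = u (n + 1) - c" and e: "\<And>n. cmod (e n) < q"
  shows "\<exists>!x. \<forall>n. x n \<in> U \<and> (x n)\<^sup>2 = x (n + 1) - c + e n \<and> shadow c (\<lambda>j. x (n + int j)) = u n"
proof -
  define P where "P = (\<lambda>n a. \<forall>i. a i \<in> U \<and> (a i)\<^sup>2 = a (Suc i) - c + e (n + int i)
    \<and> shadow c (\<lambda>j. a (i + j)) = u (n + int i))"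
  have ex1: "\<exists>!a. P n a" for n
    unfolding P_def
  proof (rule shadowed_orbit_ex1)
    show "(u (n + int i))\<^sup>2 = u (n + int (Suc i)) - c" for i
      using u(2)[of "n + int i"] by (simp add: add_ac)
  qed (use u e in auto)
  then have "\<forall>n. \<exists>a. P n a" by blast
  then obtain A where A: "\<And>n. P n (A n)" using choice by blast
  have shift: "P (n + int m) (\<lambda>i. a (m + i))" if "P n a" for n m a
    unfolding P_def
  proof
    fix i
    show "a (m + i) \<in> U \<and> (a (m + i))\<^sup>2 = a (m + Suc i) - c + e (n + int m + int i) \<and>
        shadow c (\<lambda>j. a (m + (i + j))) = u (n + int m + int i)"
      using that[unfolded P_def, rule_format, of "m + i"] by (simp add: add.assoc)
  qed
  define x where "x = (\<lambda>n. A n 0)"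
  have xA: "x (n + int m) = A n m" for n m
  proof -
    have "A (n + int m) = (\<lambda>i. A n (m + i))" using ex1 A shift[OF A] by blast
    then show ?thesis by (simp add: x_def)
  qed
  show ?thesis
  proof (rule ex1I[of _ x])
    have x: "x n \<in> U \<and> (x n)\<^sup>2 = x (n + 1) - c + e n \<and> shadow c (\<lambda>j. x (n + int j)) = u n" for n
      using A[of n, unfolded P_def, rule_format, of 0] xA[of n 1] xA[of n 0] by (simp add: xA)
    then show "\<forall>n. x n \<in> U \<and> (x n)\<^sup>2 = x (n + 1) - c + e n \<and> shadow c (\<lambda>j. x (n + int j)) = u n"
      by blast
  next
    fix y assume y: "\<forall>n. y n \<in> U \<and> (y n)\<^sup>2 = y (n + 1) - c + e n \<and> shadow c (\<lambda>j. y (n + int j)) = u n"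
    have "P n (\<lambda>i. y (n + int i))" for n
      unfolding P_def
    proof
      fix i
      show "y (n + int i) \<in> U \<and> (y (n + int i))\<^sup>2 = y (n + int (Suc i)) - c + e (n + int i) \<and>
          shadow c (\<lambda>j. y (n + int (i + j))) = u (n + int i)"
        using y[rule_format, of "n + int i"] by (simp add: add_ac)
    qed
    then have "(\<lambda>i. y (n + int i)) = A n" for n using ex1 A by blast
    then have "y (n + int 0) = A n 0" for n by (rule fun_cong)
    then show "y = x" by (simp add: x_def fun_eq_iff)
  qed
qed

end

section \<open>Henon orbits with a prescribed shadow, and the resulting conjugacy\<close>

locale henon_shadow_region = henon_region + shadow_region c U R k \<epsilon> "cmod b * R"
begin

definition henon_shadow :: "complex \<times> complex \<Rightarrow> int \<Rightarrow> complex"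
  where "henon_shadow z n = shadow c (\<lambda>i. henon_coord c b z (n + int i))"

lemma shadowed_henon_orbit_ex1:
  fixes u :: "int \<Rightarrow> complex"
  assumes u: "\<And>n. u n \<in> U" "\<And>n. (u n)\<^sup>2 = u (n + 1) - c"
  shows "\<exists>!x. \<forall>n. x n \<in> U \<and> (x n)\<^sup>2 = x (n + 1) - c + b * x (n - 1)
    \<and> shadow c (\<lambda>j. x (n + int j)) = u n"
proof -
  define Q where "Q = (\<lambda>e x. \<forall>n. x n \<in> U \<and> (x n)\<^sup>2 = x (n + 1) - c + e n \<and> shadow c (\<lambda>j. x (n + int j)) = u n)"
  have ex1: "\<exists>!x. Q e x" if "\<And>n. cmod (e n) < cmod b * R" for e
    unfolding Q_def by (rule two_sided_shadowed_orbit_ex1[where u = u and e = e, OF u that])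
  define X where "X = (\<lambda>e. THE x. Q e x)"
  have QX: "Q e (X e)" if "\<And>n. cmod (e n) < cmod b * R" for e
    unfolding X_def by (rule theI'[OF ex1[of e, OF that]])
  have X_eq: "X e = x" if "\<And>n. cmod (e n) < cmod b * R" "Q e x" for e x
    using ex1[of e] QX[of e] that by blast
  \<comment> \<open>The margin makes \<open>G\<close> map the polydisc of radius |b| R into the one
    of radius |b| (R - \<epsilon>), the strict inclusion that the fixed point theorem
    requires.\<close>
  have margin: "cmod (x n) \<le> R - \<epsilon>" if Q: "Q e x" "\<And>n. cmod (e n) < cmod b * R" for e x n
  proof -
    have "ball (x n) \<epsilon> \<subseteq> U"
      using pull[of "x (n + 1)" "e n" "x n"] Q(1) less_trans[OF Q(2) b_R, of n] unfolding Q_def by blast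
    then show ?thesis by (rule margin_norm)
  qed
  define G where "G = (\<lambda>e n. b * X e (n - 1))"
  have "\<exists>!e. (\<forall>n. cmod (e n) < cmod b * R) \<and> G e = e"
  proof (rule polydisc_fixed_point)
    have "cmod (X (\<lambda>_. 0) 0) \<le> R - \<epsilon>"
      by (rule margin[OF QX]) (use q in auto)
    then have "0 \<le> R - \<epsilon>" using norm_ge_zero order_trans by blast
    then show "0 \<le> cmod b * (R - \<epsilon>)" by simp
    show "cmod b * (R - \<epsilon>) < cmod b * R" using b \<epsilon> by simp
  next
    fix e :: "int \<Rightarrow> complex" and n assume e: "\<And>j. cmod (e j) < cmod b * R"
    show "cmod (G e n) \<le> cmod b * (R - \<epsilon>)"
      using margin[of e "X e" "n - 1"] QX[of e] e by (simp add: G_def norm_mult mult_left_mono)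
  next
    fix E :: "int \<Rightarrow> complex \<Rightarrow> complex" and n
    assume E: "\<And>j. E j holomorphic_on ball 0 1" "\<And>j z. cmod z < 1 \<Longrightarrow> cmod (E j z) < cmod b * R"
    let ?e = "\<lambda>z j. E j z"
    \<comment> \<open>\<open>G\<close> at n reads the orbit only at n - 1, and this term is
      determined by the noise and shadow from n - 1 on; so a one-sided family starting there is
      enough.\<close>
    define a where "a = (\<lambda>i. X (?e 0) (n - 1 + int i))"
    have Q0: "Q (?e 0) (X (?e 0))" by (rule QX) (use E in auto)
    have a: "a i \<in> U" "(a i)\<^sup>2 = a (Suc i) - c + E (n - 1 + int i) 0"
      "shadow c (\<lambda>j. a (i + j)) = u (n - 1 + int i)" for i
      using Q0[unfolded Q_def, rule_format, of "n - 1 + int i"] by (simp_all add: a_def algebra_simps)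
    obtain v where v: "solution_family (ball 0 1) (\<lambda>i. E (n - 1 + int i)) v" "\<And>i. v i 0 = a i"
    proof (rule continuation[where S = "ball 0 1" and p = 0 and E = "\<lambda>i. E (n - 1 + int i)" and a = a])
      show "cmod (E (n - 1 + int i) t) < k" if "t \<in> ball 0 1" for i t
        using E(2)[of t] that b_R by (auto intro: less_trans)
    qed (use E a in auto)
    have "v 0 z = X (?e z) (n - 1)" if z: "z \<in> ball 0 1" for z
    proof -
      have ez: "cmod (E j z) < cmod b * R" for j using E(2) z by simp
      have Qz: "Q (?e z) (X (?e z))" by (rule QX) (rule ez)
      define P where "P = (\<lambda>a. \<forall>i. a i \<in> U \<and> (a i)\<^sup>2 = a (Suc i) - c + E (n - 1 + int i) z
          \<and> shadow c (\<lambda>j. a (i + j)) = u (n - 1 + int i))"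
      have "\<exists>!a. P a"
        unfolding P_def
      proof (rule shadowed_orbit_ex1)
        show "(u (n - 1 + int i))\<^sup>2 = u (n - 1 + int (Suc i)) - c" for i
          using u(2)[of "n - 1 + int i"] by (simp add: algebra_simps)
      qed (use u ez in auto)
      moreover have "P (\<lambda>i. v i z)"
        unfolding P_def
      proof
        fix i
        \<comment> \<open>The continued orbit keeps the shadow u, so uniqueness identifies it with
          \<open>X\<close> at the noise z. This transfers the holomorphy of the continuation to
          \<open>X\<close>.\<close>
        have "shadow c (\<lambda>j. v (i + j) z) = shadow c (\<lambda>j. v (i + j) 0)"
          by (rule shadow_constant[OF open_ball convex_ball solution_family_shift[OF v(1)]])
            (use E z in auto)
        then show "v i z \<in> U \<and> (v i z)\<^sup>2 = v (Suc i) z - c + E (n - 1 + int i) z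
            \<and> shadow c (\<lambda>j. v (i + j) z) = u (n - 1 + int i)"
          using v z a(3) by (auto simp: solution_family_def)
      qed
      moreover have "P (\<lambda>i. X (?e z) (n - 1 + int i))"
        unfolding P_def
      proof
        fix i
        show "X (?e z) (n - 1 + int i) \<in> U
          \<and> (X (?e z) (n - 1 + int i))\<^sup>2 = X (?e z) (n - 1 + int (Suc i)) - c + E (n - 1 + int i) z
          \<and> shadow c (\<lambda>j. X (?e z) (n - 1 + int (i + j))) = u (n - 1 + int i)"
          using Qz[unfolded Q_def, rule_format, of "n - 1 + int i"] by (simp add: algebra_simps)
      qed
      ultimately have "(\<lambda>i. v i z) = (\<lambda>i. X (?e z) (n - 1 + int i))" by blast
      from fun_cong[OF this, of 0] show ?thesis by simp
    qed
    moreover have "(\<lambda>z. b * v 0 z) holomorphic_on ball 0 1"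
      using v(1) by (auto simp: solution_family_def intro!: holomorphic_intros)
    ultimately show "(\<lambda>z. G (\<lambda>j. E j z) n) holomorphic_on ball 0 1"
      by (auto simp: G_def intro: holomorphic_transform)
  qed
  then obtain e where e: "\<And>n. cmod (e n) < cmod b * R" "G e = e"
    and uniq: "\<And>e'. (\<forall>n. cmod (e' n) < cmod b * R) \<and> G e' = e' \<Longrightarrow> e' = e" by blast
  have *: "Q (\<lambda>n. b * x (n - 1)) x \<longleftrightarrow> x = X e" for x
  proof
    assume x: "Q (\<lambda>n. b * x (n - 1)) x"
    have lt: "cmod (b * x (n - 1)) < cmod b * R" for n
      using x noise_less unfolding Q_def by blast
    have "X (\<lambda>n. b * x (n - 1)) = x" by (rule X_eq[OF lt x])
    then have "G (\<lambda>n. b * x (n - 1)) = (\<lambda>n. b * x (n - 1))" by (simp add: G_def)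
    then have "(\<lambda>n. b * x (n - 1)) = e" using lt by (intro uniq) simp
    then show "x = X e" using \<open>X (\<lambda>n. b * x (n - 1)) = x\<close> by simp
  next
    assume "x = X e"
    moreover have "(\<lambda>n. b * X e (n - 1)) = e" using e(2) by (simp add: G_def)
    ultimately show "Q (\<lambda>n. b * x (n - 1)) x" using QX[OF e(1)] by simp
  qed
  show ?thesis using * unfolding Q_def by (intro ex1I[of _ "X e"]) auto
qed

lemma henon_coord_noisy:
  assumes "z \<in> julia2 (henon c b)"
  shows "henon_coord c b z (n + int i) \<in> U"
    "(henon_coord c b z (n + int i))\<^sup>2
      = henon_coord c b z (n + int (Suc i)) - c + b * henon_coord c b z (n + int i - 1)"
    "cmod (b * henon_coord c b z (n + int i - 1)) < cmod b * R"
  using assms henon_coord_square[OF b, of c z "n + int i"]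
  by (auto simp: julia2_henon add_ac intro!: noise_less)

lemma henon_shadow_orbit:
  assumes z: "z \<in> julia2 (henon c b)"
  shows "henon_shadow z n \<in> U" "(henon_shadow z n)\<^sup>2 = henon_shadow z (n + 1) - c"
proof -
  note a = henon_coord_noisy[OF z, of n]
  obtain v where v: "solution_family (ball 0 (k / (cmod b * R))) (\<lambda>i t. t * (b * henon_coord c b z (n + int i - 1))) v"
    "\<And>i. shadow c (\<lambda>j. henon_coord c b z (n + int (i + j))) = v i 0"
    by (rule shadow_orbit[of "\<lambda>i. henon_coord c b z (n + int i)" "\<lambda>i. b * henon_coord c b z (n + int i - 1)", OF a])
      blast
  have "0 \<in> ball (0::complex) (k / (cmod b * R))" using k_q by simp
  moreover have "henon_shadow z n = v 0 0" "henon_shadow z (n + 1) = v 1 0"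
    using v(2)[of 0] v(2)[of 1] by (simp_all add: henon_shadow_def algebra_simps)
  ultimately show "henon_shadow z n \<in> U" "(henon_shadow z n)\<^sup>2 = henon_shadow z (n + 1) - c"
    using v(1) by (auto simp: solution_family_def)
qed

text \<open>Along a convergent sequence of points both the orbits, which are the families at t = 1,
  and their noises converge termwise. Hence the families converge, in particular at t = 0.\<close>

lemma continuous_on_henon_shadow:
  "continuous_on (julia2 (henon c b)) (\<lambda>z. henon_shadow z n)"
  unfolding continuous_on_sequentially
proof (intro allI ballI impI)
  fix Z z assume "z \<in> julia2 (henon c b)" and Z: "(\<forall>j. Z j \<in> julia2 (henon c b)) \<and> Z \<longlonglongrightarrow> z"
  let ?S = "ball 0 (k / (cmod b * R)) :: complex set"
  let ?a = "\<lambda>z i. henon_coord c b z (n + int i)"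
  let ?e = "\<lambda>z i. b * henon_coord c b z (n + int i - 1)"
  have S: "open ?S" "connected ?S" "1 \<in> ?S" "0 \<in> ?S" using k_q by auto
  have "\<forall>j. \<exists>v. solution_family ?S (\<lambda>i t. t * ?e (Z j) i) v \<and> (\<forall>i. v i 1 = ?a (Z j) i)
      \<and> henon_shadow (Z j) n = v 0 0"
  proof
    fix j
    have zj: "Z j \<in> julia2 (henon c b)" using Z by blast
    obtain v where v: "solution_family ?S (\<lambda>i t. t * ?e (Z j) i) v" "\<And>i. v i 1 = ?a (Z j) i"
      "\<And>i. shadow c (\<lambda>l. ?a (Z j) (i + l)) = v i 0"
      by (rule shadow_orbit[of "?a (Z j)" "?e (Z j)", OF henon_coord_noisy[OF zj, of n]]) blast
    then show "\<exists>v. solution_family ?S (\<lambda>i t. t * ?e (Z j) i) v \<and> (\<forall>i. v i 1 = ?a (Z j) i)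
      \<and> henon_shadow (Z j) n = v 0 0"
      using v(1,2) v(3)[of 0] by (intro exI[of _ v]) (simp add: henon_shadow_def)
  qed
  from choice[OF this] obtain V where V0: "\<forall>j. solution_family ?S (\<lambda>i t. t * ?e (Z j) i) (V j) \<and> (\<forall>i. V j i 1 = ?a (Z j) i)
      \<and> henon_shadow (Z j) n = V j 0 0" by (elim exE)
  have V: "\<And>j. solution_family ?S (\<lambda>i t. t * ?e (Z j) i) (V j)" "\<And>j i. V j i 1 = ?a (Z j) i"
    "\<And>j. henon_shadow (Z j) n = V j 0 0" using V0 by simp_all
  have coord: "(\<lambda>j. henon_coord c b (Z j) m) \<longlonglongrightarrow> henon_coord c b z m" for m
    using continuous_on_tendsto_compose[OF continuous_on_henon_coord[OF b, of c m], of Z z] Z by simp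
  have noise: "cmod (t * ?e z' i) < k" if "z' \<in> julia2 (henon c b)" "t \<in> ?S" for z' t i
    by (rule noise_line[OF that(2) henon_coord_noisy(3)[OF that(1)]])
  obtain v where v: "solution_family ?S (\<lambda>i t. t * ?e z i) v" "\<And>i. v i 1 = ?a z i"
    "\<And>i t. t \<in> ?S \<Longrightarrow> (\<lambda>j. V j i t) \<longlonglongrightarrow> v i t"
  proof (rule solution_family_limit[where S = ?S and p = 1 and V = V
        and E = "\<lambda>j i t. t * ?e (Z j) i" and F = "\<lambda>i t. t * ?e z i" and a = "?a z", OF S(1-3)])
    show "V j i holomorphic_on ?S" for j i using V(1) by (simp add: solution_family_def)
    show "ball (V j i t) \<epsilon> \<subseteq> U" if t: "t \<in> ?S" for j i t
      using pull[of "V j (Suc i) t" "t * ?e (Z j) i" "V j i t"] V(1)[of j] noise[of "Z j" t i] Z t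
      by (simp add: solution_family_def)
    show "\<forall>\<^sub>F j in sequentially. \<forall>t\<in>?S. (V j i t)\<^sup>2 = V j (Suc i) t - c + t * ?e (Z j) i" for i
      using V(1) by (auto simp: solution_family_def)
    show "(\<lambda>j. t * ?e (Z j) i) \<longlonglongrightarrow> t * ?e z i" for i t by (intro tendsto_intros coord)
    show "cmod (1 * ?e z i) < k" for i by (rule noise[OF \<open>z \<in> _\<close> S(3)])
    show "(\<lambda>j. V j i 1) \<longlonglongrightarrow> ?a z i" for i unfolding V(2) by (rule coord)
  qed simp_all
  have "henon_shadow z n = v 0 0"
    using shadow_family(2)[OF henon_coord_noisy(3)[OF \<open>z \<in> _\<close>, of n] v(1), of 0] by (simp add: v(2) henon_shadow_def)
  then show "((\<lambda>z. henon_shadow z n) \<circ> Z) \<longlonglongrightarrow> henon_shadow z n"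
    using v(3)[OF S(4), of 0] by (simp add: o_def V(3))
qed

lemma shadowing_map_eq: "shadowing_map c b z = (\<lambda>m. henon_shadow z (- int m))"
  by (simp add: shadowing_map_def henon_shadow_def)

text \<open>A point of the inverse limit extends uniquely to a two-sided orbit of g, and exactly one
  Henon orbit in \<open>U\<close> has it as shadow. This gives bijectivity; compactness makes the
  continuous bijection a homeomorphism.\<close>

lemma is_conjugacy_shadowing_map:
  assumes g: "\<And>z. g z = z\<^sup>2 + c" and X: "X = {w. \<forall>m. (g ^^ m) w \<in> U}"
  shows "is_conjugacy (julia2 (henon c b)) (henon c b) (inverse_limit X g) (natural_shift g) (shadowing_map c b)"
proof -
  let ?J = "julia2 (henon c b)" and ?h = "shadowing_map c b" and ?Y = "inverse_limit X g"
  have gU: "g (henon_shadow z n) = henon_shadow z (n + 1)" if "z \<in> ?J" for z n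
    using henon_shadow_orbit(2)[OF that, of n] by (simp add: g)
  have gm: "(g ^^ m) (henon_shadow z n) = henon_shadow z (n + int m)" if "z \<in> ?J" for z n m
    by (induction m) (simp_all add: gU[OF that] add_ac)
  have hY: "?h z \<in> ?Y" if z: "z \<in> ?J" for z
    unfolding inverse_limit_def shadowing_map_eq
    using gm[OF z] gU[OF z] henon_shadow_orbit(1)[OF z] by (simp add: X)
  have inj: "z = z'" if z: "z \<in> ?J" "z' \<in> ?J" and eq: "?h z = ?h z'" for z z'
  proof -
    have "henon_shadow z n = henon_shadow z' n" for n
    proof (cases "n \<le> 0")
      case True
      then have "n = - int (nat (- n))" by simp
      then show ?thesis using fun_cong[OF eq, of "nat (- n)"] by (simp add: shadowing_map_eq)
    next
      case False
      then have "n = 0 + int (nat n)" by simp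
      then show ?thesis
        using gm[OF z(1), of "nat n" 0] gm[OF z(2), of "nat n" 0] fun_cong[OF eq, of 0]
        by (simp add: shadowing_map_eq)
    qed
    then have eq': "henon_shadow z' = henon_shadow z" by auto
    define P where "P = (\<lambda>x. \<forall>n. x n \<in> U \<and> (x n)\<^sup>2 = x (n + 1) - c + b * x (n - 1)
      \<and> shadow c (\<lambda>j. x (n + int j)) = henon_shadow z n)"
    have "\<exists>!x. P x"
      unfolding P_def by (rule shadowed_henon_orbit_ex1) (rule henon_shadow_orbit[OF z(1)])+
    moreover have "P (henon_coord c b z)" "P (henon_coord c b z')"
      unfolding P_def using z henon_coord_square[OF b, of c z] henon_coord_square[OF b, of c z'] fun_cong[OF eq']
      by (simp_all add: julia2_henon henon_shadow_def)
    ultimately have "henon_coord c b z = henon_coord c b z'" by blast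
    then show ?thesis
      using henon_coord_0[of c b z] henon_coord_0[of c b z'] henon_coord_minus_1[OF b, of c z]
        henon_coord_minus_1[OF b, of c z'] by (simp add: prod_eq_iff)
  qed
  have surj: "\<exists>z\<in>?J. ?h z = y" if y: "y \<in> ?Y" for y
  proof -
    have yX: "y n \<in> X" "g (y (Suc n)) = y n" for n using y by (auto simp: inverse_limit_def)
    \<comment> \<open>The two-sided orbit through y: its coordinates at times \<le> 0, forward
      iterates of \<open>y 0\<close> at positive times.\<close>
    define u where "u = (\<lambda>n::int. if n \<le> 0 then y (nat (- n)) else (g ^^ nat n) (y 0))"
    have "u n \<in> U" for n
    proof (cases "n \<le> 0")
      case True
      then show ?thesis using yX(1)[of "nat (- n)"] by (auto simp: u_def X dest: spec[of _ 0])
    next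
      case False
      then show ?thesis using yX(1)[of 0] by (simp add: u_def X)
    qed
    moreover have "g (u n) = u (n + 1)" for n
    proof (cases "n < 0")
      case True
      then have "nat (- n) = Suc (nat (- (n + 1)))" by simp
      then show ?thesis using True yX(2)[of "nat (- (n + 1))"] by (simp add: u_def)
    next
      case False
      then have "nat (n + 1) = Suc (nat n)" by simp
      then show ?thesis using False by (cases "n = 0") (simp_all add: u_def)
    qed
    then have "(u n)\<^sup>2 = u (n + 1) - c" for n using g[of "u n"] by (simp add: eq_diff_eq)
    ultimately obtain x where x: "\<And>n. x n \<in> U" "\<And>n. (x n)\<^sup>2 = x (n + 1) - c + b * x (n - 1)"
      "\<And>n. shadow c (\<lambda>j. x (n + int j)) = u n"
      using shadowed_henon_orbit_ex1[of u] by blast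
    have hx: "henon_coord c b (x 0, x (- 1)) n = x n" for n
      by (rule henon_coord_unique[OF b x(2)])
    show ?thesis
    proof
      show "(x 0, x (- 1)) \<in> ?J" using x(1) by (simp add: julia2_henon hx)
      have "henon_shadow (x 0, x (- 1)) n = u n" for n by (simp add: henon_shadow_def hx x(3))
      then show "?h (x 0, x (- 1)) = y" by (simp add: shadowing_map_eq u_def)
    qed
  qed
  have img: "?h ` ?J = ?Y" using hY surj by blast
  have fJ: "henon c b z \<in> ?J" if "z \<in> ?J" for z
    using that by (simp add: julia2_henon henon_coord_henon[OF b])
  have comm: "?h (henon c b z) = natural_shift g (?h z)" if z: "z \<in> ?J" for z
  proof
    fix m
    have 1: "henon_shadow (henon c b z) n = henon_shadow z (n + 1)" for n
      by (simp add: henon_shadow_def henon_coord_henon[OF b] add_ac)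
    show "?h (henon c b z) m = natural_shift g (?h z) m"
      using gU[OF z, of 0] by (cases m) (simp_all add: shadowing_map_eq natural_shift_def 1)
  qed
  have "continuous_on ?J ?h"
    unfolding shadowing_map_eq
    by (rule continuous_on_coordinatewise_then_product) (rule continuous_on_henon_shadow)
  then have "\<exists>k. homeomorphism ?J ?Y ?h k"
    using homeomorphism_compact[OF compact_julia2 _ img] inj by (auto simp: inj_on_def)
  moreover have "natural_shift g y \<in> ?Y" if y: "y \<in> ?Y" for y
  proof -
    obtain z where z: "z \<in> ?J" "?h z = y" using surj[OF y] by blast
    show ?thesis using comm[OF z(1)] hY[OF fJ[OF z(1)]] z(2) by simp
  qed
  ultimately show ?thesis
    using fJ comm unfolding is_conjugacy_def by (intro conjI image_subsetI ballI)
qed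

end

section \<open>The horseshoe\<close>

lemma average_less:
  fixes x y :: real
  assumes "x < y"
  shows "x < (x + y) / 2" "(x + y) / 2 < y"
  using assms by (simp_all add: field_simps)

text \<open>Two conditions compete: R^2 > |c| + (1 + |b|) R keeps pullbacks in the ball, and |c| >
  (1 + |b|) R keeps noisy images off the critical value. With R^2 = 2 |c| they coincide, and they
  become the assumption |c| > 2 (1 + |b|)^2. There is no cycle to exclude, so \<open>U\<close> is
  the whole ball.\<close>

lemma henon_region_horseshoe:
  fixes b c :: complex
  assumes b: "b \<noteq> 0" and c: "cmod c > 2 * (1 + cmod b)\<^sup>2"
  defines "R \<equiv> sqrt (2 * cmod c)"
  shows "(1 + cmod b) * R < cmod c" "\<exists>k \<epsilon>. henon_region c (ball 0 R) R k \<epsilon> b"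
proof -
  have c0: "0 < cmod c" using c by (smt (verit) zero_le_power2)
  have R2: "R\<^sup>2 = 2 * cmod c" and R: "0 < R" using c0 by (auto simp: R_def)
  have "((1 + cmod b) * R)\<^sup>2 = (2 * (1 + cmod b)\<^sup>2) * cmod c"
    by (simp add: power_mult_distrib R2)
  also have "\<dots> < cmod c * cmod c" using c c0 by (intro mult_strict_right_mono)
  finally have "((1 + cmod b) * R)\<^sup>2 < (cmod c)\<^sup>2" by (simp add: power2_eq_square)
  then show lt: "(1 + cmod b) * R < cmod c" by (rule power2_less_imp_less) simp
  then have lt': "R + cmod b * R < cmod c" by (simp add: algebra_simps)
  define k where "k = (cmod b * R + (cmod c - R)) / 2"
  have "cmod b * R < cmod c - R" using lt' by linarith
  then have k: "cmod b * R < k" "k < cmod c - R" unfolding k_def by (rule average_less)+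
  have kpos: "0 < k" using k b R by (smt (verit) mult_nonneg_nonneg norm_ge_zero)
  have "sqrt (cmod c + R + k) < sqrt (R\<^sup>2)" using k by (simp add: R2)
  then have s: "sqrt (cmod c + R + k) < R" using R by simp
  have "henon_region c (ball 0 R) R k (R - sqrt (cmod c + R + k)) b"
  proof
    fix w e v :: complex assume w: "w \<in> ball 0 R" and e: "cmod e < k" and v: "v\<^sup>2 = w - c + e"
    have we: "cmod (w + e) < R + k" using w e norm_triangle_ineq[of w e] by simp
    have "v\<^sup>2 = (w + e) - c" using v by simp
    then have "(cmod v)\<^sup>2 = cmod ((w + e) - c)" by (simp flip: norm_power)
    then have "(cmod v)\<^sup>2 > 0" "(cmod v)\<^sup>2 \<le> cmod c + R + k"
      using we k norm_triangle_ineq2[of c "w + e"] norm_triangle_ineq4[of "w + e" c]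
      by (auto simp: norm_minus_commute)
    then have "v \<noteq> 0" "cmod v \<le> sqrt (cmod c + R + k)" by (auto intro: real_le_rsqrt)
    then show "v \<noteq> 0 \<and> ball v (R - sqrt (cmod c + R + k)) \<subseteq> ball 0 R"
      by (auto simp: ball_subset_ball_iff dist_norm)
  next
    show "cmod c + (1 + cmod b) * R < R\<^sup>2" using lt by (simp add: R2)
  qed (use s b R k in auto)
  then show "\<exists>k \<epsilon>. henon_region c (ball 0 R) R k \<epsilon> b" by blast
qed

lemma csqrt_square_cases:
  assumes "Re w \<noteq> 0"
  shows "w = (if 0 < Re w then 1 else - 1) * csqrt (w\<^sup>2)"
  using csqrt_square[of w] csqrt_square[of "- w"] assms by (auto simp: not_less)

lemma is_conjugacy_horseshoe_map:
  fixes b c :: complex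
  assumes b: "b \<noteq> 0" and c: "cmod c > 2 * (1 + cmod b)\<^sup>2"
  shows "is_conjugacy (julia2 (henon c b)) (henon c b) (UNIV :: (int \<Rightarrow> bool) set) full_shift
    (horseshoe_map c b)"
proof -
  define R where "R = sqrt (2 * cmod c)"
  note reg = henon_region_horseshoe[OF b c, folded R_def]
  obtain k \<epsilon> where "henon_region c (ball 0 R) R k \<epsilon> b" using reg(2) by blast
  then interpret henon_region c "ball 0 R" R k \<epsilon> b .
  let ?J = "julia2 (henon c b)"
  let ?x = "henon_coord c b"
  define \<gamma> where "\<gamma> = csqrt (- c)"
  have c0: "c \<noteq> 0" using c by auto
  have \<gamma>: "\<gamma>\<^sup>2 = - c" "\<gamma> \<noteq> 0" using c0 by (auto simp: \<gamma>_def)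
  have Jiff: "z \<in> ?J \<longleftrightarrow> (\<forall>n. cmod (?x z n) < R)" for z by (simp add: julia2_henon)
  have c_mult: "c * (1 + p / (- c)) = c - p" for p using c0 by (simp add: field_simps)
  \<comment> \<open>By the recursion (x_n / \<gamma>)^2 differs from 1 by less than 1. It stays in
    the right half-plane, so x_n / \<gamma> is never purely imaginary and \<open>csqrt\<close> is
    holomorphic there.\<close>
  have pert: "cmod ((p + b * p') / (- c)) < 1" if "cmod p < R" "cmod p' < R" for p p'
  proof -
    have "cmod b * cmod p' \<le> cmod b * R" using that by (intro mult_left_mono) auto
    then have "cmod (p + b * p') < (1 + cmod b) * R"
      using that norm_triangle_ineq[of p "b * p'"] by (simp add: norm_mult algebra_simps)
    then show ?thesis using reg(1) c0 by (simp add: norm_divide divide_less_eq)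
  qed
  have Re_pos: "0 < Re (1 + (p + b * p') / (- c))" if "cmod p < R" "cmod p' < R" for p p'
    using pert[OF that] abs_Re_le_cmod[of "(p + b * p') / (- c)"] by (simp del: Re_divide)
  have sq: "(?x z n / \<gamma>)\<^sup>2 = 1 + (?x z (n + 1) + b * ?x z (n - 1)) / (- c)" for z n
    using c0 by (simp add: power_divide \<gamma> henon_coord_square[OF b] field_simps)
  have Re_nz: "Re (?x z n / \<gamma>) \<noteq> 0" if z: "z \<in> ?J" for z n
  proof
    assume "Re (?x z n / \<gamma>) = 0"
    then have "Re ((?x z n / \<gamma>)\<^sup>2) \<le> 0" unfolding Re_power2 by simp
    then show False unfolding sq using Re_pos[of "?x z (n + 1)" "?x z (n - 1)"] z by (simp add: Jiff del: Re_divide)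
  qed
  have hmap: "horseshoe_map c b z n \<longleftrightarrow> 0 < Re (?x z n / \<gamma>)" for z n
    by (simp add: horseshoe_map_def \<gamma>_def)
  have coded: "\<exists>!z. z \<in> ?J \<and> horseshoe_map c b z = s" for s
  proof -
    \<comment> \<open>Solves the recursion for x_n with the square root that the symbol
      \<open>s n\<close> prescribes. Fixed points of \<open>T\<close> in the polydisc are the orbits
      with itinerary s.\<close>
    define T where "T = (\<lambda>x n. (if s n then 1 else - 1) * \<gamma> * csqrt (1 + (x (n + 1) + b * x (n - 1)) / (- c)))"
    have ex1: "\<exists>!x. (\<forall>n. cmod (x n) < R) \<and> T x = x"
    proof (rule polydisc_fixed_point)
      show "0 \<le> sqrt (cmod c + (1 + cmod b) * R)" using R by simp
      have "sqrt (cmod c + (1 + cmod b) * R) < sqrt (R\<^sup>2)"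
        by (rule real_sqrt_less_mono[OF escape])
      then show "sqrt (cmod c + (1 + cmod b) * R) < R" using R by simp
    next
      fix x :: "int \<Rightarrow> complex" and n assume x: "\<And>j. cmod (x j) < R"
      have "(cmod (T x n))\<^sup>2 = cmod c * cmod (1 + (x (n + 1) + b * x (n - 1)) / (- c))"
        using \<gamma>(1) by (simp add: T_def norm_mult power_mult_distrib flip: norm_power)
      also have "\<dots> = cmod (c - (x (n + 1) + b * x (n - 1)))"
        by (simp only: c_mult flip: norm_mult)
      also have "\<dots> \<le> cmod c + (1 + cmod b) * R"
      proof -
        have "cmod (b * x (n - 1)) \<le> cmod b * R"
          using x[of "n - 1"] by (simp add: norm_mult mult_left_mono)
        then show ?thesis
          using norm_triangle_ineq4[of c "x (n + 1) + b * x (n - 1)"] x[of "n + 1"]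
            norm_triangle_ineq[of "x (n + 1)" "b * x (n - 1)"] by (simp add: algebra_simps)
      qed
      finally show "cmod (T x n) \<le> sqrt (cmod c + (1 + cmod b) * R)" by (rule real_le_rsqrt)
    next
      fix E :: "int \<Rightarrow> complex \<Rightarrow> complex" and n
      assume E: "\<And>j. E j holomorphic_on ball 0 1" "\<And>j z. cmod z < 1 \<Longrightarrow> cmod (E j z) < R"
      have "1 + (E (n + 1) z + b * E (n - 1) z) / (- c) \<notin> \<real>\<^sub>\<le>\<^sub>0" if "z \<in> ball 0 1" for z
        using Re_pos[of "E (n + 1) z" "E (n - 1) z"] E(2)[of z] that
        by (auto simp: complex_nonpos_Reals_iff simp del: Re_divide)
      then show "(\<lambda>z. T (\<lambda>j. E j z) n) holomorphic_on ball 0 1"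
        unfolding T_def by (intro holomorphic_intros E(1)) (use c0 in auto)
    qed
    have T_iff: "T (?x z) = ?x z" if z: "z \<in> ?J" and hs: "horseshoe_map c b z = s" for z
    proof
      fix n
      have "?x z n / \<gamma> = (if s n then 1 else - 1) * csqrt ((?x z n / \<gamma>)\<^sup>2)"
        using csqrt_square_cases[OF Re_nz[OF z]] hmap[of z n] hs by simp
      then show "T (?x z) n = ?x z n"
        unfolding T_def sq[symmetric] using \<gamma>(2) by (simp add: field_simps)
    qed
    obtain x where x: "\<And>n. cmod (x n) < R" "T x = x"
      and uniq: "\<And>y. (\<forall>n. cmod (y n) < R) \<and> T y = y \<Longrightarrow> y = x" using ex1 by blast
    have "(x n)\<^sup>2 = x (n + 1) - c + b * x (n - 1)" for n
    proof -
      have "(x n)\<^sup>2 = (T x n)\<^sup>2" using x(2) by simp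
      also have "\<dots> = - c * (1 + (x (n + 1) + b * x (n - 1)) / (- c))"
        by (simp add: T_def power_mult_distrib \<gamma>(1))
      also have "\<dots> = x (n + 1) - c + b * x (n - 1)"
        by (simp only: mult_minus_left c_mult) simp
      finally show ?thesis .
    qed
    then have hx: "?x (x 0, x (- 1)) n = x n" for n by (rule henon_coord_unique[OF b])
    have zJ: "(x 0, x (- 1)) \<in> ?J" using x(1) by (simp add: Jiff hx)
    have "horseshoe_map c b (x 0, x (- 1)) = s"
    proof
      fix n
      have "x n / \<gamma> = (if s n then 1 else - 1) * csqrt (1 + (x (n + 1) + b * x (n - 1)) / (- c))"
        using fun_cong[OF x(2), of n] \<gamma>(2) by (simp add: T_def field_simps)
      moreover have "0 \<le> Re (csqrt (1 + (x (n + 1) + b * x (n - 1)) / (- c)))" by (rule Re_csqrt)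
      ultimately show "horseshoe_map c b (x 0, x (- 1)) n = s n"
        using Re_nz[OF zJ, of n] unfolding hmap hx by (cases "s n") (simp_all del: Re_divide csqrt.simps)
    qed
    moreover have "z = (x 0, x (- 1))" if "z \<in> ?J" "horseshoe_map c b z = s" for z
    proof -
      have "?x z = x" using T_iff[OF that] that(1) by (intro uniq) (simp add: Jiff)
      then show ?thesis using henon_coord_0[of c b z] henon_coord_minus_1[OF b, of c z] by (simp add: prod_eq_iff)
    qed
    ultimately show ?thesis using zJ by blast
  qed
  \<comment> \<open>On the Julia set the real part never vanishes, so either symbol is detected by
    an open half-plane.\<close>
  have cont: "continuous_on ?J (\<lambda>z. horseshoe_map c b z n)" for n
    unfolding continuous_on_open_invariant
  proof (intro allI impI)
    fix B :: "bool set"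
    let ?f = "\<lambda>z. Re (?x z n / \<gamma>)"
    have "continuous_on UNIV ?f"
      by (intro continuous_intros continuous_on_henon_coord b) (use \<gamma> in auto)
    then have op: "open (?f -` {0<..})" "open (?f -` {..<0})" by (auto intro: open_vimage)
    define A where "A = (if True \<in> B then ?f -` {0<..} else {}) \<union> (if False \<in> B then ?f -` {..<0} else {})"
    have "open A" unfolding A_def using op by (intro open_Un) auto
    moreover have "z \<in> A \<longleftrightarrow> horseshoe_map c b z n \<in> B" if "z \<in> ?J" for z
      using Re_nz[OF that, of n] unfolding hmap A_def
      by (cases "0 < ?f z") (auto simp del: Re_divide)
    ultimately show "\<exists>A. open A \<and> A \<inter> ?J = (\<lambda>z. horseshoe_map c b z n) -` B \<inter> ?J"
      by (intro exI[of _ A]) auto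
  qed
  \<comment> \<open>The symbols are coded by the reals 0 and 1, and the compactness argument is run
    for real sequences. The inverse is carried back by composing with the coding
    \<open>?E\<close>.\<close>
  define H where "H = (\<lambda>z n. of_bool (horseshoe_map c b z n) :: real)"
  have of_bool_cont: "continuous_on UNIV (of_bool :: bool \<Rightarrow> real)" by simp
  have "continuous_on ?J H"
    unfolding H_def
    by (intro continuous_on_coordinatewise_then_product continuous_on_compose2[OF of_bool_cont cont]) simp
  moreover have "inj_on H ?J"
  proof (rule inj_onI)
    fix z z' assume z: "z \<in> ?J" "z' \<in> ?J" "H z = H z'"
    have "horseshoe_map c b z = horseshoe_map c b z'"
    proof
      fix n show "horseshoe_map c b z n = horseshoe_map c b z' n"
        using fun_cong[OF z(3), of n]
        by (cases "horseshoe_map c b z n"; cases "horseshoe_map c b z' n") (simp_all add: H_def)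
    qed
    then show "z = z'" using coded z by blast
  qed
  ultimately obtain K where K: "homeomorphism ?J (H ` ?J) H K"
    using homeomorphism_compact[OF compact_julia2, of H "H ` ?J"] by blast
  let ?E = "\<lambda>s n. of_bool (s n) :: real"
  have E_img: "?E s \<in> H ` ?J" for s
  proof -
    obtain z where "z \<in> ?J" "horseshoe_map c b z = s" using coded by blast
    then show ?thesis by (auto simp: H_def)
  qed
  have "continuous_on UNIV ?E"
    by (intro continuous_on_coordinatewise_then_product continuous_on_compose2[OF of_bool_cont])
      (auto intro: continuous_on_product_coordinates)
  then have contK: "continuous_on UNIV (\<lambda>s. K (?E s))"
    by (rule continuous_on_compose2[OF homeomorphism_cont2[OF K]]) (use E_img in auto)
  have KE: "K (?E s) \<in> ?J \<and> horseshoe_map c b (K (?E s)) = s" for s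
  proof -
    obtain z where z: "z \<in> ?J" "horseshoe_map c b z = s" using coded by blast
    then have "?E s = H z" by (auto simp: H_def)
    then show ?thesis using z homeomorphism_apply1[OF K z(1)] by simp
  qed
  have hom: "homeomorphism ?J UNIV (horseshoe_map c b) (\<lambda>s. K (?E s))"
  proof (rule homeomorphismI)
    show "continuous_on ?J (horseshoe_map c b)"
      using cont by (intro continuous_on_coordinatewise_then_product)
    show "K (?E (horseshoe_map c b z)) = z" if "z \<in> ?J" for z
      using KE coded that by blast
  qed (use contK KE in auto)
  have "horseshoe_map c b (henon c b z) = full_shift (horseshoe_map c b z)" for z
    by (simp add: horseshoe_map_def full_shift_def henon_coord_henon[OF b] fun_eq_iff)
  moreover have "henon c b ` ?J \<subseteq> ?J" by (auto simp: Jiff henon_coord_henon[OF b])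
  ultimately show ?thesis using hom unfolding is_conjugacy_def by blast
qed

section \<open>The solenoid\<close>

text \<open>The hypothesis puts the square of w into the right half-plane, and \<open>Ln\<close>
  doubles under squaring because w itself has positive real part.\<close>

lemma abs_Im_Ln_less_quarter_pi:
  assumes "\<bar>Im w\<bar> < Re w"
  shows "\<bar>Im (Ln w)\<bar> < pi / 4"
proof -
  have w0: "w \<noteq> 0" using assms by auto
  have half: "\<bar>Im (Ln w)\<bar> < pi / 2" using Re_Ln_pos_lt[OF w0] assms by simp
  have "(Im w)\<^sup>2 < (Re w)\<^sup>2" using power_strict_mono[of "\<bar>Im w\<bar>" "Re w" 2] assms by simp
  then have "0 < Re (w\<^sup>2)" by (simp add: Re_power2)
  moreover have "Ln (w\<^sup>2) = 2 * Ln w"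
  proof -
    have "exp (2 * Ln w) = w\<^sup>2" using w0 by (simp add: exp_double)
    then show ?thesis using Ln_exp[of "2 * Ln w"] half by simp
  qed
  ultimately have "\<bar>Im (2 * Ln w)\<bar> < pi / 2" using Re_Ln_pos_lt[of "w\<^sup>2"] w0 by simp
  then show ?thesis by simp
qed

text \<open>The argument of \<open>v\<^sub>i(t) / v\<^sub>i(1)\<close> is half of that of
  \<open>v\<^sub>i\<^sub>+\<^sub>1(t) / v\<^sub>i\<^sub>+\<^sub>1(1)\<close> up to the contribution of the noise, which is less than
  \<open>\<pi>/4\<close> at either parameter, so the bound \<open>\<pi>/2\<close> is preserved.\<close>

lemma solenoid_near:
  fixes v :: "nat \<Rightarrow> complex \<Rightarrow> complex" and e :: "nat \<Rightarrow> complex"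
  assumes S: "connected S" "1 \<in> S"
    and cont: "\<And>i. continuous_on S (v i)" and ge: "\<And>i t. t \<in> S \<Longrightarrow> 1 / 2 < cmod (v i t)"
    and noise: "\<And>i t. t \<in> S \<Longrightarrow> cmod (t * e i) < 1 / 4"
    and rec: "\<And>i t. i < m \<Longrightarrow> t \<in> S \<Longrightarrow> (v i t)\<^sup>2 = v (Suc i) t + t * e i"
    and const: "\<And>t. v m t = v m 1" and t: "t \<in> S"
  shows "0 < Re (v 0 t / v 0 1)"
proof -
  have "\<exists>l. continuous_on S l \<and> l 1 = 0 \<and> (\<forall>t\<in>S. v 0 t = v 0 1 * exp (l t) \<and> \<bar>Im (l t)\<bar> < pi / 2)"
    using cont ge noise rec const
  proof (induction m arbitrary: v e)
    case 0
    show ?case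
    proof (intro exI conjI ballI)
      show "continuous_on S (\<lambda>_. 0)" by (rule continuous_on_const)
      show "v 0 t = v 0 1 * exp 0" for t using 0(5)[of t] by simp
    qed simp_all
  next
    case (Suc m)
    have ne: "v i t \<noteq> 0" if "t \<in> S" for i t using Suc.prems(2)[OF that, of i] by auto
    have "\<exists>l. continuous_on S l \<and> l 1 = 0
        \<and> (\<forall>t\<in>S. v (Suc 0) t = v (Suc 0) 1 * exp (l t) \<and> \<bar>Im (l t)\<bar> < pi / 2)"
    proof (rule Suc.IH[of "\<lambda>i. v (Suc i)" "\<lambda>i. e (Suc i)"])
      show "(v (Suc i) t)\<^sup>2 = v (Suc (Suc i)) t + t * e (Suc i)" if "i < m" "t \<in> S" for i t
        using Suc.prems(4)[of "Suc i" t] that by simp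
    qed (rule Suc.prems, assumption?)+
    then obtain l where l: "continuous_on S l" "l 1 = 0"
      "\<And>t. t \<in> S \<Longrightarrow> v 1 t = v 1 1 * exp (l t)" "\<And>t. t \<in> S \<Longrightarrow> \<bar>Im (l t)\<bar> < pi / 2"
      unfolding One_nat_def by blast
    \<comment> \<open>The relative effect of the noise, v_0(t)^2 = v_1(t) w(t). From noise below 1/4
      and |v_1| > 1/2 follows |w - 1| < 1/2, hence |Im w| < 1/2 < Re w.\<close>
    define w where "w = (\<lambda>t. 1 + t * e 0 / v 1 t)"
    have wide: "\<bar>Im (w t)\<bar> < Re (w t)" if t: "t \<in> S" for t
    proof -
      have "cmod (t * e 0) < 1 / 2 * cmod (v 1 t)"
        using Suc.prems(3)[OF t, of 0] Suc.prems(2)[OF t, of 1] by simp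
      then have "cmod (t * e 0 / v 1 t) < 1 / 2"
        using ne[OF t, of 1] by (simp add: norm_divide divide_less_eq)
      then show ?thesis
        using abs_Im_le_cmod[of "t * e 0 / v 1 t"] abs_Re_le_cmod[of "t * e 0 / v 1 t"]
        by (simp add: w_def del: Re_divide Im_divide)
    qed
    have w0: "w t \<noteq> 0" if "t \<in> S" for t
      using wide[OF that] by (intro notI) simp
    have w_cont: "continuous_on S (\<lambda>t. Ln (w t))"
    proof (rule continuous_on_Ln')
      show "continuous_on S w"
        unfolding w_def by (intro continuous_intros Suc.prems(1) ballI ne)
      show "w t \<notin> \<real>\<^sub>\<le>\<^sub>0" if "t \<in> S" for t
        using wide[OF that] by (auto simp: complex_nonpos_Reals_iff)
    qed
    define l' where "l' = (\<lambda>t. (l t + Ln (w t) - Ln (w 1)) / 2)"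
    have cont': "continuous_on S l'" unfolding l'_def by (intro continuous_intros l w_cont) auto
    have l'1: "l' 1 = 0" by (simp add: l'_def l)
    \<comment> \<open>By construction l' is half the logarithm of v_0(t)^2 / v_0(1)^2, so f takes
      the values 1 and -1 only. Being continuous on a connected set with f(1) = 1, it is
      constant.\<close>
    define f where "f = (\<lambda>t. v 0 t / (v 0 1 * exp (l' t)))"
    have sq: "(f t)\<^sup>2 = 1" if t: "t \<in> S" for t
    proof -
      have v_sq: "(v 0 t)\<^sup>2 = v 1 t * w t" if "t \<in> S" for t
        using Suc.prems(4)[of 0 t] ne[OF that, of 1] that by (simp add: w_def distrib_left)
      have "(exp (l' t))\<^sup>2 = exp (2 * l' t)" by (rule exp_double[symmetric])
      also have "2 * l' t = l t + Ln (w t) - Ln (w 1)" by (simp add: l'_def)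
      also have "exp \<dots> = exp (l t) * w t / w 1"
        using w0[OF t] w0[OF S(2)] by (simp add: exp_add exp_diff)
      finally have "(v 0 1)\<^sup>2 * (exp (l' t))\<^sup>2 = (v 0 t)\<^sup>2"
        using w0[OF S(2)] l(3)[OF t] v_sq[OF S(2)] v_sq[OF t] by simp
      then show ?thesis
        using ne[OF t, of 0] by (simp add: f_def power_divide power_mult_distrib)
    qed
    have f1: "f t = 1" if t: "t \<in> S" for t
    proof -
      have "f constant_on S"
      proof (rule continuous_finite_range_constant[OF S(1)])
        show "continuous_on S f"
          unfolding f_def by (intro continuous_intros Suc.prems(1) cont') (simp add: ne[OF S(2)])
        have "f ` S \<subseteq> {1, - 1}" using sq[THEN power2_eq_1_iff[THEN iffD1]] by blast
        then show "finite (f ` S)" by (rule finite_subset) simp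
      qed
      then obtain y where "\<And>x. x \<in> S \<Longrightarrow> f x = y" unfolding constant_on_def by blast
      from this[OF t] this[OF S(2)] have "f t = f 1" by simp
      then show ?thesis using ne[OF S(2), of 0] by (simp add: f_def l'1)
    qed
    have "v 0 t = v 0 1 * exp (l' t)" if "t \<in> S" for t
      using f1[OF that] ne[OF S(2), of 0] unfolding f_def by (simp add: divide_eq_1_iff)
    moreover have "\<bar>Im (l' t)\<bar> < pi / 2" if t: "t \<in> S" for t
      using l(4)[OF t] abs_Im_Ln_less_quarter_pi[OF wide[OF t]] abs_Im_Ln_less_quarter_pi[OF wide[OF S(2)]]
      by (simp add: l'_def)
    ultimately show ?case using cont' l'1 by (intro exI[of _ l']) simp
  qed
  then obtain l where l: "\<forall>t\<in>S. v 0 t = v 0 1 * exp (l t) \<and> \<bar>Im (l t)\<bar> < pi / 2" by blast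
  have "v 0 1 \<noteq> 0" using ge[OF S(2), of 0] by auto
  moreover have "v 0 t = v 0 1 * exp (l t)" using l t by blast
  ultimately have "v 0 t / v 0 1 = exp (l t)" by simp
  moreover have "0 < cos (Im (l t))" using l t by (intro cos_gt_zero_pi) auto
  ultimately show ?thesis by (simp only: Re_exp) simp
qed

lemma ball_subset_annulusI:
  assumes "r + \<epsilon> \<le> cmod v" "cmod v + \<epsilon> \<le> R"
  shows "ball v \<epsilon> \<subseteq> {w. r < cmod w \<and> cmod w < R}"
proof (clarsimp simp: dist_norm)
  fix w assume "cmod (v - w) < \<epsilon>"
  then show "r < cmod w \<and> cmod w < R"
    using assms norm_triangle_ineq2[of v w] norm_triangle_ineq3[of w v] by (simp add: norm_minus_commute)
qed

text \<open>The disc of radius r is mapped into itself under squaring with noise r - r^2, which is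
  largest, namely 1/4, at r = 1/2. The outer radius is the root of R^2 - R = 1/4, tolerating the
  same noise. The requirement |b| R < 1/4 is then the bound on b, as (sqrt 2 - 1)/2 * R =
  1/4.\<close>

lemma henon_shadow_region_solenoid:
  fixes b :: complex
  assumes b: "b \<noteq> 0" and lt: "cmod b < (sqrt 2 - 1) / 2"
  defines "R \<equiv> (1 + sqrt 2) / 2"
  obtains k \<epsilon> where "henon_shadow_region 0 {w. 1 / 2 < cmod w \<and> cmod w < R} R k \<epsilon> b"
proof -
  have R: "1 < R" "R\<^sup>2 = R + 1 / 4" by (simp_all add: R_def power2_eq_square field_simps)
  have "cmod b * R < (sqrt 2 - 1) / 2 * R" using lt R by (intro mult_strict_right_mono) auto
  also have "\<dots> = 1 / 4" by (simp add: R_def field_simps)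
  finally have bR: "cmod b * R < 1 / 4" .
  define k where "k = (cmod b * R + 1 / 4) / 2"
  have k: "cmod b * R < k" "k < 1 / 4" unfolding k_def by (rule average_less[OF bR])+
  moreover have "0 < cmod b * R" using b R by simp
  ultimately have k: "cmod b * R < k" "k < 1 / 4" "0 < k" "0 < cmod b * R" by linarith+
  \<comment> \<open>The gaps at the inner and outer circle: pullbacks v satisfy 1/2 - k \<le> |v|^2
    \<le> R + k.\<close>
  define \<epsilon> where "\<epsilon> = min (sqrt (1 / 2 - k) - 1 / 2) (R - sqrt (R + k))"
  have "sqrt (1 / 4) < sqrt (1 / 2 - k)" using k by (intro real_sqrt_less_mono) simp
  then have s1: "1 / 2 < sqrt (1 / 2 - k)" by (simp add: real_sqrt_divide)
  have "R + k < R\<^sup>2" using k R by simp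
  then have "sqrt (R + k) < sqrt (R\<^sup>2)" by (rule real_sqrt_less_mono)
  then have s2: "sqrt (R + k) < R" using R(1) by simp
  let ?U = "{w::complex. 1 / 2 < cmod w \<and> cmod w < R}"
  have openU: "open ?U" by (intro open_Collect_conj open_Collect_less continuous_intros)
  have "henon_shadow_region 0 ?U R k \<epsilon> b"
  proof
    show "open ?U" by (rule openU)
    show "?U \<subseteq> ball 0 R" by auto
    show "0 < \<epsilon>" using s1 s2 by (simp add: \<epsilon>_def)
    show "cmod 0 + (1 + cmod b) * R < R\<^sup>2" using bR R by (simp add: algebra_simps)
  next
    fix w e v :: complex assume w: "w \<in> ?U" and e: "cmod e < k" and v: "v\<^sup>2 = w - 0 + e"
    have "(cmod v)\<^sup>2 = cmod (w + e)" using v by (simp flip: norm_power)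
    then have "1 / 2 - k \<le> (cmod v)\<^sup>2" "(cmod v)\<^sup>2 \<le> R + k"
      using w e norm_triangle_ineq[of w e] norm_diff_ineq[of w e] by auto
    then have "sqrt (1 / 2 - k) \<le> cmod v" "cmod v \<le> sqrt (R + k)"
      by (auto intro: real_le_lsqrt real_le_rsqrt)
    then have "1 / 2 + \<epsilon> \<le> cmod v" "cmod v + \<epsilon> \<le> R" by (auto simp: \<epsilon>_def)
    moreover have "v \<noteq> 0" using less_le_trans[OF s1 \<open>sqrt (1 / 2 - k) \<le> cmod v\<close>] by auto
    ultimately show "v \<noteq> 0 \<and> ball v \<epsilon> \<subseteq> ?U" using ball_subset_annulusI by blast
  next
    fix x y :: complex assume x: "x \<in> ball 0 R - ?U" and y: "cmod y < R"
    have "(cmod x)\<^sup>2 \<le> (1 / 2)\<^sup>2" using x by (intro power_mono) auto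
    moreover have "cmod b * cmod y \<le> cmod b * R" using y by (intro mult_left_mono) auto
    ultimately have "cmod (x\<^sup>2 - b * y) < 1 / 2"
      using bR norm_triangle_ineq4[of "x\<^sup>2" "b * y"] by (simp add: norm_mult norm_power power2_eq_square)
    then have "x\<^sup>2 + 0 - b * y \<in> ball 0 (1 / 2)" by simp
    moreover have "ball 0 (1 / 2) \<subseteq> ball 0 R - ?U" using R by auto
    ultimately show "x\<^sup>2 + 0 - b * y \<in> interior (ball 0 R - ?U)" by (meson interiorI open_ball)
  next
    fix m and v :: "nat \<Rightarrow> complex \<Rightarrow> complex" and e :: "nat \<Rightarrow> complex"
    let ?S = "ball 0 (k / (cmod b * R)) :: complex set"
    have cancel: "x / y * y = x" if "0 < y" for x y :: real using that by simp
    assume v: "\<And>i. v i holomorphic_on ?S" "\<And>i t. t \<in> ?S \<Longrightarrow> v i t \<in> ?U" "\<And>i. cmod (e i) < cmod b * R"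
      "\<And>i t. i < m \<Longrightarrow> t \<in> ?S \<Longrightarrow> (v i t)\<^sup>2 = v (Suc i) t - 0 + t * e i"
      "\<And>i t. m \<le> i \<Longrightarrow> v i t = v i 1"
    show "0 < Re (v 0 0 / v 0 1)"
    proof (rule solenoid_near[of ?S v e m])
      show "cmod (t * e i) < 1 / 4" if "t \<in> ?S" for t i
      proof -
        have "cmod t * cmod (e i) < k / (cmod b * R) * (cmod b * R)"
          using that v(3)[of i] k by (intro mult_strict_mono') auto
        also have "\<dots> = k" by (rule cancel[OF k(4)])
        finally show ?thesis using k(2) by (simp add: norm_mult)
      qed
      show "connected ?S" by simp
      show "1 \<in> ?S" "0 \<in> ?S" using k by simp_all
      show "continuous_on ?S (v i)" for i by (rule holomorphic_on_imp_continuous_on[OF v(1)])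
      show "1 / 2 < cmod (v i t)" if "t \<in> ?S" for i t using v(2)[OF that, of i] by blast
      show "(v i t)\<^sup>2 = v (Suc i) t + t * e i" if "i < m" "t \<in> ?S" for i t using v(4)[OF that] by simp
      show "v m t = v m 1" for t by (rule v(5)[OF order_refl])
    qed
  qed (use b R k in auto)
  then show ?thesis by (rule that)
qed

lemma squaring_orbit_in_annulus_iff:
  fixes w :: complex
  assumes "0 < r" "r < 1" "1 < R"
  shows "(\<forall>m. r < cmod (((\<lambda>z. z\<^sup>2) ^^ m) w) \<and> cmod (((\<lambda>z. z\<^sup>2) ^^ m) w) < R) \<longleftrightarrow> cmod w = 1"
proof -
  have pow: "cmod (((\<lambda>z. z\<^sup>2) ^^ m) w) = cmod w ^ (2 ^ m)" for m
    by (induction m) (simp_all add: norm_power mult.commute flip: power_mult)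
  have grow: "m \<le> (2::nat) ^ m" for m using less_imp_le less_exp by blast
  have "cmod w = 1" if all: "\<And>m. r < cmod w ^ (2 ^ m) \<and> cmod w ^ (2 ^ m) < R"
  proof (rule ccontr)
    assume "cmod w \<noteq> 1"
    then consider "cmod w < 1" | "cmod w > 1" by linarith
    then show False
    proof cases
      case 1
      obtain m where "cmod w ^ m < r" using real_arch_pow_inv[OF assms(1) 1] by blast
      moreover have "cmod w ^ (2 ^ m) \<le> cmod w ^ m" using 1 grow by (intro power_decreasing) auto
      ultimately show False using all[of m] by linarith
    next
      case 2
      obtain m where "R < cmod w ^ m" using real_arch_pow[OF 2] by blast
      moreover have "cmod w ^ m \<le> cmod w ^ (2 ^ m)" using 2 grow by (intro power_increasing) auto
      ultimately show False using all[of m] by linarith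
    qed
  qed
  then show ?thesis using assms by (auto simp: pow)
qed

lemma is_conjugacy_solenoid:
  fixes b :: complex
  assumes b: "b \<noteq> 0" and lt: "cmod b < (sqrt 2 - 1) / 2"
  shows "is_conjugacy (julia2 (henon 0 b)) (henon 0 b)
    (inverse_limit (sphere 0 1) (\<lambda>z. z\<^sup>2)) (natural_shift (\<lambda>z. z\<^sup>2)) (shadowing_map 0 b)"
proof -
  let ?R = "(1 + sqrt 2) / 2"
  obtain k \<epsilon> where "henon_shadow_region 0 {w. 1 / 2 < cmod w \<and> cmod w < ?R} ?R k \<epsilon> b"
    by (rule henon_shadow_region_solenoid[OF b lt])
  then interpret henon_shadow_region 0 "{w. 1 / 2 < cmod w \<and> cmod w < ?R}" ?R k \<epsilon> b .
  have "1 < ?R" by simp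
  then have "sphere 0 1 = {w. \<forall>m. ((\<lambda>z. z\<^sup>2) ^^ m) w \<in> {w::complex. 1 / 2 < cmod w \<and> cmod w < ?R}}"
    using squaring_orbit_in_annulus_iff[of "1/2" ?R] by auto
  then show ?thesis by (intro is_conjugacy_shadowing_map) auto
qed

section \<open>The basilica\<close>

text \<open>Otherwise x = pi/6 < 0.5184, and the Taylor bound for the sine would give sin x < 1/2.
  The precision is what the basilica estimate consumes: 3.11^2 = 9.6721 barely exceeds 2.6 * 2 *
  1.86 = 9.672.\<close>

lemma pi_ge_311: "3.11 \<le> pi"
proof (rule ccontr)
  assume "\<not> 3.11 \<le> pi"
  define x where "x = pi / 6"
  have x: "x < 0.5184" using \<open>\<not> 3.11 \<le> pi\<close> by (simp add: x_def)
  have sin_x: "sin x = 1 / 2" by (simp add: x_def sin_30)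
  have x2: "1 / 2 \<le> x" using sin_x_le_x[of x] unfolding sin_x by (simp add: x_def)
  have "\<bar>sin x - (\<Sum>m<5. sin_coeff m * x ^ m)\<bar> \<le> inverse (fact 5) * \<bar>x\<bar> ^ 5"
    by (rule Maclaurin_sin_bound)
  moreover have "{..<5::nat} = {0, 1, 2, 3, 4}" by auto
  then have "(\<Sum>m<5. sin_coeff m * x ^ m) = x - x ^ 3 / 6"
    by (simp add: sin_coeff_def fact_numeral)
  moreover have "fact 5 = (120::real)" by (simp add: eval_nat_numeral)
  ultimately have "\<bar>1 / 2 - (x - x ^ 3 / 6)\<bar> * 120 \<le> x ^ 5" using x2 by (simp add: sin_x)
  then have "(1 / 2 - (x - x ^ 3 / 6)) * 120 \<le> x ^ 5"
    by (rule order_trans[rotated]) (rule mult_right_mono[OF abs_ge_self], simp)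
  then have "1 / 2 \<le> x - x ^ 3 / 6 + x ^ 5 / 120" by (simp add: field_simps)
  moreover have "1 / 8 \<le> x ^ 3"
    using power_mono[OF x2, of 3] by (simp add: power_divide)
  moreover have "x ^ 5 \<le> 0.04"
  proof -
    have "x * x \<le> 0.5184 * 0.5184" using x x2 by (intro mult_mono) auto
    then have xx: "x * x \<le> 0.27" by simp
    have "(x * x) * (x * x) * x \<le> 0.27 * 0.27 * 0.5184"
      using x x2 xx by (intro mult_mono) auto
    moreover have "x ^ 5 = (x * x) * (x * x) * x" by (simp add: power_numeral_odd Let_def power2_eq_square mult_ac)
    ultimately show ?thesis by simp
  qed
  ultimately show False using x by simp
qed

lemma le_exp_double:
  fixes x y :: real
  assumes "a \<le> exp x" "0 \<le> a" "b \<le> a * a" "y = 2 * x"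
  shows "b \<le> exp y"
proof -
  have "a * a \<le> exp x * exp x" using assms(1,2) by (intro mult_mono) auto
  then show ?thesis using assms(3,4) by (simp flip: exp_add)
qed

text \<open>With \<open>l\<close> a logarithm of \<open>g\<close>, the function \<open>exp (\<i> \<alpha> (l - ln r))\<close> maps
  the disc into the upper half-plane, where the Schwarz lemma bounds the quotient of its moduli, which
  is \<open>exp (- \<alpha> Im (l(1) - l(0)))\<close>.\<close>

lemma annulus_valued_argument:
  fixes g :: "complex \<Rightarrow> complex"
  assumes \<rho>: "1 < \<rho>" and r: "0 < r"
    and g: "g holomorphic_on ball 0 \<rho>" "\<And>t. t \<in> ball 0 \<rho> \<Longrightarrow> r < cmod (g t) \<and> cmod (g t) < R"
    and small: "(\<rho> + 1) / (\<rho> - 1) < exp (pi\<^sup>2 / (2 * ln (R / r)))"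
  shows "0 < Re (g 0 / g 1)"
proof -
  let ?S = "ball 0 \<rho> :: complex set"
  have S: "0 \<in> ?S" "1 \<in> ?S" using \<rho> by auto
  have rR: "r < R" using g(2)[OF S(1)] by linarith
  have g0: "g t \<noteq> 0" if "t \<in> ?S" for t using g(2)[OF that] r by auto
  obtain l where l: "l holomorphic_on ?S" "\<And>t. t \<in> ?S \<Longrightarrow> g t = exp (l t)"
    using simply_connected_eq_holomorphic_log[OF open_ball] convex_imp_simply_connected[OF convex_ball] g(1) g0
    by blast
  have Re_l: "ln r < Re (l t) \<and> Re (l t) < ln R" if t: "t \<in> ?S" for t
  proof -
    have "exp (ln r) < exp (Re (l t))" "exp (Re (l t)) < exp (ln R)"
      using g(2)[OF t] l(2)[OF t] r rR by simp_all
    then show ?thesis by simp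
  qed
  \<comment> \<open>Stretches the strip ln r < Re < ln R to width pi, so that multiplication by \<i>
    and exponentiation map it to the upper half-plane.\<close>
  define \<alpha> where "\<alpha> = pi / ln (R / r)"
  have lnRr: "ln (R / r) = ln R - ln r" "0 < ln (R / r)" using r rR by (simp_all add: ln_div)
  have \<alpha>: "0 < \<alpha>" using lnRr(2) by (simp add: \<alpha>_def)
  define P where "P = (\<lambda>t. exp (\<i> * of_real \<alpha> * (l t - of_real (ln r))))"
  have Im_P: "0 < Im (P t)" if t: "t \<in> ?S" for t
  proof -
    have "\<alpha> * (Re (l t) - ln r) < \<alpha> * ln (R / r)" "0 < \<alpha> * (Re (l t) - ln r)"
      using Re_l[OF t] \<alpha> lnRr(1) by (simp_all)
    then have "0 < sin (\<alpha> * (Re (l t) - ln r))"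
      using lnRr(2) by (intro sin_gt_zero) (simp_all add: \<alpha>_def)
    then show ?thesis by (simp add: P_def Im_exp)
  qed
  have cmod_P: "cmod (P t) = exp (- \<alpha> * Im (l t))" for t
    by (simp add: P_def norm_exp_eq_Re)
  have half: "cmod (z - P 0) < cmod (z - cnj (P 0))" if z: "0 < Im z" for z
  proof -
    have "(cmod (z - cnj (P 0)))\<^sup>2 - (cmod (z - P 0))\<^sup>2 = 4 * (Im z * Im (P 0))"
      unfolding cmod_power2 by (simp add: power2_eq_square algebra_simps)
    moreover have "0 < Im z * Im (P 0)" using z Im_P[OF S(1)] by simp
    ultimately have "(cmod (z - P 0))\<^sup>2 < (cmod (z - cnj (P 0)))\<^sup>2" by linarith
    then show ?thesis by (rule power2_less_imp_less) simp
  qed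
  \<comment> \<open>The Cayley transform that sends P(0) to 0, precomposed with scaling by \<rho>.
    It is a self-map of the unit disc fixing 0, and the parameter 1 corresponds to 1/\<rho>.\<close>
  define F where "F = (\<lambda>t. (P (of_real \<rho> * t) - P 0) / (P (of_real \<rho> * t) - cnj (P 0)))"
  have in_S: "of_real \<rho> * t \<in> ?S" if "cmod t < 1" for t using that \<rho> by (simp add: norm_mult)
  have "cmod (F (1 / of_real \<rho>)) \<le> cmod (1 / of_real \<rho>)"
  proof (rule Schwarz_Lemma(1))
    have "(P \<circ> (\<lambda>t. of_real \<rho> * t)) holomorphic_on ball 0 1"
    proof (rule holomorphic_on_compose_gen)
      show "P holomorphic_on ?S" unfolding P_def by (intro holomorphic_intros l)
    qed (use in_S in \<open>auto intro!: holomorphic_intros\<close>)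
    then have "(\<lambda>t. P (of_real \<rho> * t)) holomorphic_on ball 0 1" by (simp add: o_def)
    moreover have "P (of_real \<rho> * t) - cnj (P 0) \<noteq> 0" if "t \<in> ball 0 1" for t
      using half[OF Im_P[OF in_S[of t]]] that by auto
    ultimately show "F holomorphic_on ball 0 1" unfolding F_def by (intro holomorphic_intros)
    show "cmod (F t) < 1" if "cmod t < 1" for t
      using half[OF Im_P[OF in_S[OF that]]] norm_ge_zero[of "P (of_real \<rho> * t) - P 0"]
      by (simp add: F_def norm_divide divide_less_eq)
  qed (use \<rho> in \<open>auto simp: F_def norm_divide\<close>)
  then have "cmod (P 1 - P 0) / cmod (P 1 - cnj (P 0)) \<le> 1 / \<rho>"
    using \<rho> by (simp add: F_def norm_divide)
  moreover have "0 < cmod (P 1 - cnj (P 0))"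
    using half[OF Im_P[OF S(2)]] norm_ge_zero le_less_trans by blast
  ultimately have "cmod (P 1 - P 0) * \<rho> \<le> cmod (P 1 - cnj (P 0))"
    using \<rho> by (simp add: divide_le_eq le_divide_eq)
  also have "\<dots> \<le> cmod (P 1) + cmod (P 0)" using norm_triangle_ineq4[of "P 1" "cnj (P 0)"] by simp
  finally have diff: "cmod (P 1 - P 0) * \<rho> \<le> cmod (P 1) + cmod (P 0)" .
  \<comment> \<open>Discards the arguments of P(0) and P(1): the Schwarz bound on |P(1) - P(0)|
    limits the quotient of the moduli by (\<rho> + 1)/(\<rho> - 1).\<close>
  have ratio: "x \<le> (\<rho> + 1) / (\<rho> - 1) * y" if "(x - y) * \<rho> \<le> x + y" for x y :: real
  proof -
    have "x * (\<rho> - 1) \<le> (\<rho> + 1) * y" using that by (simp add: algebra_simps)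
    then show ?thesis using \<rho> by (simp add: field_simps)
  qed
  have "(cmod (P 1) - cmod (P 0)) * \<rho> \<le> cmod (P 1 - P 0) * \<rho>" "(cmod (P 0) - cmod (P 1)) * \<rho> \<le> cmod (P 1 - P 0) * \<rho>"
    using \<rho> norm_triangle_ineq2[of "P 1" "P 0"] norm_triangle_ineq2[of "P 0" "P 1"]
    by (auto intro!: mult_right_mono simp: norm_minus_commute)
  then have "cmod (P 1) \<le> (\<rho> + 1) / (\<rho> - 1) * cmod (P 0)" "cmod (P 0) \<le> (\<rho> + 1) / (\<rho> - 1) * cmod (P 1)"
    using diff by - (rule ratio, linarith)+
  moreover have "(\<rho> + 1) / (\<rho> - 1) * cmod (P t) < exp (pi\<^sup>2 / (2 * ln (R / r))) * cmod (P t)" for t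
    using small cmod_P[of t] by (intro mult_strict_right_mono) auto
  ultimately have "cmod (P 1) < exp (pi\<^sup>2 / (2 * ln (R / r))) * cmod (P 0)"
    "cmod (P 0) < exp (pi\<^sup>2 / (2 * ln (R / r))) * cmod (P 1)" using le_less_trans by blast+
  \<comment> \<open>The threshold in \<open>small\<close> is exp(\<alpha> pi/2), so the bound on the
    moduli becomes |Im (l(1) - l(0))| < pi/2.\<close>
  moreover have "pi\<^sup>2 / (2 * ln (R / r)) = \<alpha> * (pi / 2)" by (simp add: \<alpha>_def power2_eq_square)
  ultimately have "- \<alpha> * Im (l 1) < \<alpha> * (pi / 2) + - \<alpha> * Im (l 0)"
    "- \<alpha> * Im (l 0) < \<alpha> * (pi / 2) + - \<alpha> * Im (l 1)"
    by (simp_all only: cmod_P exp_less_cancel_iff flip: exp_add)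
  then have "\<alpha> * (Im (l 0) - Im (l 1)) < \<alpha> * (pi / 2)" "\<alpha> * (Im (l 1) - Im (l 0)) < \<alpha> * (pi / 2)"
    by (simp_all add: algebra_simps)
  then have "Im (l 0) - Im (l 1) < pi / 2" "Im (l 1) - Im (l 0) < pi / 2"
    using \<alpha> by (simp_all only: mult_less_cancel_left_pos)
  then have "0 < cos (Im (l 0 - l 1))" by (intro cos_gt_zero_pi) auto
  moreover have "g 0 / g 1 = exp (l 0 - l 1)" using l(2)[OF S(1)] l(2)[OF S(2)] by (simp add: exp_diff)
  ultimately show ?thesis by (simp add: Re_exp)
qed

text \<open>The number 380/327 is 0.038 / (0.02 * 1.635), the tolerated noise over the largest
  possible noise of an orbit. At this value the quotient is 707/53, about 13.34, which is compared
  with exp 2.6 > 13.41; the bound ln(1.635/0.255) \<le> 1.86 makes the exponent at least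
  2.6.\<close>

lemma basilica_modulus:
  fixes \<rho> :: real
  assumes \<rho>: "380 / 327 < \<rho>"
  shows "(\<rho> + 1) / (\<rho> - 1) < exp (pi\<^sup>2 / (2 * ln (1.635 / 0.255)))"
proof -
  \<comment> \<open>Lower bounds for \<open>exp\<close> at 2.6 and at 1.86 come from the quadratic
    Taylor polynomial at 1/32 of the argument, followed by five squarings with rounding
    down.\<close>
  have "1.08455 \<le> 1 + 2.6 / 32 + (2.6 / 32)\<^sup>2 / (2 :: real)" by (simp add: power2_eq_square)
  also have "\<dots> \<le> exp (2.6 / 32)" by (rule exp_lower_Taylor_quadratic) simp
  finally have "1.08455 \<le> exp (2.6 / 32 :: real)" .
  then have "1.1762 \<le> exp (2.6 / 16 :: real)" by (rule le_exp_double) simp_all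
  then have "1.3834 \<le> exp (2.6 / 8 :: real)" by (rule le_exp_double) simp_all
  then have "1.9137 \<le> exp (2.6 / 4 :: real)" by (rule le_exp_double) simp_all
  then have "3.6622 \<le> exp (2.6 / 2 :: real)" by (rule le_exp_double) simp_all
  then have "13.41 \<le> exp (2.6 :: real)" by (rule le_exp_double) simp_all
  note exp26 = this
  have "1.05981 \<le> 1 + 1.86 / 32 + (1.86 / 32)\<^sup>2 / (2 :: real)" by (simp add: power2_eq_square)
  also have "\<dots> \<le> exp (1.86 / 32)" by (rule exp_lower_Taylor_quadratic) simp
  finally have "1.05981 \<le> exp (1.86 / 32 :: real)" .
  then have "1.12319 \<le> exp (1.86 / 16 :: real)" by (rule le_exp_double) simp_all
  then have "1.26155 \<le> exp (1.86 / 8 :: real)" by (rule le_exp_double) simp_all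
  then have "1.5915 \<le> exp (1.86 / 4 :: real)" by (rule le_exp_double) simp_all
  then have "2.53287 \<le> exp (1.86 / 2 :: real)" by (rule le_exp_double) simp_all
  then have "6.4154 \<le> exp (1.86 :: real)" by (rule le_exp_double) simp_all
  then have "1.635 / 0.255 \<le> exp (1.86 :: real)" by (rule order_trans[rotated]) simp
  then have "ln (1.635 / 0.255) \<le> ln (exp (1.86 :: real))" by (subst ln_le_cancel_iff) auto
  then have ln: "ln (1.635 / 0.255) \<le> (1.86 :: real)" by simp
  have "(3.11 :: real)\<^sup>2 \<le> pi\<^sup>2" using pi_ge_311 by (intro power_mono) auto
  moreover have "2.6 * (2 * 1.86) \<le> (3.11 :: real)\<^sup>2" by (simp add: power2_eq_square)
  moreover have "2.6 * (2 * ln (1.635 / 0.255)) \<le> 2.6 * (2 * (1.86 :: real))" using ln by simp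
  ultimately have "2.6 * (2 * ln (1.635 / 0.255)) \<le> pi\<^sup>2" by linarith
  moreover have "0 < 2 * ln (1.635 / 0.255 :: real)" by (simp add: ln_gt_zero)
  ultimately have "2.6 \<le> pi\<^sup>2 / (2 * ln (1.635 / 0.255))" by (simp only: pos_le_divide_eq)
  then have "exp 2.6 \<le> exp (pi\<^sup>2 / (2 * ln (1.635 / 0.255)))" by simp
  moreover have "(\<rho> + 1) / (\<rho> - 1) < 13.41"
  proof -
    have "\<rho> - 1 > 0" "\<rho> + 1 < 13.41 * (\<rho> - 1)" using \<rho> by simp_all
    then show ?thesis by (simp only: pos_divide_less_eq)
  qed
  ultimately show ?thesis using exp26 by linarith
qed

text \<open>The discs of radius \<open>0.255\<close> about \<open>0\<close> and \<open>0.1031\<close> about \<open>-1\<close>, which surround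
  the superattracting cycle, are mapped into one another by \<open>z\<^sup>2 - 1\<close> with a noise of at most
  \<open>0.038\<close>.\<close>

definition basilica_region :: "complex set"
  where "basilica_region = {w. 0.255 < cmod w \<and> 0.1031 < cmod (w + 1) \<and> cmod w < 1.635}"

text \<open>The constants are nearly sharp solutions of 0.255^2 + k < 0.1031, 0.1031 * 2.1031 + k <
  0.255 and 1 + 1.635 + k < 1.635^2 with k = 0.038; the factor 2.1031 bounds |x - 1| near -1. The
  same inequalities govern trapping and pulling back.\<close>

lemma henon_shadow_region_basilica:
  fixes b :: complex
  assumes b: "b \<noteq> 0" and lt: "cmod b < 0.02"
  shows "henon_shadow_region (- 1) basilica_region 1.635 0.038 (1 / 20000) b"
proof
  have bR: "cmod b * 1.635 < 0.0327" using lt by simp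
  show "open basilica_region"
    unfolding basilica_region_def by (intro open_Collect_conj open_Collect_less continuous_intros)
  show "basilica_region \<subseteq> ball 0 1.635" by (auto simp: basilica_region_def)
  show "cmod b * 1.635 < 0.038" using bR by simp
  show "cmod (- 1) + (1 + cmod b) * 1.635 < 1.635\<^sup>2" using bR by (simp add: power2_eq_square)
  show "0 < cmod b * 1.635" using b by simp
next
  fix w e v :: complex assume w: "w \<in> basilica_region" and e: "cmod e < 0.038" and v: "v\<^sup>2 = w - - 1 + e"
  have w': "0.255 < cmod w" "0.1031 < cmod (w + 1)" "cmod w < 1.635"
    using w by (auto simp: basilica_region_def)
  have "(cmod v)\<^sup>2 = cmod ((w + 1) + e)" using v by (simp flip: norm_power)
  then have v2: "0.0651 < (cmod v)\<^sup>2" "(cmod v)\<^sup>2 < 2.673"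
    using w' e norm_diff_ineq[of "w + 1" e] norm_triangle_ineq[of "w + 1" e] norm_triangle_ineq[of w 1] by auto
  \<comment> \<open>The three bounds 0.25505, 1.63495 and 0.10315 are the boundary values of the
    region moved inwards by the margin 1/20000.\<close>
  have v_ge: "0.25505 < cmod v"
    by (rule power2_less_imp_less) (use v2(1) in \<open>simp_all add: power2_eq_square\<close>)
  have v_le: "cmod v < 1.63495"
    by (rule power2_less_imp_less) (use v2(2) in \<open>simp_all add: power2_eq_square\<close>)
  have v1: "0.10315 < cmod (v + 1)"
  proof (rule ccontr)
    assume "\<not> 0.10315 < cmod (v + 1)"
    moreover have "cmod (v - 1) \<le> cmod (v + 1) + 2" using norm_triangle_ineq4[of "v + 1" 2] by simp
    ultimately have "cmod (v + 1) * cmod (v - 1) \<le> 0.10315 * 2.10315" by (intro mult_mono) auto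
    moreover have "(v + 1) * (v - 1) = w + e" using v by (simp add: power2_eq_square algebra_simps)
    then have "cmod (v + 1) * cmod (v - 1) = cmod (w + e)" by (metis norm_mult)
    ultimately show False using w' e norm_diff_ineq[of w e] by simp
  qed
  have "ball v (1 / 20000) \<subseteq> basilica_region"
  proof
    fix y assume "y \<in> ball v (1 / 20000)"
    then have "cmod (v - y) < 0.00005" by (simp add: dist_norm)
    then show "y \<in> basilica_region"
      using v_ge v_le v1 norm_triangle_ineq2[of v y] norm_triangle_ineq2[of y v] norm_triangle_ineq2[of "v + 1" "y + 1"]
      by (simp add: basilica_region_def norm_minus_commute)
  qed
  then show "v \<noteq> 0 \<and> ball v (1 / 20000) \<subseteq> basilica_region" using v_ge by auto
next
  fix x y :: complex assume x: "x \<in> ball 0 1.635 - basilica_region" and y: "cmod y < 1.635"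
  have "cmod b * cmod y \<le> 0.02 * 1.635" using y lt by (intro mult_mono) auto
  then have bR: "cmod (b * y) \<le> 0.0327" by (simp add: norm_mult)
  let ?W = "ball 0 0.255 \<union> ball (- 1) 0.1031 :: complex set"
  consider "cmod x \<le> 0.255" | "cmod (x + 1) \<le> 0.1031" using x by (auto simp: basilica_region_def)
  then have "x\<^sup>2 + - 1 - b * y \<in> ?W"
  proof cases
    case 1
    then have "cmod x * cmod x \<le> 0.255 * 0.255" by (intro mult_mono) auto
    then have "cmod (x\<^sup>2 - b * y) < 0.1031"
      using bR norm_triangle_ineq4[of "x\<^sup>2" "b * y"] by (simp add: norm_mult power2_eq_square)
    then have "x\<^sup>2 + - 1 - b * y \<in> ball (- 1) 0.1031" by (simp add: dist_norm norm_minus_commute algebra_simps)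
    then show ?thesis by blast
  next
    case 2
    moreover have "cmod (x - 1) \<le> cmod (x + 1) + 2" using norm_triangle_ineq4[of "x + 1" 2] by simp
    ultimately have "cmod (x + 1) * cmod (x - 1) \<le> 0.1031 * 2.1031" by (intro mult_mono) auto
    then have "cmod ((x + 1) * (x - 1) - b * y) < 0.255"
      using bR norm_triangle_ineq4[of "(x + 1) * (x - 1)" "b * y"] by (simp add: norm_mult)
    moreover have "(x + 1) * (x - 1) - b * y = x\<^sup>2 + - 1 - b * y" by (simp add: power2_eq_square algebra_simps)
    ultimately have "x\<^sup>2 + - 1 - b * y \<in> ball 0 0.255" by simp
    then show ?thesis by blast
  qed
  moreover have "?W \<subseteq> ball 0 1.635 - basilica_region"
  proof
    fix z assume "z \<in> ?W"
    moreover have "cmod z \<le> cmod (z + 1) + 1" using norm_triangle_ineq4[of "z + 1" 1] by simp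
    moreover have "dist (- 1) z = cmod (z + 1)" by (simp add: dist_norm norm_minus_commute)
    ultimately show "z \<in> ball 0 1.635 - basilica_region" by (auto simp: basilica_region_def)
  qed
  ultimately show "x\<^sup>2 + - 1 - b * y \<in> interior (ball 0 1.635 - basilica_region)"
    by (meson interiorI open_Un open_ball)
next
  fix m and v :: "nat \<Rightarrow> complex \<Rightarrow> complex" and e :: "nat \<Rightarrow> complex"
  let ?\<rho> = "0.038 / (cmod b * 1.635)"
  assume v: "\<And>i. v i holomorphic_on ball 0 ?\<rho>" "\<And>i t. t \<in> ball 0 ?\<rho> \<Longrightarrow> v i t \<in> basilica_region"
  \<comment> \<open>The region lies in the annulus between the radii 0.255 and 1.635 about 0, and
    the Schwarz estimate for functions on the disc of radius \<rho> with values in it controls the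
    argument of v_0. Here \<rho> > 380/327 follows from |b| < 0.02.\<close>
  have bR: "0 < cmod b * 1.635" "cmod b * 1.635 < 0.0327" using lt b by simp_all
  have \<rho>: "380 / 327 < ?\<rho>" using bR by (simp add: field_simps)
  show "0 < Re (v 0 0 / v 0 1)"
  proof (rule annulus_valued_argument)
    show "1 < ?\<rho>" using \<rho> by simp
    show "v 0 holomorphic_on ball 0 ?\<rho>" by (rule v(1))
    show "0.255 < cmod (v 0 t) \<and> cmod (v 0 t) < 1.635" if "t \<in> ball 0 ?\<rho>" for t
      using v(2)[OF that, of 0] by (simp add: basilica_region_def)
    show "(?\<rho> + 1) / (?\<rho> - 1) < exp (pi\<^sup>2 / (2 * ln (1.635 / 0.255)))"
      by (rule basilica_modulus[OF \<rho>])
  qed simp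
qed (use b in auto)

lemma is_conjugacy_basilica:
  fixes b :: complex
  assumes b: "b \<noteq> 0" and lt: "cmod b < 0.02"
  shows "is_conjugacy (julia2 (henon (- 1) b)) (henon (- 1) b)
    (inverse_limit (julia1 (\<lambda>z. z\<^sup>2 - 1)) (\<lambda>z. z\<^sup>2 - 1)) (natural_shift (\<lambda>z. z\<^sup>2 - 1))
    (shadowing_map (- 1) b)"
proof -
  interpret henon_shadow_region "- 1" basilica_region "1.635" "0.038" "1 / 20000" b
    by (rule henon_shadow_region_basilica[OF b lt])
  have "(\<lambda>z. z\<^sup>2 - 1) = (\<lambda>z. z\<^sup>2 + (- 1) :: complex)" by simp
  then show ?thesis using julia1_quadratic by (intro is_conjugacy_shadowing_map) auto
qed

theorem corollary1p3:
  fixes b c :: complex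
  assumes "b \<noteq> 0"
  shows
    "(cmod c > 2 * (1 + cmod b)\<^sup>2 \<longrightarrow>
        topologically_conjugate (julia2 (henon c b)) (henon c b)
          (UNIV :: (int \<Rightarrow> bool) set) full_shift) \<and>
     (c = 0 \<and> cmod b < (sqrt 2 - 1) / 2 \<longrightarrow>
        topologically_conjugate (julia2 (henon c b)) (henon c b)
          (inverse_limit (sphere 0 1) (\<lambda>z. z\<^sup>2)) (natural_shift (\<lambda>z. z\<^sup>2 :: complex))) \<and>
     (c = - 1 \<and> cmod b < 0.02 \<longrightarrow>
        topologically_conjugate (julia2 (henon c b)) (henon c b)
          (inverse_limit (julia1 (\<lambda>z. z\<^sup>2 - 1)) (\<lambda>z. z\<^sup>2 - 1)) (natural_shift (\<lambda>z. z\<^sup>2 - 1))) \<and>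
     (cmod c > 2 * (1 + cmod b)\<^sup>2 \<longrightarrow>
        is_conjugacy (julia2 (henon c b)) (henon c b)
          (UNIV :: (int \<Rightarrow> bool) set) full_shift (horseshoe_map c b)) \<and>
     (c = 0 \<and> cmod b < (sqrt 2 - 1) / 2 \<longrightarrow>
        is_conjugacy (julia2 (henon c b)) (henon c b)
          (inverse_limit (sphere 0 1) (\<lambda>z. z\<^sup>2)) (natural_shift (\<lambda>z. z\<^sup>2)) (shadowing_map c b)) \<and>
     (c = - 1 \<and> cmod b < 0.02 \<longrightarrow>
        is_conjugacy (julia2 (henon c b)) (henon c b)
          (inverse_limit (julia1 (\<lambda>z. z\<^sup>2 - 1)) (\<lambda>z. z\<^sup>2 - 1)) (natural_shift (\<lambda>z. z\<^sup>2 - 1))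
          (shadowing_map c b))"
  using is_conjugacy_horseshoe_map[OF assms] is_conjugacy_solenoid[OF assms] is_conjugacy_basilica[OF assms]
  unfolding topologically_conjugate_def by blast

end
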